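(* Let $\alpha$ and $d$ be positive constants with $\alpha\le 1$ and $d<\pi$, and let $\mathscr{D}=\psi(\mathscr{D}_d)$. Let $g$ be continuous on $[a,b]$ and $k$ continuous on $[a,b]\times[a,b]$. Assume that $g$, $k(z,\cdot)$ and $k(\cdot,w)$ belong to $\mathbf{H}^\infty(\mathscr{D})$ for all $z,w\in\mathscr{D}$, and that $g$, $k(t,\cdot)$ and $k(\cdot,s)$ belong to $C([a,b])$ for all $t,s\in[a,b]$. Furthermore, assume that $g\in\mathbf{M}_\alpha(\mathscr{D})$ and that $k(\cdot,w)$ belongs to $\mathbf{M}_\alpha(\mathscr{D})$ uniformly with respect to $w\in\mathscr{D}$. For each positive integer $N$ let $h=\sqrt{\pi d/(\alpha N)}$ and $n=2N+1$. Let $u$ be the solution of $$u(t)-\int_a^t k(t,s)u(s)\,ds=g(t),\qquad a\le t\le b.$$ Then there exists a positive integer $N_0$ such that for all $N\ge N_0$ the matrix $I_n-V_n^{SE}$ is invertible. Furthermore, there exists a constant $C$ independent of $N$ such that for all $N\ge N_0$, $$\|u-v_N^{SE}\|_{C([a,b])}\le C\sqrt{N}\,e^{-\sqrt{\pi d\alpha N}},$$ where $v_N^{SE}$ is the approximate solution of Stenger's SE-Sinc-collocation method (defined in the context).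
   Context: $a<b$ are real; $\|\cdot\|_{C([a,b])}$ is the uniform norm. Transformation: $\psi(x)=\frac{b-a}{2}\tanh\left(\frac{x}{2}\right)+\frac{b+a}{2}$, $\phi=\psi^{-1}:(a,b)\to\mathbb{R}$, $t_j=\psi(jh)$. Strip: $\mathscr{D}_d=\{\zeta\in\mathbb{C}:|\mathrm{Im}\,\zeta|<d\}$, and $\psi(\mathscr{D}_d)=\{\psi(\zeta):\zeta\in\mathscr{D}_d\}$, a simply connected domain containing $(a,b)$. Function spaces: $\mathbf{H}^\infty(\mathscr{D})$ is the family of analytic functions $f$ on $\mathscr{D}$ with $\sup_{z\in\mathscr{D}}|f(z)|<\infty$. $\mathbf{M}_\alpha(\mathscr{D})$ is the family of $f\in\mathbf{H}^\infty(\mathscr{D})$ for which there is a constant $L$ with $|f(z)-f(a)|\le L|z-a|^\alpha$ and $|f(b)-f(z)|\le L|b-z|^\alpha$ for all $z\in\mathscr{D}$ ($f(a),f(b)$ being the values of $f$ at the endpoints, which are boundary points of $\mathscr{D}$). For a two-variable function $k$, "$k(\cdot,w)$ belongs to $\mathbf{M}_\alpha(\mathscr{D})$ uniformly with respect to $w\in\mathscr{D}$" means there is a constant $L_k$ independent of $w$ with $|k(z,w)-k(a,w)|\le L_k|z-a|^\alpha$ and $|k(b,w)-k(z,w)|\le L_k|b-z|^\alpha$ for all $z,w\in\mathscr{D}$. Method: $S(j,h)(x)=\frac{\sin(\pi(x-jh)/h)}{\pi(x-jh)/h}$ for $x\neq jh$, $S(j,h)(jh)=1$ (with $S(j,h)(\phi(t))$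 extended to $t=a,b$ by limits); $\omega_a(t)=\frac{b-t}{b-a}$, $\omega_b(t)=\frac{t-a}{b-a}$; $\mathrm{Si}(x)=\int_0^x\frac{\sin t}{t}dt$; $\delta_m^{(-1)}=\frac12+\frac1\pi\mathrm{Si}(\pi m)$. $I_n$ is the identity matrix and $V_n^{SE}$ is the $n\times n$ matrix with entries $(V_n^{SE})_{ij}=k(t_i,t_j)\psi'(jh)\,h\,\delta^{(-1)}_{i-j}$, $i,j=-N,\dots,N$. Let $(u_{-N},\dots,u_N)^{\mathrm T}$ be the solution of $(I_n-V_n^{SE})\mathbf{u}_n=(g(t_{-N}),\dots,g(t_N))^{\mathrm T}$. Then $$v_N^{SE}(t)=u_{-N}\omega_a(t)+u_N\omega_b(t)+\sum_{j=-N}^N\{u_j-u_{-N}\omega_a(t_j)-u_N\omega_b(t_j)\}S(j,h)(\phi(t)).$$ *)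

theory Defs
  imports "HOL-Probability.Sinc_Integral" "Jordan_Normal_Form.Matrix"
begin

section \<open>The SE transformation and the domain\<close>

definition SE_psi :: "real \<Rightarrow> real \<Rightarrow> 'a::{banach,real_normed_field} \<Rightarrow> 'a" where
  "SE_psi a b x = of_real ((b - a) / 2) * tanh (x / 2) + of_real ((b + a) / 2)"

text \<open>Only meaningful on the open interval \<open>(a, b)\<close>, the range of \<open>SE_psi a b\<close> on the reals.\<close>
definition SE_phi :: "real \<Rightarrow> real \<Rightarrow> real \<Rightarrow> real" where
  "SE_phi a b = inv_into UNIV (SE_psi a b)"

definition strip :: "real \<Rightarrow> complex set" where
  "strip d = {\<zeta>. \<bar>Im \<zeta>\<bar> < d}"

definition SE_domain :: "real \<Rightarrow> real \<Rightarrow> real \<Rightarrow> complex set" where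
  "SE_domain a b d = SE_psi a b ` strip d"

section \<open>Function spaces\<close>

text \<open>
  Functions on a domain \<open>D\<close> and on \<open>[a, b]\<close> are represented by total functions on the
  complex plane, of which only the values on \<open>D\<close> and on \<open>[a, b]\<close> matter. The end points \<open>a\<close>
  and \<open>b\<close> lie on the boundary of \<open>D\<close>.
\<close>

definition Hinf :: "complex set \<Rightarrow> (complex \<Rightarrow> complex) set" where
  "Hinf D = {f. f analytic_on D \<and> bounded (f ` D)}"

definition end_Hoelder ::
  "real \<Rightarrow> real \<Rightarrow> real \<Rightarrow> complex set \<Rightarrow> real \<Rightarrow> (complex \<Rightarrow> complex) \<Rightarrow> bool" where
  "end_Hoelder a b \<alpha> D L f \<longleftrightarrow>
    (\<forall>z\<in>D. norm (f z - f (of_real a)) \<le> L * norm (z - of_real a) powr \<alpha> \<and>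
           norm (f (of_real b) - f z) \<le> L * norm (of_real b - z) powr \<alpha>)"

definition Malpha :: "real \<Rightarrow> real \<Rightarrow> real \<Rightarrow> complex set \<Rightarrow> (complex \<Rightarrow> complex) set" where
  "Malpha a b \<alpha> D = {f \<in> Hinf D. \<exists>L. end_Hoelder a b \<alpha> D L f}"

definition Malpha_uniformly ::
  "real \<Rightarrow> real \<Rightarrow> real \<Rightarrow> complex set \<Rightarrow> (complex \<Rightarrow> complex \<Rightarrow> complex) \<Rightarrow> bool" where
  "Malpha_uniformly a b \<alpha> D k \<longleftrightarrow>
    (\<forall>w\<in>D. (\<lambda>z. k z w) \<in> Hinf D) \<and> (\<exists>L. \<forall>w\<in>D. end_Hoelder a b \<alpha> D L (\<lambda>z. k z w))"

text \<open>
  The norm of \<open>C([a, b])\<close>. It is only applied to functions continuous on \<open>[a, b]\<close>, for which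
  the supremum is over a bounded set.
\<close>
definition uniform_norm :: "real \<Rightarrow> real \<Rightarrow> (real \<Rightarrow> complex) \<Rightarrow> real" where
  "uniform_norm a b f = (SUP t\<in>{a..b}. norm (f t))"

section \<open>The Volterra integral equation\<close>

definition volterra_solution ::
  "real \<Rightarrow> real \<Rightarrow> (complex \<Rightarrow> complex \<Rightarrow> complex) \<Rightarrow> (complex \<Rightarrow> complex) \<Rightarrow> (real \<Rightarrow> complex) \<Rightarrow> bool"
  where
  "volterra_solution a b k g u \<longleftrightarrow>
    continuous_on {a..b} u \<and>
    (\<forall>t\<in>{a..b}. u t - integral {a..t} (\<lambda>s. k (of_real t) (of_real s) * u s) = g (of_real t))"

section \<open>The SE-Sinc-collocation method\<close>

definition mesh_size :: "real \<Rightarrow> real \<Rightarrow> nat \<Rightarrow> real" where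
  "mesh_size \<alpha> d N = sqrt (pi * d / (\<alpha> * real N))"

definition node :: "real \<Rightarrow> real \<Rightarrow> real \<Rightarrow> int \<Rightarrow> real" where
  "node a b h j = SE_psi a b (of_int j * h)"

definition S :: "int \<Rightarrow> real \<Rightarrow> real \<Rightarrow> real" where
  "S j h x = (if x = of_int j * h then 1
    else sin (pi * (x - of_int j * h) / h) / (pi * (x - of_int j * h) / h))"

definition S_phi :: "real \<Rightarrow> real \<Rightarrow> int \<Rightarrow> real \<Rightarrow> real \<Rightarrow> real" where
  "S_phi a b j h t = (if a < t \<and> t < b then S j h (SE_phi a b t)
    else Lim (at t within {a<..<b}) (\<lambda>s. S j h (SE_phi a b s)))"

definition omega_a :: "real \<Rightarrow> real \<Rightarrow> real \<Rightarrow> real" where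
  "omega_a a b t = (b - t) / (b - a)"

definition omega_b :: "real \<Rightarrow> real \<Rightarrow> real \<Rightarrow> real" where
  "omega_b a b t = (t - a) / (b - a)"

definition delta_m1 :: "int \<Rightarrow> real" where
  "delta_m1 m = 1 / 2 + 1 / pi * Si (pi * of_int m)"

text \<open>
  The indices \<open>-N, \<dots>, N\<close> of the mathematical vectors and matrices correspond to the
  indices \<open>0, \<dots>, 2N\<close> here, that is, \<open>j\<close> is stored at position \<open>j + N\<close>.
\<close>

definition V_SE ::
  "real \<Rightarrow> real \<Rightarrow> (complex \<Rightarrow> complex \<Rightarrow> complex) \<Rightarrow> real \<Rightarrow> nat \<Rightarrow> complex mat" where
  "V_SE a b k h N = mat (2 * N + 1) (2 * N + 1) (\<lambda>(p, q).
    let i = int p - int N; j = int q - int N in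
      k (of_real (node a b h i)) (of_real (node a b h j)) *
      of_real (deriv (SE_psi a b :: real \<Rightarrow> real) (of_int j * h) * h * delta_m1 (i - j)))"

definition g_vec :: "real \<Rightarrow> real \<Rightarrow> (complex \<Rightarrow> complex) \<Rightarrow> real \<Rightarrow> nat \<Rightarrow> complex vec" where
  "g_vec a b g h N = vec (2 * N + 1) (\<lambda>p. g (of_real (node a b h (int p - int N))))"

definition SE_solution ::
  "real \<Rightarrow> real \<Rightarrow> (complex \<Rightarrow> complex \<Rightarrow> complex) \<Rightarrow> (complex \<Rightarrow> complex) \<Rightarrow> real \<Rightarrow> nat \<Rightarrow>
    complex vec \<Rightarrow> bool" where
  "SE_solution a b k g h N c \<longleftrightarrow>
    c \<in> carrier_vec (2 * N + 1) \<and>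
    mult_mat_vec (1\<^sub>m (2 * N + 1) - V_SE a b k h N) c = g_vec a b g h N"

definition v_SE :: "real \<Rightarrow> real \<Rightarrow> real \<Rightarrow> nat \<Rightarrow> complex vec \<Rightarrow> real \<Rightarrow> complex" where
  "v_SE a b h N c t =
    (let u = (\<lambda>j::int. vec_index c (nat (j + int N)));
         l = u (- int N); r = u (int N) in
      l * of_real (omega_a a b t) + r * of_real (omega_b a b t) +
      (\<Sum>j = - int N..int N.
        (u j - l * of_real (omega_a a b (node a b h j)) - r * of_real (omega_b a b (node a b h j))) *
        of_real (S_phi a b j h t)))"

end

theory Submission
  imports Defs "HOL-Complex_Analysis.Complex_Analysis" "HOL-Real_Asymp.Real_Asymp"
    "Jordan_Normal_Form.Determinant"
begin

text \<open>
  In the coordinate \<open>\<zeta>\<close> with \<open>z = SE_psi a b \<zeta>\<close> the domain becomes the strip \<open>\<bar>Im \<zeta>\<bar> < d\<close>, the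
  integral from \<open>a\<close> to \<open>t\<close> becomes an integral from \<open>- \<infinity>\<close> against an exponentially decaying weight,
  and Hoelder continuity at the end points becomes exponential convergence, like
  \<open>exp (- \<alpha> * \<bar>Re \<zeta>\<bar>)\<close>, to the end point values. The estimate rests on three facts.

  Regularity. The solution extends to a bounded holomorphic function \<open>U\<close> on the strip, and \<open>U\<close>
  converges at both ends at the rate just mentioned. The extension is the sum of a Neumann series
  (\<open>volterra_equation_holomorphic_solution\<close>). Integrals from \<open>- \<infinity>\<close> are replaced throughout by
  primitives that vanish at \<open>- \<infinity>\<close>; in the strip such primitives exist by Cauchy's theorem, and
  a bound on the integrand that depends on the real part only is integrated by the mean value
  inequality. That \<open>U\<close> restricts to the given solution is a uniqueness statement for the real
  equation (\<open>solution_agrees\<close>), and the behaviour at the ends is \<open>solution_end_decay\<close>.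

  Consistency. The error of Sinc interpolation at a real point \<open>x\<close> is \<open>sin (pi * x / h)\<close> times a
  Cauchy integral over the boundary of the strip, whose density carries the factor
  \<open>1 / sin (pi * \<zeta> / h)\<close> of size \<open>exp (- pi * d / h)\<close>. This gives \<open>sinc_interpolation_error\<close>. One
  integration by parts, which exploits the oscillation of the sine, gives
  \<open>sinc_indefinite_integral_error\<close>. Cutting the sums at \<open>N\<close> costs a geometric tail, of size
  \<open>exp (- \<alpha> * N * h) / h\<close> for interpolation. The mesh size makes the two exponents equal, and the
  factor \<open>1 / h\<close> is the source of \<open>sqrt N\<close>.

  Stability. The numbers \<open>delta_m1 m\<close> tend to \<open>1\<close> and \<open>0\<close> for \<open>m \<rightarrow> \<plusminus>\<infinity>\<close>, so the collocation matrix
  is a strictly lower triangular matrix, to which a discrete Gronwall inequality applies, up to a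
  perturbation that is small when \<open>h\<close> is small. This is \<open>sinc_volterra_stability\<close>; it yields both
  the invertibility of the matrix and a bound for the errors at the nodes by the quadrature
  errors.

  Finally the Lebesgue constant of Sinc interpolation, bounded by a multiple of \<open>sqrt N\<close>,
  transports the errors at the nodes to the whole interval (\<open>SE_approximation_error\<close>).
\<close>

section \<open>Contour integrals over rectangles and the sine kernel\<close>

text \<open>
  With the majorant given as a derivative, its integral is an increment of \<open>\<sigma>\<close>. Below \<open>\<sigma>\<close> is a
  multiple of \<open>arctan\<close>, so that the bound does not grow with the length of the segment.
\<close>

lemma cmod_contour_integral_horizontal_le:
  fixes f :: "complex \<Rightarrow> complex" and s t y :: real and \<sigma> \<sigma>' :: "real \<Rightarrow> real"
  assumes "s < t"
    and cont: "continuous_on (closed_segment (Complex s y) (Complex t y)) f"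
    and der: "\<And>x. (\<sigma> has_real_derivative \<sigma>' x) (at x)"
    and bnd: "\<And>x. s \<le> x \<Longrightarrow> x \<le> t \<Longrightarrow> cmod (f (Complex x y)) \<le> \<sigma>' x"
  shows "cmod (contour_integral (linepath (Complex s y) (Complex t y)) f) \<le> \<sigma> t - \<sigma> s"
proof -
  let ?p = "linepath (Complex s y) (Complex t y)"
  have lp: "?p v = Complex (s + v * (t - s)) y" for v
    by (auto simp: linepath_def complex_eq_iff algebra_simps)
  have diff: "Complex t y - Complex s y = of_real (t - s)"
    by (simp add: complex_eq_iff)
  have "(f has_contour_integral contour_integral ?p f) ?p"
    using contour_integrable_continuous_linepath[OF cont] by (rule has_contour_integral_integral)
  hence hi: "((\<lambda>v. f (?p v) * (Complex t y - Complex s y)) has_integral contour_integral ?p f) {0..1}"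
    by (simp add: has_contour_integral_linepath)
  have "((\<lambda>v. \<sigma>' (s + v * (t - s)) * (t - s)) has_integral
          (\<sigma> (s + 1 * (t - s)) - \<sigma> (s + 0 * (t - s)))) {0..1}"
  proof (rule fundamental_theorem_of_calculus)
    fix v :: real
    have "((\<lambda>v. \<sigma> (s + v * (t - s))) has_real_derivative \<sigma>' (s + v * (t - s)) * (t - s)) (at v)"
      by (rule DERIV_chain2[OF der]) (auto intro!: derivative_eq_intros)
    thus "((\<lambda>v. \<sigma> (s + v * (t - s))) has_vector_derivative \<sigma>' (s + v * (t - s)) * (t - s))
            (at v within {0..1})"
      by (simp add: has_real_derivative_iff_has_vector_derivative has_vector_derivative_at_within)
  qed simp
  hence hg: "((\<lambda>v. \<sigma>' (s + v * (t - s)) * (t - s)) has_integral (\<sigma> t - \<sigma> s)) {0..1}"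
    by simp
  have "cmod (integral {0..1} (\<lambda>v. f (?p v) * (Complex t y - Complex s y)))
          \<le> integral {0..1} (\<lambda>v. \<sigma>' (s + v * (t - s)) * (t - s))"
  proof (rule integral_norm_bound_integral)
    fix v :: real assume v: "v \<in> {0..1}"
    have "v * (t - s) \<le> 1 * (t - s)" using v \<open>s < t\<close> by (intro mult_right_mono) auto
    hence "s + v * (t - s) \<le> t" by (simp add: algebra_simps)
    moreover have "s \<le> s + v * (t - s)" using v \<open>s < t\<close> by simp
    ultimately    have "cmod (f (?p v)) \<le> \<sigma>' (s + v * (t - s))"
      unfolding lp by (intro bnd)
    thus "cmod (f (?p v) * (Complex t y - Complex s y)) \<le> \<sigma>' (s + v * (t - s)) * (t - s)"
      using \<open>s < t\<close> unfolding diff norm_mult norm_of_real by (simp add: mult_right_mono)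
  qed (use hi hg in blast)+
  thus ?thesis unfolding integral_unique[OF hi] integral_unique[OF hg] .
qed

lemma contour_integral_rectpath_split:
  fixes a c :: complex
  defines "b \<equiv> Complex (Re c) (Im a)" and "e \<equiv> Complex (Re a) (Im c)"
  assumes cont: "continuous_on (path_image (rectpath a c)) f"
  shows "contour_integral (rectpath a c) f = contour_integral (linepath a b) f
     + contour_integral (linepath b c) f + contour_integral (linepath c e) f
     + contour_integral (linepath e a) f"
proof -
  have rp: "rectpath a c = linepath a b +++ linepath b c +++ linepath c e +++ linepath e a"
    by (simp add: rectpath_def Let_def b_def e_def)
  have "path_image (rectpath a c) = closed_segment a b \<union> closed_segment b c
      \<union> closed_segment c e \<union> closed_segment e a"
    by (simp add: rp path_image_join Un_assoc)
  hence c1: "continuous_on (closed_segment a b) f" "continuous_on (closed_segment b c) f"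
    "continuous_on (closed_segment c e) f" "continuous_on (closed_segment e a) f"
    using cont by (auto elim: continuous_on_subset)
  show ?thesis
    unfolding rp using c1[THEN contour_integrable_continuous_linepath] by simp
qed

text \<open>
  The horizontal sides contribute at most the integral of \<open>B / (1 + \<xi>\<^sup>2)\<close> over the whole line, whatever
  \<open>R\<close> is; the contribution of the vertical sides is kept apart because it disappears when \<open>R\<close>
  tends to infinity.
\<close>

lemma cmod_contour_integral_rectpath_le:
  fixes f :: "complex \<Rightarrow> complex" and R y B V :: real
  assumes R: "0 < R" and y: "0 < y"
    and cont: "continuous_on (path_image (rectpath (Complex (-R) (-y)) (Complex R y))) f"
    and hor: "\<And>\<xi> \<eta>. \<bar>\<xi>\<bar> \<le> R \<Longrightarrow> \<bar>\<eta>\<bar> = y \<Longrightarrow> cmod (f (Complex \<xi> \<eta>)) \<le> B / (1 + \<xi>\<^sup>2)"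
    and ver: "\<And>\<xi> \<eta>. \<bar>\<xi>\<bar> = R \<Longrightarrow> \<bar>\<eta>\<bar> \<le> y \<Longrightarrow> cmod (f (Complex \<xi> \<eta>)) \<le> V"
  shows "cmod (contour_integral (rectpath (Complex (-R) (-y)) (Complex R y)) f)
           \<le> 2 * pi * B + 4 * y * V"
proof -
  let ?a = "Complex (-R) (-y)" and ?b = "Complex R (-y)" and ?c = "Complex R y" and ?e = "Complex (-R) y"
  have pim: "path_image (rectpath ?a ?c) = closed_segment ?a ?b \<union> closed_segment ?b ?c
      \<union> closed_segment ?c ?e \<union> closed_segment ?e ?a"
    by (simp add: rectpath_def Let_def path_image_join Un_assoc)
  have c1: "continuous_on (closed_segment ?a ?b) f" "continuous_on (closed_segment ?b ?c) f"
    "continuous_on (closed_segment ?c ?e) f" "continuous_on (closed_segment ?e ?a) f"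
    using cont unfolding pim by (auto elim: continuous_on_subset)
  note ci = c1[THEN contour_integrable_continuous_linepath]
  note split = contour_integral_rectpath_split[OF cont, unfolded complex.sel]
  have B0: "0 \<le> B" using hor[of 0 y] y R by (smt (verit) abs_of_pos divide_nonneg_pos norm_ge_zero power_zero_numeral div_by_1 abs_zero)
  have V0: "0 \<le> V" using ver[of R 0] y R by (smt (verit) norm_ge_zero)
  have der: "((\<lambda>x. B * arctan x) has_real_derivative B / (1 + x\<^sup>2)) (at x)" for x
    by (auto intro!: derivative_eq_intros simp: field_simps)
  have at: "B * arctan R - B * arctan (- R) \<le> pi * B"
  proof -
    have "arctan R - arctan (- R) \<le> pi" using arctan_bounded[of R] arctan_bounded[of "-R"] by linarith
    hence "B * (arctan R - arctan (- R)) \<le> B * pi" using B0 by (rule mult_left_mono)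
    thus ?thesis by (simp add: algebra_simps)
  qed
  have h1: "cmod (contour_integral (linepath ?a ?b) f) \<le> pi * B"
    by (rule order_trans[OF cmod_contour_integral_horizontal_le[OF _ c1(1) der] at])
       (use R y hor in auto)
  have cs: "continuous_on (closed_segment ?e ?c) f" using c1(3) by (simp add: closed_segment_commute)
  have h2': "cmod (contour_integral (linepath ?e ?c) f) \<le> pi * B"
    by (rule order_trans[OF cmod_contour_integral_horizontal_le[OF _ cs der] at])
       (use R y hor in auto)
  have h2: "cmod (contour_integral (linepath ?c ?e) f) \<le> pi * B"
    using h2' contour_integral_reverse_linepath[OF cs] by simp
  have seg: "\<bar>Re x\<bar> = R \<and> \<bar>Im x\<bar> \<le> y" if "x \<in> closed_segment ?b ?c \<union> closed_segment ?e ?a" for x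
  proof -
    from that obtain v where v: "0 \<le> v" "v \<le> 1" and
      x: "x = (1 - v) *\<^sub>R ?b + v *\<^sub>R ?c \<or> x = (1 - v) *\<^sub>R ?e + v *\<^sub>R ?a"
      by (auto simp: closed_segment_def)
    have "Im x = (2 * v - 1) * y \<or> Im x = (1 - 2 * v) * y" "Re x = R \<or> Re x = - R"
      using x by (auto simp: left_diff_distrib)
    moreover have "\<bar>(2 * v - 1) * y\<bar> \<le> 1 * y" "\<bar>(1 - 2 * v) * y\<bar> \<le> 1 * y"
      unfolding abs_mult using v y by (auto intro!: mult_mono)
    ultimately show ?thesis using R by auto
  qed
  have ver': "cmod (f x) \<le> V" if "x \<in> closed_segment ?b ?c \<union> closed_segment ?e ?a" for x
    using ver[of "Re x" "Im x"] seg[OF that] by simp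
  have l: "cmod (?c - ?b) = 2 * y" "cmod (?a - ?e) = 2 * y"
    using y by (auto simp: cmod_def real_sqrt_mult)
  have h3: "cmod (contour_integral (linepath ?b ?c) f) \<le> V * (2 * y)"
    using contour_integral_bound_linepath[OF ci(2) V0] ver' l by force
  have h4: "cmod (contour_integral (linepath ?e ?a) f) \<le> V * (2 * y)"
    using contour_integral_bound_linepath[OF ci(4) V0] ver' l by force
  have "cmod (contour_integral (rectpath ?a ?c) f) \<le> pi * B + V * (2 * y) + pi * B + V * (2 * y)"
    unfolding split by (intro order_trans[OF norm_triangle_ineq] add_mono h1 h2 h3 h4)
  thus ?thesis by (simp add: algebra_simps)
qed

lemma norm_sin_complex: "(cmod (sin z))\<^sup>2 = (sin (Re z))\<^sup>2 + (sinh (Im z))\<^sup>2"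
proof -
  have "sin z = Complex (sin (Re z) * cosh (Im z)) (cos (Re z) * sinh (Im z))"
    by (simp add: complex_eq_iff Re_sin Im_sin cosh_def sinh_def exp_minus field_simps)
  hence "(cmod (sin z))\<^sup>2 = (sin (Re z))\<^sup>2 * (cosh (Im z))\<^sup>2 + (cos (Re z))\<^sup>2 * (sinh (Im z))\<^sup>2"
    by (simp add: cmod_power2 power_mult_distrib)
  also have "\<dots> = (sin (Re z))\<^sup>2 + (sinh (Im z))\<^sup>2"
    by (simp add: cosh_square_eq cos_squared_eq algebra_simps)
  finally show ?thesis .
qed

text \<open>
  The numerator may vanish at \<open>z\<close>, in which case the singularity is removable and the residue is
  zero. This case occurs below: the interpolated function may have zeros at nodes.
\<close>

lemma residue_simple_zero:
  assumes s: "open s" "z \<in> s" and f: "f holomorphic_on s" and g: "g holomorphic_on s"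
    and gz: "g z = 0" and g': "(g has_field_derivative g') (at z)" "g' \<noteq> 0"
    and nz: "\<And>w. w \<in> s - {z} \<Longrightarrow> g w \<noteq> 0"
  shows "residue (\<lambda>w. f w / g w) z = f z / g'"
proof (rule residue_simple'[OF s])
  show "(\<lambda>w. f w / g w) holomorphic_on s - {z}"
    by (intro holomorphic_on_divide holomorphic_on_subset[OF f] holomorphic_on_subset[OF g] nz) auto
  have "((\<lambda>w. (g w - g z) / (w - z)) \<longlongrightarrow> g') (at z)"
    using g'(1) by (simp add: has_field_derivative_iff)
  moreover have "(f \<longlongrightarrow> f z) (at z)"
    using f s by (metis holomorphic_on_imp_continuous_on continuous_on_eq_continuous_at isCont_def)
  ultimately have "((\<lambda>w. f w / ((g w - g z) / (w - z))) \<longlongrightarrow> f z / g') (at z)"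
    using g'(2) by (intro tendsto_divide)
  thus "((\<lambda>w. f w / g w * (w - z)) \<longlongrightarrow> f z / g') (at z)"
    by (simp add: gz)
qed

lemma strip_open [simp]: "open (strip d)" and strip_convex [simp]: "convex (strip d)"
proof -
  have e: "strip d = {z. Im z < d} \<inter> {z. Im z > -d}" by (auto simp: strip_def)
  show "open (strip d)" unfolding e by (intro open_Int open_halfspace_Im_lt open_halfspace_Im_gt)
  show "convex (strip d)" unfolding e by (intro convex_Int convex_halfspace_Im_lt convex_halfspace_Im_gt)
qed

lemma sin_scaled_eq_0_iff:
  fixes z :: complex and h :: real
  assumes "0 < h"
  shows "sin (of_real pi * z / of_real h) = 0 \<longleftrightarrow> (\<exists>j::int. z = of_real (of_int j * h))"
proof -
  have "(of_real pi * z / of_real h = of_real (of_int j * pi)) = (z = of_real (of_int j * h))" for j :: int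
    using assms by (auto simp: field_simps)
  thus ?thesis by (simp add: sin_eq_0)
qed

lemma S_eq_sinc: "S j h x = sinc (pi * (x - of_int j * h) / h)" if "0 < h"
  using that by (auto simp: S_def)

lemma sin_pi_int [simp]: "sin (pi * of_int j) = 0"
  by (simp add: sin_zero_iff_int2 mult.commute)

lemma cos_pi_int_squared: "cos (pi * of_int j) * cos (pi * of_int j) = 1"
  using sin_cos_squared_add[of "pi * of_int j"] by (simp add: power2_eq_square)

lemma S_at_nonnode:
  assumes "0 < h" "x \<noteq> of_int j * h"
  shows "S j h x = - sin (pi * x / h) * (h / (pi * cos (pi * of_int j))) / (of_int j * h - x)"
proof -
  have "sin (pi * (x - of_int j * h) / h) = sin (pi * x / h - pi * of_int j)"
    using assms(1) by (simp add: field_simps)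
  also have "\<dots> = sin (pi * x / h) * cos (pi * of_int j)"
    by (simp add: sin_diff)
  finally have *: "sin (pi * (x - of_int j * h) / h) = sin (pi * x / h) * cos (pi * of_int j)" .
  have c: "cos (pi * of_int j) = inverse (cos (pi * of_int j))"
    using cos_pi_int_squared[of j] by (metis inverse_unique)
  show ?thesis using assms unfolding S_def * by (subst c) (simp add: field_simps)
qed

lemma S_at_node:
  assumes "0 < h"
  shows "S j h (of_int i * h) = (if i = j then 1 else 0)"
proof (cases "i = j")
  case False
  have "pi * (of_int i * h - of_int j * h) / h = pi * of_int (i - j)"
    using assms by (simp add: field_simps)
  thus ?thesis using False assms unfolding S_def by (simp del: of_int_diff)
qed (simp add: S_def)

lemma abs_S_le_1: "\<bar>S j h x\<bar> \<le> 1"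
proof (cases "x = of_int j * h")
  case False
  have "\<bar>sin (pi * (x - of_int j * h) / h)\<bar> \<le> \<bar>pi * (x - of_int j * h) / h\<bar>"
    by (rule abs_sin_x_le_abs_x)
  moreover have "\<bar>s\<bar> \<le> \<bar>w\<bar> \<Longrightarrow> \<bar>s / w\<bar> \<le> 1" for s w :: real
    by (cases "w = 0") (simp_all add: abs_divide)
  ultimately have "\<bar>sin (pi * (x - of_int j * h) / h) / (pi * (x - of_int j * h) / h)\<bar> \<le> 1"
    by blast
  thus ?thesis using False by (simp only: S_def if_False)
qed (simp add: S_def)

definition rect :: "real \<Rightarrow> real \<Rightarrow> real \<Rightarrow> complex" where
  "rect R y = rectpath (Complex (- R) (- y)) (Complex R y)"

lemma path_image_rect:
  assumes "0 < R" "0 < y"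
  shows "path_image (rect R y) = {z. \<bar>Re z\<bar> \<le> R \<and> \<bar>Im z\<bar> \<le> y \<and> (\<bar>Re z\<bar> = R \<or> \<bar>Im z\<bar> = y)}"
  unfolding rect_def using assms
  by (subst path_image_rectpath) (auto simp: abs_le_iff abs_if split: if_splits)

text \<open>
  The vertical sides lie half way between two nodes.
\<close>

lemma sin_nonzero_on_rect:
  assumes h: "0 < h" and y: "0 < y" and z: "z \<in> path_image (rect ((of_nat M + 1/2) * h) y)"
  shows "sin (of_real pi * z / of_real h) \<noteq> 0"
proof
  assume "sin (of_real pi * z / of_real h) = 0"
  then obtain j :: int where j: "z = of_real (of_int j * h)" by (auto simp: sin_scaled_eq_0_iff[OF h])
  have "0 < (of_nat M + 1/2) * h" using h by simp
  hence "\<bar>of_int j * h\<bar> = (of_nat M + 1/2) * h"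
    using z y by (auto simp: path_image_rect j)
  hence "\<bar>real_of_int j\<bar> = real M + 1/2" using h by (simp add: abs_mult)
  hence "2 * \<bar>j\<bar> = 2 * int M + 1" by linarith
  thus False by presburger
qed

text \<open>
  By the residue theorem the contour integral is the sum of the residue \<open>F x / sin (pi * x / h)\<close> at
  the pole \<open>x\<close> and of residues at the nodes \<open>j * h\<close>. Multiplication by \<open>sin (pi * x / h)\<close> turns the
  latter into \<open>- F (j * h) * S j h x\<close>. If \<open>x\<close> is itself a node, both sides vanish.
\<close>

lemma sinc_interpolation_contour:
  fixes F :: "complex \<Rightarrow> complex" and h x y d :: real and M :: nat
  defines "R \<equiv> (of_nat M + 1/2) * h"
  assumes F: "F holomorphic_on strip d" and h: "0 < h" and y: "0 < y" "y < d" and x: "\<bar>x\<bar> < R"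
  shows "F (of_real x) - (\<Sum>j = - int M..int M. F (of_real (of_int j * h)) * of_real (S j h x))
    = of_real (sin (pi * x / h)) / (2 * of_real pi * \<i>) *
      contour_integral (rect R y) (\<lambda>\<zeta>. F \<zeta> / sin (of_real pi * \<zeta> / of_real h) / (\<zeta> - of_real x))"
proof (cases "\<exists>i::int. x = of_int i * h")
  case True
  then obtain i :: int where i: "x = of_int i * h" by blast
  have "\<bar>real_of_int i\<bar> * h < (real M + 1/2) * h" using x h unfolding R_def i by (simp add: abs_mult)
  hence "\<bar>real_of_int i\<bar> < real M + 1/2" using h by (simp only: mult_less_cancel_right_pos)
  hence iM: "i \<in> {- int M..int M}" by auto
  have "(\<Sum>j = - int M..int M. F (of_real (of_int j * h)) * of_real (S j h x))
      = (\<Sum>j = - int M..int M. if j = i then F (of_real x) else 0)"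
    by (intro sum.cong refl) (auto simp: i S_at_node[OF h])
  also have "\<dots> = F (of_real x)" using iM by simp
  finally have *: "F (of_real x) - (\<Sum>j = - int M..int M. F (of_real (of_int j * h)) * of_real (S j h x)) = 0"
    by simp
  have "sin (pi * x / h) = 0" using h by (simp add: i mult.commute)
  thus ?thesis unfolding * by simp
next
  case False
  define g where "g = (\<lambda>\<zeta>::complex. sin (of_real pi * \<zeta> / of_real h))"
  define f where "f = (\<lambda>\<zeta>. F \<zeta> / g \<zeta> / (\<zeta> - of_real x))"
  define X :: complex where "X = of_real x"
  define nd where "nd = (\<lambda>j::int. complex_of_real (of_int j * h))"
  define Q where "Q = strip d \<inter> {z. Re z < (of_nat M + 1) * h} \<inter> {z. Re z > - ((of_nat M + 1) * h)}"
  define A where "A = {- int M..int M}"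
  define pts where "pts = insert X (nd ` A)"
  have R: "0 < R" "R < (of_nat M + 1) * h" using h unfolding R_def by auto
  have oQ: "open Q" unfolding Q_def by (intro open_Int strip_open open_halfspace_Re_lt open_halfspace_Re_gt)
  have cQ: "convex Q" unfolding Q_def by (intro convex_Int strip_convex convex_halfspace_Re_lt convex_halfspace_Re_gt)
  have FQ: "F holomorphic_on Q" using F by (rule holomorphic_on_subset) (auto simp: Q_def)
  have gh: "g holomorphic_on T" for T unfolding g_def using h by (intro holomorphic_intros) auto
  have g0: "g z = 0 \<longleftrightarrow> (\<exists>j. z = nd j)" for z
    unfolding g_def nd_def by (rule sin_scaled_eq_0_iff[OF h])
  have ndQ: "j \<in> A" if "nd j \<in> Q" for j
  proof -
    have "real_of_int j * h < (of_nat M + 1) * h" "(- (of_nat M + 1)) * h < real_of_int j * h"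
      using that by (auto simp: Q_def nd_def algebra_simps)
    hence "real_of_int j < of_nat M + 1" "- (of_nat M + 1) < real_of_int j"
      using h by (simp_all only: mult_less_cancel_right_pos)
    thus ?thesis by (auto simp: A_def)
  qed
  have inj: "inj nd" using h by (auto simp: inj_on_def nd_def)
  have Xnd: "X \<noteq> nd j" for j unfolding X_def nd_def of_real_eq_iff using False by blast
  have gnz: "g z \<noteq> 0" if "z \<in> Q - nd ` A" for z using that ndQ by (auto simp: g0)
  have fholo: "f holomorphic_on Q - pts"
    unfolding f_def by (intro holomorphic_intros holomorphic_on_subset[OF FQ] gh)
      (auto simp: pts_def X_def intro: gnz[THEN notE] )
  have inbox: "p \<in> box (Complex (-R) (-y)) (Complex R y)" if "p \<in> pts" for p
  proof -
    have "- R < real_of_int j * h \<and> real_of_int j * h < R" if "j \<in> A" for j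
    proof -
      have "\<bar>real_of_int j\<bar> \<le> real M" using that by (auto simp: A_def)
      hence "\<bar>real_of_int j\<bar> * h < R" unfolding R_def using h by (intro mult_strict_right_mono) auto
      hence "\<bar>real_of_int j * h\<bar> < R" using h by (simp add: abs_mult)
      thus ?thesis by linarith
    qed
    thus ?thesis using that x y h
      by (auto simp: pts_def X_def nd_def in_box_complex_iff abs_less_iff)
  qed
  have pathQ: "path_image (rect R y) \<subseteq> Q - pts"
  proof
    fix z assume z: "z \<in> path_image (rect R y)"
    have "z \<in> Q" using z R y by (auto simp: path_image_rect Q_def strip_def)
    moreover have "z \<notin> pts" using z inbox[of z] R y unfolding rect_def
      by (subst (asm) path_image_rectpath_cbox_minus_box) auto
    ultimately show "z \<in> Q - pts" by blast
  qed
  have wn1: "winding_number (rect R y) p = 1" if "p \<in> pts" for p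
    unfolding rect_def by (rule winding_number_rectpath[OF inbox[OF that]])
  have wn0: "winding_number (rect R y) z = 0" if "z \<notin> Q" for z
    unfolding rect_def using that R y
    by (intro winding_number_rectpath_outside) (auto simp: Q_def strip_def in_cbox_complex_iff)
  have "contour_integral (rect R y) f
      = 2 * pi * \<i> * (\<Sum>p\<in>pts. winding_number (rect R y) p * residue f p)"
    by (rule Residue_theorem[OF oQ convex_connected[OF cQ] _ fholo _ _ pathQ])
       (auto simp: wn0 pts_def A_def, auto simp: rect_def)
  also have "(\<Sum>p\<in>pts. winding_number (rect R y) p * residue f p) = (\<Sum>p\<in>pts. residue f p)"
    by (intro sum.cong refl) (simp add: wn1)
  also have "\<dots> = residue f X + (\<Sum>j\<in>A. residue f (nd j))"
    unfolding pts_def using Xnd inj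
    by (subst sum.insert) (auto simp: A_def sum.reindex inj_on_def)
  also have "residue f X = F X / g X"
  proof -
    have "residue (\<lambda>w. (F w / g w) / (w - X)) X = F X / g X"
    proof (rule residue_simple)
      show "open (Q - nd ` A)" by (intro open_Diff oQ finite_imp_closed) (simp add: A_def)
      show "X \<in> Q - nd ` A" using Xnd x R y by (auto simp: Q_def X_def strip_def)
      show "(\<lambda>w. F w / g w) holomorphic_on Q - nd ` A"
        by (intro holomorphic_on_divide holomorphic_on_subset[OF FQ] gh gnz) auto
    qed
    thus ?thesis by (simp add: f_def X_def)
  qed
  also have "(\<Sum>j\<in>A. residue f (nd j)) =
      (\<Sum>j\<in>A. F (nd j) * (of_real (h / (pi * cos (pi * of_int j))) / (nd j - X)))"
  proof (rule sum.cong[OF refl])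
    fix j assume j: "j \<in> A"
    have "residue (\<lambda>w. (F w / (w - X)) / g w) (nd j)
        = F (nd j) / (nd j - X) / (of_real (cos (pi * of_int j)) * (of_real pi / of_real h))"
    proof (rule residue_simple_zero)
      let ?s = "Q - insert X (nd ` (A - {j}))"
      show "open ?s" by (intro open_Diff oQ finite_imp_closed) (simp add: A_def)
      have "nd j \<in> Q" using inbox[of "nd j"] j R y
        by (auto simp: pts_def Q_def strip_def in_box_complex_iff)
      thus "nd j \<in> ?s" using Xnd[of j] injD[OF inj] by auto
      show "(\<lambda>w. F w / (w - X)) holomorphic_on ?s"
        by (intro holomorphic_intros holomorphic_on_subset[OF FQ]) auto
      show "g holomorphic_on ?s" by (rule gh)
      show "g (nd j) = 0" by (auto simp: g0)
      have arg: "of_real pi * nd j / of_real h = of_real (pi * of_int j)"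
        using h by (simp add: nd_def)
      have "(g has_field_derivative cos (of_real pi * nd j / of_real h) * (of_real pi / of_real h)) (at (nd j))"
        unfolding g_def using h by (auto intro!: derivative_eq_intros)
      thus "(g has_field_derivative of_real (cos (pi * of_int j)) * (of_real pi / of_real h)) (at (nd j))"
        unfolding arg cos_of_real .
      show "complex_of_real (cos (pi * of_int j)) * (of_real pi / of_real h) \<noteq> 0"
        using h cos_pi_int_squared[of j] by auto
      show "g w \<noteq> 0" if "w \<in> ?s - {nd j}" for w using that by (intro gnz) auto
    qed
    moreover have "(\<lambda>w. (F w / (w - X)) / g w) = f" by (auto simp: f_def X_def)
    ultimately show "residue f (nd j) = F (nd j) * (of_real (h / (pi * cos (pi * of_int j))) / (nd j - X))"
      using h by (simp add: field_simps)
  qed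
  finally have main: "contour_integral (rect R y) f = 2 * pi * \<i> *
     (F X / g X + (\<Sum>j\<in>A. F (nd j) * (of_real (h / (pi * cos (pi * of_int j))) / (nd j - X))))" .
  have gX: "g X = of_real (sin (pi * x / h))" unfolding g_def X_def
    by (metis of_real_divide of_real_mult sin_of_real)
  have gX0: "g X \<noteq> 0" using Xnd by (simp add: g0)
  have Seq: "of_real (S j h x) = - (g X * (of_real (h / (pi * cos (pi * of_int j))) / (nd j - X)))" for j
    using False h unfolding gX by (subst S_at_nonnode) (auto simp: nd_def X_def)
  have cancel: "a / (2 * of_real pi * \<i>) * (complex_of_real (2 * pi) * \<i> * b) = a * b" for a b :: complex
    by (simp add: field_simps)
  have "of_real (sin (pi * x / h)) / (2 * of_real pi * \<i>) * contour_integral (rect R y) f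
      = g X * (F X / g X + (\<Sum>j\<in>A. F (nd j) * (of_real (h / (pi * cos (pi * of_int j))) / (nd j - X))))"
    unfolding main gX by (rule cancel)
  also have "\<dots> = F X - (\<Sum>j\<in>A. F (nd j) * of_real (S j h x))"
    using gX0 unfolding Seq by (simp add: distrib_left sum_distrib_left sum_negf mult.left_commute)
  finally show ?thesis unfolding f_def g_def X_def nd_def A_def by simp
qed

lemma continuous_on_rect_quotient:
  assumes F: "F holomorphic_on strip d" and h: "0 < h" and y: "0 < y" "y < d"
  shows "continuous_on (path_image (rect ((of_nat M + 1/2) * h) y))
           (\<lambda>\<zeta>. F \<zeta> / sin (of_real pi * \<zeta> / of_real h))"
proof (intro continuous_intros)
  have R: "0 < (of_nat M + 1/2) * h" using h by simp
  show "continuous_on (path_image (rect ((of_nat M + 1/2) * h) y)) F"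
    using R y by (intro holomorphic_on_imp_continuous_on holomorphic_on_subset[OF F])
      (auto simp: path_image_rect strip_def)
  show "\<forall>z\<in>path_image (rect ((of_nat M + 1/2) * h) y). sin (of_real pi * z / of_real h) \<noteq> 0"
    using sin_nonzero_on_rect[OF h y(1)] by blast
qed (use h in auto)

text \<open>
  The exponential growth of the sine away from the real axis is what makes the discretisation
  errors exponentially small.
\<close>

lemma cmod_sin_scaled_ge_sinh:
  assumes "0 < h" "\<bar>\<eta>\<bar> = y"
  shows "sinh (pi * y / h) \<le> cmod (sin (of_real pi * Complex \<xi> \<eta> / of_real h))"
proof (rule power2_le_imp_le)
  have im: "Im (of_real pi * Complex \<xi> \<eta> / of_real h) = pi * \<eta> / h"
    by (simp add: complex_eq_iff Im_divide_of_real)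
  have "sinh (pi * \<eta> / h) ^ 2 = sinh (pi * y / h) ^ 2"
  proof (cases "0 \<le> \<eta>")
    case False
    hence "\<eta> = - y" using assms(2) by linarith
    hence "pi * \<eta> / h = - (pi * y / h)" by simp
    thus ?thesis by (simp only: sinh_minus power2_minus)
  qed (use assms in simp)
  thus "sinh (pi * y / h) ^ 2 \<le> (cmod (sin (of_real pi * Complex \<xi> \<eta> / of_real h)))\<^sup>2"
    unfolding norm_sin_complex im by simp
qed simp

lemma cmod_sin_scaled_ge_1:
  assumes "0 < h" "\<bar>\<xi>\<bar> = (of_nat M + 1/2) * h"
  shows "1 \<le> cmod (sin (of_real pi * Complex \<xi> \<eta> / of_real h))"
proof (rule power2_le_imp_le)
  have re: "Re (of_real pi * Complex \<xi> \<eta> / of_real h) = pi * \<xi> / h"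
    by (simp add: Re_divide_of_real)
  have "\<bar>sin (pi * \<xi> / h)\<bar> = \<bar>sin (real M * pi + pi / 2)\<bar>"
  proof (cases "0 \<le> \<xi>")
    case True
    hence "pi * \<xi> / h = real M * pi + pi / 2" using assms by (simp add: field_simps)
    thus ?thesis by simp
  next
    case False
    hence "\<xi> = - ((of_nat M + 1/2) * h)" using assms(2) by linarith
    have "pi * \<xi> / h = - (real M * pi + pi / 2)"
      unfolding \<open>\<xi> = - ((of_nat M + 1/2) * h)\<close> using assms(1) by (simp add: field_simps)
    thus ?thesis by (simp only: sin_minus abs_minus_cancel)
  qed
  also have "\<dots> = 1" by (simp add: sin_add cos_npi)
  finally have "(sin (pi * \<xi> / h))\<^sup>2 = 1" by (metis power2_abs one_power2)
  thus "1\<^sup>2 \<le> (cmod (sin (of_real pi * Complex \<xi> \<eta> / of_real h)))\<^sup>2"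
    unfolding norm_sin_complex re by simp
qed simp

text \<open>
  Used to exchange decay of \<open>F\<close> along the contour for decay in \<open>x\<close> of the differentiated Cauchy
  kernel \<open>1 / (\<zeta> - x)\<^sup>2\<close>, where \<open>\<zeta> = \<xi> + i y\<close>.
\<close>

lemma Peetre_inequality:
  fixes x \<xi> y :: real
  assumes "0 < y"
  shows "1 + x\<^sup>2 \<le> 2 * (1 + 1 / y\<^sup>2) * (1 + \<xi>\<^sup>2) * (y\<^sup>2 + (\<xi> - x)\<^sup>2)"
proof -
  define t where "t = \<xi> - x"
  have x: "x = \<xi> - t" by (simp add: t_def)
  have "1 + x\<^sup>2 \<le> 2 * (1 + \<xi>\<^sup>2) * (1 + t\<^sup>2)"
  proof -
    have "0 \<le> (\<xi> + t)\<^sup>2 + 2 * (\<xi> * t)\<^sup>2" by simp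
    thus ?thesis unfolding x by (simp add: power2_eq_square algebra_simps)
  qed
  also have "1 + t\<^sup>2 \<le> (1 + 1 / y\<^sup>2) * (y\<^sup>2 + t\<^sup>2)"
    using assms by (simp add: distrib_right distrib_left)
  hence "2 * (1 + \<xi>\<^sup>2) * (1 + t\<^sup>2) \<le> 2 * (1 + \<xi>\<^sup>2) * ((1 + 1 / y\<^sup>2) * (y\<^sup>2 + t\<^sup>2))"
    by (intro mult_left_mono) auto
  finally show ?thesis unfolding t_def by (simp only: mult_ac)
qed

text \<open>
  On the horizontal sides the first bound uses \<open>\<bar>\<zeta> - x\<bar> \<ge> y\<close>. The second bound needs a factor that is
  integrable in \<open>x\<close>, since the derivative of the Cauchy integral is going to be integrated over
  half lines; Peetre's inequality supplies it at the expense of one of the two factors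
  \<open>1 / (1 + \<xi>\<^sup>2)\<close> of the bound for \<open>F\<close>. On the vertical sides the sine has modulus at least \<open>1\<close> and
  \<open>\<zeta>\<close> is at distance at least \<open>1\<close> from \<open>x\<close>.
\<close>

lemma contour_kernel_bounds:
  fixes F :: "complex \<Rightarrow> complex" and h x y d K :: real and M :: nat
  defines "R \<equiv> (of_nat M + 1/2) * h"
  defines "f \<equiv> (\<lambda>\<zeta>. F \<zeta> / sin (of_real pi * \<zeta> / of_real h))"
  assumes F: "F holomorphic_on strip d" and h: "0 < h" and y: "0 < y" "y < d" and x: "\<bar>x\<bar> + 1 \<le> R"
    and K: "0 \<le> K" "\<And>\<zeta>. \<zeta> \<in> strip d \<Longrightarrow> cmod (F \<zeta>) \<le> K / (1 + (Re \<zeta>)\<^sup>2)\<^sup>2"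
  shows "cmod (contour_integral (rect R y) (\<lambda>\<zeta>. f \<zeta> / (\<zeta> - of_real x)))
           \<le> 2 * pi * (K / (y * sinh (pi * y / h))) + 4 * y * (K / R)" (is ?A)
    and "cmod (contour_integral (rect R y) (\<lambda>\<zeta>. f \<zeta> / (\<zeta> - of_real x)\<^sup>2))
           \<le> 2 * pi * (2 * (1 + 1 / y\<^sup>2) * K / sinh (pi * y / h) / (1 + x\<^sup>2)) + 4 * y * (K / R)" (is ?B)
proof -
  have R: "0 < R" "1 \<le> R" using x by auto
  define s where "s = sinh (pi * y / h)"
  have s: "0 < s" unfolding s_def using h y by simp
  have Xn: "of_real x \<notin> path_image (rect R y)" using x y R by (auto simp: path_image_rect)
  have cf: "continuous_on (path_image (rect R y)) f"
    unfolding f_def R_def by (rule continuous_on_rect_quotient[OF F h y])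
  have fh: "cmod (f (Complex \<xi> \<eta>)) \<le> K / (1 + \<xi>\<^sup>2)\<^sup>2 / s" if "\<bar>\<eta>\<bar> = y" for \<xi> \<eta>
  proof -
    have "cmod (F (Complex \<xi> \<eta>)) \<le> K / (1 + \<xi>\<^sup>2)\<^sup>2" using K(2)[of "Complex \<xi> \<eta>"] that y by (simp add: strip_def)
    thus ?thesis unfolding f_def norm_divide s_def using cmod_sin_scaled_ge_sinh[OF h that] s K(1)
      by (intro frac_le) (auto simp: s_def)
  qed
  have RR: "R \<le> (1 + R\<^sup>2)\<^sup>2"
  proof -
    have "0 \<le> (R - 1)\<^sup>2" by simp
    hence "R \<le> 1 + R\<^sup>2" unfolding power2_diff using R by simp
    also have "\<dots> \<le> (1 + R\<^sup>2)\<^sup>2" by (intro self_le_power) auto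
    finally show ?thesis .
  qed
  have fv: "cmod (f (Complex \<xi> \<eta>)) \<le> K / R" if "\<bar>\<xi>\<bar> = R" "\<bar>\<eta>\<bar> \<le> y" for \<xi> \<eta>
  proof -
    have e: "\<xi>\<^sup>2 = R\<^sup>2" using that by (metis power2_abs)
    have "cmod (F (Complex \<xi> \<eta>)) \<le> K / (1 + \<xi>\<^sup>2)\<^sup>2" using K(2)[of "Complex \<xi> \<eta>"] that y by (simp add: strip_def)
    also have "\<dots> \<le> K / R" unfolding e using K RR R by (intro divide_left_mono) (auto intro!: mult_pos_pos zero_less_power add_pos_nonneg)
    finally have "cmod (F (Complex \<xi> \<eta>)) \<le> K / R" .
    moreover have "1 \<le> cmod (sin (of_real pi * Complex \<xi> \<eta> / of_real h))"
      by (rule cmod_sin_scaled_ge_1[OF h that(1)[unfolded R_def]])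
    ultimately have "cmod (f (Complex \<xi> \<eta>)) \<le> K / R / 1" unfolding f_def norm_divide
      using K R by (intro frac_le) auto
    thus ?thesis by simp
  qed
  have dv: "1 \<le> cmod (Complex \<xi> \<eta> - of_real x)" if "\<bar>\<xi>\<bar> = R" for \<xi> \<eta>
    using abs_Re_le_cmod[of "Complex \<xi> \<eta> - of_real x"] that x by simp
  have dh: "y \<le> cmod (Complex \<xi> \<eta> - of_real x)" if "\<bar>\<eta>\<bar> = y" for \<xi> \<eta>
    using abs_Im_le_cmod[of "Complex \<xi> \<eta> - of_real x"] that by simp
  have dh2: "(cmod (Complex \<xi> \<eta> - of_real x))\<^sup>2 = y\<^sup>2 + (\<xi> - x)\<^sup>2" if "\<bar>\<eta>\<bar> = y" for \<xi> \<eta>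
    using that by (auto simp: cmod_power2)
  show ?A unfolding s_def[symmetric] rect_def
  proof (rule cmod_contour_integral_rectpath_le[OF R(1) y(1)])
    show "continuous_on (path_image (rectpath (Complex (- R) (- y)) (Complex R y))) (\<lambda>\<zeta>. f \<zeta> / (\<zeta> - of_real x))"
      using cf Xn unfolding rect_def by (intro continuous_intros) auto
  next
    fix \<xi> \<eta> :: real assume a: "\<bar>\<eta>\<bar> = y"
    have "cmod (f (Complex \<xi> \<eta>) / (Complex \<xi> \<eta> - of_real x)) \<le> K / (1 + \<xi>\<^sup>2)\<^sup>2 / s / y"
      unfolding norm_divide using fh[OF a] dh[OF a] y s K by (intro frac_le) auto
    also have "\<dots> = K / (y * s) / (1 + \<xi>\<^sup>2)\<^sup>2" by (simp add: field_simps)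
    also have "\<dots> \<le> K / (y * s) / (1 + \<xi>\<^sup>2)"
    proof (intro divide_left_mono self_le_power)
      have "0 < 1 + \<xi>\<^sup>2" by (simp add: add_pos_nonneg)
      thus "0 < (1 + \<xi>\<^sup>2)\<^sup>2 * (1 + \<xi>\<^sup>2)" by (intro mult_pos_pos zero_less_power)
    qed (use K y s in auto)
    finally show "cmod (f (Complex \<xi> \<eta>) / (Complex \<xi> \<eta> - of_real x)) \<le> K / (y * s) / (1 + \<xi>\<^sup>2)" .
  next
    fix \<xi> \<eta> :: real assume a: "\<bar>\<xi>\<bar> = R" "\<bar>\<eta>\<bar> \<le> y"
    have "cmod (f (Complex \<xi> \<eta>) / (Complex \<xi> \<eta> - of_real x)) \<le> K / R / 1"
      unfolding norm_divide using fv[OF a] dv[OF a(1)] K R by (intro frac_le) auto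
    thus "cmod (f (Complex \<xi> \<eta>) / (Complex \<xi> \<eta> - of_real x)) \<le> K / R" by simp
  qed
  show ?B unfolding s_def[symmetric] rect_def
  proof (rule cmod_contour_integral_rectpath_le[OF R(1) y(1)])
    show "continuous_on (path_image (rectpath (Complex (- R) (- y)) (Complex R y))) (\<lambda>\<zeta>. f \<zeta> / (\<zeta> - of_real x)\<^sup>2)"
      using cf Xn unfolding rect_def by (intro continuous_intros) auto
  next
    fix \<xi> \<eta> :: real assume a: "\<bar>\<eta>\<bar> = y"
    have p: "0 < y\<^sup>2 + (\<xi> - x)\<^sup>2" "0 < 1 + \<xi>\<^sup>2" "0 < 1 + x\<^sup>2" using y by (auto intro!: add_pos_nonneg)
    have "cmod (f (Complex \<xi> \<eta>) / (Complex \<xi> \<eta> - of_real x)\<^sup>2) \<le> K / (1 + \<xi>\<^sup>2)\<^sup>2 / s / (y\<^sup>2 + (\<xi> - x)\<^sup>2)"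
      unfolding norm_divide norm_power dh2[OF a] using fh[OF a] p by (intro divide_right_mono) auto
    also have "\<dots> = K / s / (1 + \<xi>\<^sup>2) * (1 / ((1 + \<xi>\<^sup>2) * (y\<^sup>2 + (\<xi> - x)\<^sup>2)))"
      by (simp add: power2_eq_square)
    also have "\<dots> \<le> K / s / (1 + \<xi>\<^sup>2) * (2 * (1 + 1 / y\<^sup>2) / (1 + x\<^sup>2))"
    proof (rule mult_left_mono)
      have gen: "1 / A \<le> C / X" if "X \<le> C * A" "0 < A" "0 < X" for X C A :: real
        using that by (simp add: field_simps)
      have "(1 + x\<^sup>2) \<le> 2 * (1 + 1 / y\<^sup>2) * ((1 + \<xi>\<^sup>2) * (y\<^sup>2 + (\<xi> - x)\<^sup>2))"
        using Peetre_inequality[OF y(1), of x \<xi>] by (simp only: mult.assoc)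
      thus "1 / ((1 + \<xi>\<^sup>2) * (y\<^sup>2 + (\<xi> - x)\<^sup>2)) \<le> 2 * (1 + 1 / y\<^sup>2) / (1 + x\<^sup>2)"
        using gen mult_pos_pos[OF p(2,1)] p(3) by blast
    qed (use K s p in auto)
    also have "\<dots> = 2 * (1 + 1 / y\<^sup>2) * K / s / (1 + x\<^sup>2) / (1 + \<xi>\<^sup>2)" by (simp add: mult_ac)
    finally show "cmod (f (Complex \<xi> \<eta>) / (Complex \<xi> \<eta> - of_real x)\<^sup>2)
        \<le> 2 * (1 + 1 / y\<^sup>2) * K / s / (1 + x\<^sup>2) / (1 + \<xi>\<^sup>2)" .
  next
    fix \<xi> \<eta> :: real assume a: "\<bar>\<xi>\<bar> = R" "\<bar>\<eta>\<bar> \<le> y"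
    have "cmod (f (Complex \<xi> \<eta>) / (Complex \<xi> \<eta> - of_real x)\<^sup>2) \<le> K / R / 1"
      unfolding norm_divide norm_power using fv[OF a] dv[OF a(1)] K R by (intro frac_le) auto
    thus "cmod (f (Complex \<xi> \<eta>) / (Complex \<xi> \<eta> - of_real x)\<^sup>2) \<le> K / R" by simp
  qed
qed

lemma sum_geometric_tail_le:
  fixes q :: real
  assumes "0 \<le> q" "q < 1"
  shows "(\<Sum>n\<in>{N<..M}. q ^ n) \<le> q ^ N * (q / (1 - q))"
proof (cases "N \<le> M")
  case True
  define c where "c = q / (1 - q)"
  have "c * (1 - q) = q" using assms by (simp add: c_def)
  hence qc: "q = c - c * q" by (simp add: algebra_simps)
  from True have "(\<Sum>n\<in>{N<..M}. q ^ n) = (q ^ N - q ^ M) * (q / (1 - q))"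
    unfolding c_def[symmetric]
  proof (induction M rule: dec_induct)
    case (step M)
    have "{N<..Suc M} = insert (Suc M) {N<..M}" using step by auto
    hence "(\<Sum>n\<in>{N<..Suc M}. q ^ n) = q * q ^ M + (q ^ N - q ^ M) * c" using step by simp
    also have "q * q ^ M = (c - c * q) * q ^ M" using qc by simp
    finally show ?case by (simp add: algebra_simps)
  qed simp
  also have "\<dots> \<le> q ^ N * (q / (1 - q))" using assms by (intro mult_right_mono) auto
  finally show ?thesis .
qed (use assms in auto)

lemma sum_exp_tail_le:
  fixes \<beta> h :: real
  assumes "0 < \<beta>" "0 < h"
  shows "(\<Sum>j\<in>{- int M..int M} - {- int N..int N}. exp (- \<beta> * \<bar>of_int j * h\<bar>))
           \<le> 2 * exp (- \<beta> * (N * h)) / (\<beta> * h)"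
proof -
  define q where "q = exp (- \<beta> * h)"
  have q: "0 < q" "q < 1" using assms by (auto simp: q_def)
  have "1 + \<beta> * h \<le> exp (\<beta> * h)" by (rule exp_ge_add_one_self)
  hence "(1 + \<beta> * h) * q \<le> 1" unfolding q_def by (simp add: exp_minus field_simps)
  hence c: "q / (1 - q) \<le> 1 / (\<beta> * h)" using q assms by (simp add: field_simps)
  have qn: "exp (- \<beta> * \<bar>of_int (int n) * h\<bar>) = q ^ n" for n
    unfolding q_def using assms by (simp add: exp_of_nat_mult[symmetric] abs_mult)
  have t: "(\<Sum>n\<in>{N<..M}. q ^ n) \<le> exp (- \<beta> * (N * h)) / (\<beta> * h)"
  proof -
    have "(\<Sum>n\<in>{N<..M}. q ^ n) \<le> q ^ N * (q / (1 - q))" by (rule sum_geometric_tail_le) (use q in auto)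
    also have "\<dots> \<le> q ^ N * (1 / (\<beta> * h))" using q c by (intro mult_left_mono) auto
    also have "q ^ N = exp (- \<beta> * (N * h))" using qn[of N] assms by (simp add: abs_mult)
    finally show ?thesis by simp
  qed
  have "{- int M..int M} - {- int N..int N} \<subseteq> int ` {N<..M} \<union> (\<lambda>n. - int n) ` {N<..M}"
  proof
    fix j assume j: "j \<in> {- int M..int M} - {- int N..int N}"
    hence "nat \<bar>j\<bar> \<in> {N<..M}" "j = int (nat \<bar>j\<bar>) \<or> j = - int (nat \<bar>j\<bar>)" by auto
    thus "j \<in> int ` {N<..M} \<union> (\<lambda>n. - int n) ` {N<..M}" by blast
  qed
  hence "(\<Sum>j\<in>{- int M..int M} - {- int N..int N}. exp (- \<beta> * \<bar>of_int j * h\<bar>))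
      \<le> (\<Sum>j\<in>int ` {N<..M} \<union> (\<lambda>n. - int n) ` {N<..M}. exp (- \<beta> * \<bar>of_int j * h\<bar>))"
    by (intro sum_mono2) auto
  also have "\<dots> \<le> (\<Sum>j\<in>int ` {N<..M}. exp (- \<beta> * \<bar>of_int j * h\<bar>))
      + (\<Sum>j\<in>(\<lambda>n. - int n) ` {N<..M}. exp (- \<beta> * \<bar>of_int j * h\<bar>))"
    by (subst sum.union_inter[symmetric]) (auto intro: sum_nonneg)
  also have "\<dots> = (\<Sum>n\<in>{N<..M}. q ^ n) + (\<Sum>n\<in>{N<..M}. q ^ n)"
    using qn by (simp add: sum.reindex inj_on_def)
  also have "\<dots> \<le> 2 * exp (- \<beta> * (N * h)) / (\<beta> * h)" using t by simp
  finally show ?thesis .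
qed

section \<open>Sinc interpolation and Sinc indefinite integration on a strip\<close>

lemma filterlim_half_mesh:
  assumes "0 < h"
  shows "filterlim (\<lambda>M::nat. (real M + 1/2) * h) at_top sequentially"
  using assms by real_asymp

text \<open>
  The contour formula controls the symmetric sums up to \<open>M\<close> as \<open>M\<close> tends to infinity, while the
  method uses the sum up to \<open>N\<close>; a geometric tail separates the two.
\<close>

lemma norm_diff_truncated_sum_le:
  fixes t :: "int \<Rightarrow> complex" and X :: "nat \<Rightarrow> real"
  assumes h: "0 < h" and \<beta>: "0 < \<beta>" and c: "0 \<le> c"
    and t: "\<And>j. cmod (t j) \<le> c * exp (- \<beta> * \<bar>of_int j * h\<bar>)"
    and X: "X \<longlonglongrightarrow> x"
    and le: "eventually (\<lambda>M. cmod (z - (\<Sum>j = - int M..int M. t j)) \<le> X M) sequentially"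
  shows "cmod (z - (\<Sum>j = - int N..int N. t j)) \<le> x + c * (2 * exp (- \<beta> * (N * h)) / (\<beta> * h))"
proof -
  let ?T = "c * (2 * exp (- \<beta> * (N * h)) / (\<beta> * h))"
  have "cmod (z - (\<Sum>j = - int N..int N. t j)) \<le> X M + ?T"
    if M: "N \<le> M \<and> cmod (z - (\<Sum>j = - int M..int M. t j)) \<le> X M" for M
  proof -
    let ?D = "{- int M..int M} - {- int N..int N}"
    have "(\<Sum>j = - int M..int M. t j) = (\<Sum>j = - int N..int N. t j) + (\<Sum>j\<in>?D. t j)"
      using M by (subst sum.subset_diff[of "{- int N..int N}"]) auto
    hence eq: "z - (\<Sum>j = - int N..int N. t j) = (z - (\<Sum>j = - int M..int M. t j)) + (\<Sum>j\<in>?D. t j)" by simp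
    have "cmod (\<Sum>j\<in>?D. t j) \<le> c * (\<Sum>j\<in>?D. exp (- \<beta> * \<bar>of_int j * h\<bar>))"
      unfolding sum_distrib_left by (rule order_trans[OF norm_sum sum_mono[OF t]])
    also have "\<dots> \<le> ?T" by (intro mult_left_mono sum_exp_tail_le \<beta> h c)
    finally have "cmod (\<Sum>j\<in>?D. t j) \<le> ?T" .
    with M show ?thesis unfolding eq by (intro order_trans[OF norm_triangle_ineq] add_mono) auto
  qed
  hence "eventually (\<lambda>M. cmod (z - (\<Sum>j = - int N..int N. t j)) \<le> X M + ?T) sequentially"
    by (rule eventually_mono[OF eventually_conj[OF eventually_ge_at_top[of N] le]])
  with tendsto_add[OF X tendsto_const[of ?T]] show ?thesis by (rule tendsto_lowerbound) simp
qed

text \<open>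
  Since \<open>F\<close> is only given on the open strip, the contour runs at a height \<open>y < d\<close>. The limit
  \<open>y \<rightarrow> d\<close> is taken afterwards, in the inequality.
\<close>

lemma sinc_interpolation_error_inner_strip:
  fixes F :: "complex \<Rightarrow> complex" and h x y d K K0 \<beta> :: real and N :: nat
  assumes F: "F holomorphic_on strip d" and h: "0 < h" and y: "0 < y" "y < d"
    and K: "0 \<le> K" "\<And>\<zeta>. \<zeta> \<in> strip d \<Longrightarrow> cmod (F \<zeta>) \<le> K / (1 + (Re \<zeta>)\<^sup>2)\<^sup>2"
    and \<beta>: "0 < \<beta>" and K0: "0 \<le> K0" "\<And>\<xi>. cmod (F (of_real \<xi>)) \<le> K0 * exp (- \<beta> * \<bar>\<xi>\<bar>)"
  shows "cmod (F (of_real x) - (\<Sum>j = - int N..int N. F (of_real (of_int j * h)) * of_real (S j h x)))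
      \<le> K / (y * sinh (pi * y / h)) + 2 * K0 * exp (- \<beta> * (N * h)) / (\<beta> * h)"
proof -
  let ?t = "\<lambda>j. F (of_real (of_int j * h)) * of_real (S j h x)"
  let ?R = "\<lambda>M::nat. (real M + 1/2) * h"
  let ?X = "\<lambda>M. 1 / (2 * pi) * (2 * pi * (K / (y * sinh (pi * y / h))) + 4 * y * (K / ?R M))"
  have lim: "?X \<longlonglongrightarrow> 1 / (2 * pi) * (2 * pi * (K / (y * sinh (pi * y / h))) + 4 * y * 0)"
    by (intro tendsto_intros tendsto_divide_0[OF tendsto_const] filterlim_at_top_imp_at_infinity
        filterlim_half_mesh[OF h])
  have "\<forall>\<^sub>F M in sequentially. \<bar>x\<bar> + 1 \<le> ?R M"
    using filterlim_half_mesh[OF h] unfolding filterlim_at_top by blast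
  hence le: "\<forall>\<^sub>F M in sequentially. cmod (F (of_real x) - (\<Sum>j = - int M..int M. ?t j)) \<le> ?X M"
  proof (rule eventually_mono)
    fix M assume M: "\<bar>x\<bar> + 1 \<le> ?R M"
    hence xR: "\<bar>x\<bar> < ?R M" by simp
    show "cmod (F (of_real x) - (\<Sum>j = - int M..int M. ?t j)) \<le> ?X M"
      unfolding sinc_interpolation_contour[OF F h y xR] norm_mult
      by (rule mult_mono[OF _ contour_kernel_bounds(1)[OF F h y M K]])
         (auto simp: norm_divide norm_mult divide_right_mono)
  qed
  have "cmod (?t j) \<le> K0 * exp (- \<beta> * \<bar>of_int j * h\<bar>)" for j
    using mult_mono[OF K0(2) abs_S_le_1[of j h x], of "of_int j * h"] K0(1)
    unfolding norm_mult[of "F _"] norm_of_real by simp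
  from norm_diff_truncated_sum_le[OF h \<beta> K0(1) this lim le, of N] show ?thesis by (simp add: mult_ac)
qed

lemma tendsto_sinh_at_left:
  assumes "0 < d" "0 < h"
  shows "((\<lambda>y. sinh (pi * y / h)) \<longlongrightarrow> sinh (pi * d / h)) (at_left d)"
  by (intro tendsto_intros) (use assms in auto)

lemma sinc_interpolation_error:
  fixes F :: "complex \<Rightarrow> complex" and h x d K K0 \<beta> :: real and N :: nat
  assumes F: "F holomorphic_on strip d" and h: "0 < h" and d: "0 < d"
    and K: "0 \<le> K" "\<And>\<zeta>. \<zeta> \<in> strip d \<Longrightarrow> cmod (F \<zeta>) \<le> K / (1 + (Re \<zeta>)\<^sup>2)\<^sup>2"
    and \<beta>: "0 < \<beta>" and K0: "0 \<le> K0" "\<And>\<xi>. cmod (F (of_real \<xi>)) \<le> K0 * exp (- \<beta> * \<bar>\<xi>\<bar>)"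
  shows "cmod (F (of_real x) - (\<Sum>j = - int N..int N. F (of_real (of_int j * h)) * of_real (S j h x)))
      \<le> K / (d * sinh (pi * d / h)) + 2 * K0 * exp (- \<beta> * (N * h)) / (\<beta> * h)"
proof (rule tendsto_lowerbound)
  show "((\<lambda>y. K / (y * sinh (pi * y / h)) + 2 * K0 * exp (- \<beta> * (N * h)) / (\<beta> * h)) \<longlongrightarrow>
      K / (d * sinh (pi * d / h)) + 2 * K0 * exp (- \<beta> * (N * h)) / (\<beta> * h)) (at_left d)"
    by (intro tendsto_add tendsto_divide tendsto_mult tendsto_sinh_at_left tendsto_const tendsto_ident_at d h)
       (use d h in auto)
  show "\<forall>\<^sub>F y in at_left d. cmod (F (of_real x) - (\<Sum>j = - int N..int N. F (of_real (of_int j * h)) * of_real (S j h x)))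
     \<le> K / (y * sinh (pi * y / h)) + 2 * K0 * exp (- \<beta> * (N * h)) / (\<beta> * h)"
    by (rule eventually_at_leftI[OF _ d], rule sinc_interpolation_error_inner_strip) (use assms in auto)
qed simp

lemma Si_bounded:
  obtains B where "0 \<le> B" "\<And>t. \<bar>Si t\<bar> \<le> B"
  using bounded_Si by (metis abs_ge_zero order_trans)

lemma Si_at_bot: "(Si \<longlongrightarrow> - (pi / 2)) at_bot"
proof -
  have "((\<lambda>t. - Si t) \<longlongrightarrow> - (pi / 2)) at_top" by (intro tendsto_minus Si_at_top)
  hence "((\<lambda>t. Si (- t)) \<longlongrightarrow> - (pi / 2)) at_top"
    by (rule Lim_transform_eventually) (auto intro!: eventually_mono[OF eventually_ge_at_top[of 0]] simp: Si_neg)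
  thus ?thesis by (simp add: at_bot_mirror filterlim_filtermap)
qed

lemma contour_integral_linepath_cauchy_derivative:
  assumes f: "continuous_on (closed_segment p q) f" and w: "w \<notin> closed_segment p q"
  shows "((\<lambda>w. contour_integral (linepath p q) (\<lambda>\<zeta>. f \<zeta> / (\<zeta> - w))) has_field_derivative
           contour_integral (linepath p q) (\<lambda>\<zeta>. f \<zeta> / (\<zeta> - w)\<^sup>2)) (at w)"
proof -
  let ?G = "\<lambda>w. contour_integral (linepath p q) (\<lambda>\<zeta>. f \<zeta> / (\<zeta> - w))"
  have f': "continuous_on (path_image (linepath p q)) f" using f by simp
  have "(?G has_field_derivative of_nat 1 * contour_integral (linepath p q) (\<lambda>\<zeta>. f \<zeta> / (\<zeta> - w) ^ Suc 1)) (at w)"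
  proof (rule Cauchy_next_derivative(2)[OF f', where S = UNIV])
    show "((\<lambda>\<zeta>. f \<zeta> / (\<zeta> - w) ^ 1) has_contour_integral ?G w) (linepath p q)"
      if "w \<in> UNIV - path_image (linepath p q)" for w
    proof -
      have "continuous_on (closed_segment p q) (\<lambda>\<zeta>. f \<zeta> / (\<zeta> - w))"
        using that f by (intro continuous_intros) auto
      from contour_integrable_continuous_linepath[OF this]
      show ?thesis by (simp add: has_contour_integral_integral)
    qed
    show "cmod (vector_derivative (linepath p q) (at t)) \<le> cmod (q - p)" for t by simp
  qed (use w in auto)
  thus ?thesis by (simp add: numeral_2_eq_2)
qed

text \<open>
  Differentiation under the integral sign is carried out on each side separately, because there
  the path has constant speed.
\<close>

lemma contour_integral_rect_cauchy_derivative: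
  assumes f: "continuous_on (path_image (rect R y)) f" and w: "w \<notin> path_image (rect R y)"
  shows "((\<lambda>w. contour_integral (rect R y) (\<lambda>\<zeta>. f \<zeta> / (\<zeta> - w))) has_field_derivative
           contour_integral (rect R y) (\<lambda>\<zeta>. f \<zeta> / (\<zeta> - w)\<^sup>2)) (at w)"
proof -
  let ?a = "Complex (-R) (-y)" and ?b = "Complex R (-y)" and ?c = "Complex R y" and ?e = "Complex (-R) y"
  let ?G = "\<lambda>p q n w. contour_integral (linepath p q) (\<lambda>\<zeta>. f \<zeta> / (\<zeta> - w) ^ n)"
  have pim: "path_image (rect R y) = closed_segment ?a ?b \<union> closed_segment ?b ?c
      \<union> closed_segment ?c ?e \<union> closed_segment ?e ?a"
    by (simp add: rect_def rectpath_def Let_def path_image_join Un_assoc)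
  have sp: "?G ?a ?b n w + ?G ?b ?c n w + ?G ?c ?e n w + ?G ?e ?a n w
      = contour_integral (rect R y) (\<lambda>\<zeta>. f \<zeta> / (\<zeta> - w) ^ n)"
    if "w \<notin> path_image (rect R y)" for w n
    unfolding rect_def using that f
    by (subst contour_integral_rectpath_split) (auto simp: rect_def intro!: continuous_intros)
  have d: "(?G p q 1 has_field_derivative ?G p q 2 w) (at w)" if "closed_segment p q \<subseteq> path_image (rect R y)" for p q
    unfolding power_one_right
    by (rule contour_integral_linepath_cauchy_derivative) (use that f w in \<open>auto elim: continuous_on_subset\<close>)
  have "((\<lambda>w. ?G ?a ?b 1 w + ?G ?b ?c 1 w + ?G ?c ?e 1 w + ?G ?e ?a 1 w) has_field_derivative
          ?G ?a ?b 2 w + ?G ?b ?c 2 w + ?G ?c ?e 2 w + ?G ?e ?a 2 w) (at w)"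
    by (intro DERIV_add d) (auto simp: pim)
  hence *: "((\<lambda>w. ?G ?a ?b 1 w + ?G ?b ?c 1 w + ?G ?c ?e 1 w + ?G ?e ?a 1 w) has_field_derivative
          contour_integral (rect R y) (\<lambda>\<zeta>. f \<zeta> / (\<zeta> - w)\<^sup>2)) (at w)"
    unfolding sp[OF w] .
  have "valid_path (rect R y)" by (simp add: rect_def)
  hence o: "open (- path_image (rect R y))" using closed_valid_path_image by blast
  show ?thesis
    by (rule has_field_derivative_transform_within_open[OF * o]) (use w sp[of _ 1] in auto)
qed

text \<open>
  Let \<open>G\<close> be the Cauchy integral in \<open>sinc_interpolation_contour\<close>, so that the interpolation error is
  \<open>c * sin (pi * x / h) * G x\<close>. Its integral over \<open>[- r, x]\<close> has to be bounded uniformly in \<open>r\<close>, for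
  which the decay of \<open>G\<close>, of order \<open>1 / \<bar>x\<bar>\<close>, is too slow. Integration by parts replaces \<open>sin * G\<close> by
  \<open>(h / pi) * cos * G'\<close>, and \<open>G'\<close> decays like \<open>1 / (1 + x\<^sup>2)\<close> by Peetre's inequality. In the proof no
  integral is formed: the boundary term of the integration by parts is added to a primitive of the
  interpolation error, and the mean value inequality is applied to the resulting function \<open>A\<close>.
\<close>

lemma sinc_indefinite_integral_error_rectangle:
  fixes F :: "complex \<Rightarrow> complex" and p :: "real \<Rightarrow> complex" and h x r y d K :: real and M :: nat
  defines "R \<equiv> (of_nat M + 1/2) * h" and "s \<equiv> sinh (pi * y / h)"
  assumes F: "F holomorphic_on strip d" and h: "0 < h" and y: "0 < y" "y < d"
    and K: "0 \<le> K" "\<And>\<zeta>. \<zeta> \<in> strip d \<Longrightarrow> cmod (F \<zeta>) \<le> K / (1 + (Re \<zeta>)\<^sup>2)\<^sup>2"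
    and p: "\<And>x. (p has_vector_derivative F (of_real x)) (at x)"
    and xr: "- r < x" "\<bar>x\<bar> + 1 \<le> R" "\<bar>r\<bar> + 1 \<le> R"
  shows "cmod (p x - p (- r) - (\<Sum>j = - int M..int M. F (of_real (of_int j * h)) *
            of_real (h / pi * (Si (pi * (x - of_int j * h) / h) - Si (pi * (- r - of_int j * h) / h)))))
     \<le> h / (2 * pi\<^sup>2) * (4 * pi\<^sup>2 * (1 + 1 / y\<^sup>2) * K / s + 4 * y * (K / R) * (x + r)
        + 2 * (2 * pi * (K / (y * s)) + 4 * y * (K / R)))"
proof -
  define f where "f = (\<lambda>\<zeta>. F \<zeta> / sin (of_real pi * \<zeta> / of_real h))"
  define G where "G = (\<lambda>w. contour_integral (rect R y) (\<lambda>\<zeta>. f \<zeta> / (\<zeta> - w)))"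
  define G' where "G' = (\<lambda>w. contour_integral (rect R y) (\<lambda>\<zeta>. f \<zeta> / (\<zeta> - w)\<^sup>2))"
  define c where "c = 1 / (2 * complex_of_real pi * \<i>)"
  define Fj where "Fj = (\<lambda>j::int. F (of_real (of_int j * h)))"
  define Sj where "Sj = (\<lambda>(j::int) x. h / pi * Si (pi * (x - of_int j * h) / h))"
  define q where "q = (\<lambda>x. c * of_real (h / pi * cos (pi * x / h)) * G (of_real x))"
  \<comment> \<open>The summand \<open>q\<close> is the boundary term of the integration by parts.\<close>
  define A where "A = (\<lambda>x. p x - (\<Sum>j = - int M..int M. Fj j * of_real (Sj j x)) + q x)"
  define \<sigma> where "\<sigma> = (\<lambda>x. h / (2 * pi\<^sup>2) * (2 * pi * (2 * (1 + 1 / y\<^sup>2) * K / s) * arctan x + 4 * y * (K / R) * x))"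
  have R: "0 < R" using xr by linarith
  have cf: "continuous_on (path_image (rect R y)) f"
    unfolding f_def R_def by (rule continuous_on_rect_quotient[OF F h y])
  have nx: "of_real v \<notin> path_image (rect R y)" if "\<bar>v\<bar> < R" for v
    using that y R by (auto simp: path_image_rect)
  have dG: "(G has_field_derivative G' (of_real v)) (at (of_real v))" if v: "\<bar>v\<bar> < R" for v
    unfolding G_def G'_def by (rule contour_integral_rect_cauchy_derivative[OF cf nx[OF v]])
  have dSj: "(Sj j has_real_derivative S j h v) (at v)" for j v
  proof -
    have "((\<lambda>x. Si (pi * (x - of_int j * h) / h)) has_real_derivative
            sinc (pi * (v - of_int j * h) / h) * (pi / h)) (at v)"
      by (rule DERIV_chain2[OF DERIV_Si]) (use h in \<open>auto intro!: derivative_eq_intros\<close>)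
    from DERIV_cmult[OF this, of "h / pi"] show ?thesis
      unfolding Sj_def S_eq_sinc[OF h] using h by (simp add: mult.commute)
  qed
  have vG: "((\<lambda>v. G (of_real v)) has_vector_derivative G' (of_real v)) (at v)" if "\<bar>v\<bar> < R" for v
    using has_vector_derivative_real_field[OF has_field_derivative_at_within[OF dG[OF that]]] by (simp add: o_def)
  have vSj: "((\<lambda>v. Fj j * complex_of_real (Sj j v)) has_vector_derivative Fj j * of_real (S j h v)) (at v)" for j v
    using has_vector_derivative_mult_right[OF has_vector_derivative_of_real[OF dSj]] by blast
  have vcos: "((\<lambda>v. complex_of_real (h / pi * cos (pi * v / h))) has_vector_derivative of_real (- sin (pi * v / h))) (at v)" for v
  proof (rule has_vector_derivative_of_real)
    show "((\<lambda>v. h / pi * cos (pi * v / h)) has_real_derivative - sin (pi * v / h)) (at v)"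
      using h by (auto intro!: derivative_eq_intros)
  qed
  have vA: "(A has_vector_derivative c * of_real (h / pi * cos (pi * v / h)) * G' (of_real v)) (at v)" if v: "\<bar>v\<bar> < R" for v
  proof -
    have "(q has_vector_derivative c * of_real (h / pi * cos (pi * v / h)) * G' (of_real v)
         + c * of_real (- sin (pi * v / h)) * G (of_real v)) (at v)"
      unfolding q_def
      using has_vector_derivative_mult[OF has_vector_derivative_mult_right[OF vcos, of c] vG[OF v]] by simp
    hence "(A has_vector_derivative F (of_real v) - (\<Sum>j = - int M..int M. Fj j * of_real (S j h v))
        + (c * of_real (h / pi * cos (pi * v / h)) * G' (of_real v)
         + c * of_real (- sin (pi * v / h)) * G (of_real v))) (at v)"
      unfolding A_def by (intro has_vector_derivative_add has_vector_derivative_diff p has_vector_derivative_sum vSj)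
    moreover have "F (of_real v) - (\<Sum>j = - int M..int M. Fj j * of_real (S j h v))
        = c * of_real (sin (pi * v / h)) * G (of_real v)"
      using sinc_interpolation_contour[OF F h y v[unfolded R_def]]
      by (simp add: Fj_def c_def G_def f_def R_def)
    ultimately show ?thesis by simp
  qed
  have nc: "cmod c = 1 / (2 * pi)" by (simp add: c_def norm_divide norm_mult)
  have cosb: "cmod (c * of_real (h / pi * cos (pi * v / h))) \<le> h / (2 * pi\<^sup>2)" for v
  proof -
    have "cmod (c * of_real (h / pi * cos (pi * v / h))) = h / (2 * pi\<^sup>2) * \<bar>cos (pi * v / h)\<bar>"
      using h unfolding norm_mult nc norm_of_real abs_mult by (simp add: power2_eq_square)
    also have "\<dots> \<le> h / (2 * pi\<^sup>2) * 1" using h by (intro mult_left_mono) auto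
    finally show ?thesis by simp
  qed
  have d\<sigma>: "(\<sigma> has_real_derivative h / (2 * pi\<^sup>2) * (2 * pi * (2 * (1 + 1 / y\<^sup>2) * K / s / (1 + v\<^sup>2)) + 4 * y * (K / R))) (at v)" for v
  proof -
    have "((\<lambda>x. c0 * (2 * pi * C * arctan x + b * x)) has_real_derivative c0 * (2 * pi * (C / (1 + v\<^sup>2)) + b)) (at v)"
      for c0 C b :: real
    proof -
      have "((\<lambda>x. c0 * (2 * pi * C * arctan x + b * x)) has_real_derivative
          c0 * (2 * pi * C * inverse (1 + v\<^sup>2) + b * 1)) (at v)"
        by (intro DERIV_cmult DERIV_add DERIV_arctan DERIV_ident)
      thus ?thesis by (simp only: divide_inverse mult.assoc mult_1_right)
    qed
    thus ?thesis unfolding \<sigma>_def by blast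
  qed
  have int: "\<bar>v\<bar> + 1 \<le> R" if "- r \<le> v" "v \<le> x" for v using that xr by linarith
  have "cmod (A x - A (- r)) \<le> \<sigma> x - \<sigma> (- r)"
  proof (rule differentiable_bound_general[OF xr(1)])
    show "continuous_on {- r..x} A"
    proof (intro continuous_at_imp_continuous_on ballI)
      fix v assume "v \<in> {- r..x}"
      hence "\<bar>v\<bar> < R" using int[of v] by simp
      thus "isCont A v" using vA has_vector_derivative_continuous by blast
    qed
    show "continuous_on {- r..x} \<sigma>"
      by (intro continuous_at_imp_continuous_on ballI DERIV_isCont[OF d\<sigma>])
    show "(\<sigma> has_vector_derivative h / (2 * pi\<^sup>2) * (2 * pi * (2 * (1 + 1 / y\<^sup>2) * K / s / (1 + v\<^sup>2)) + 4 * y * (K / R))) (at v)" for v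
      using d\<sigma> by (simp add: has_real_derivative_iff_has_vector_derivative)
    fix v assume v: "- r < v" "v < x"
    hence i: "\<bar>v\<bar> + 1 \<le> R" using int[of v] by simp
    show "(A has_vector_derivative c * of_real (h / pi * cos (pi * v / h)) * G' (of_real v)) (at v)"
      using i by (intro vA) simp
    have "cmod (G' (of_real v)) \<le> 2 * pi * (2 * (1 + 1 / y\<^sup>2) * K / s / (1 + v\<^sup>2)) + 4 * y * (K / R)"
      unfolding G'_def f_def s_def R_def by (rule contour_kernel_bounds(2)[OF F h y i[unfolded R_def] K])
    thus "cmod (c * of_real (h / pi * cos (pi * v / h)) * G' (of_real v))
       \<le> h / (2 * pi\<^sup>2) * (2 * pi * (2 * (1 + 1 / y\<^sup>2) * K / s / (1 + v\<^sup>2)) + 4 * y * (K / R))"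
      by (subst norm_mult, intro mult_mono cosb) (use h in auto)
  qed
  also have "\<sigma> x - \<sigma> (- r) = h / (2 * pi\<^sup>2) * (2 * pi * (2 * (1 + 1 / y\<^sup>2) * K / s) * (arctan x - arctan (- r))
        + 4 * y * (K / R) * (x + r))"
  proof -
    have "c0 * (C * t + b * x) - c0 * (C * t' + b * - r) = c0 * (C * (t - t') + b * (x + r))"
      for c0 C b t t' :: real
      by (simp add: algebra_simps)
    thus ?thesis unfolding \<sigma>_def by blast
  qed
  also have "\<dots> \<le> h / (2 * pi\<^sup>2) * (2 * pi * (2 * (1 + 1 / y\<^sup>2) * K / s) * pi + 4 * y * (K / R) * (x + r))"
  proof -
    have "arctan x - arctan (- r) \<le> pi" using arctan_bounded[of x] arctan_bounded[of "-r"] by linarith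
    moreover have "0 \<le> s" unfolding s_def using h y by simp
    ultimately show ?thesis using h K by (intro mult_left_mono add_right_mono) auto
  qed
  finally have bA: "cmod (A x - A (- r)) \<le> h / (2 * pi\<^sup>2) * (2 * pi * (2 * (1 + 1 / y\<^sup>2) * K / s) * pi + 4 * y * (K / R) * (x + r))" .
  have bq: "cmod (q v) \<le> h / (2 * pi\<^sup>2) * (2 * pi * (K / (y * s)) + 4 * y * (K / R))" if i: "\<bar>v\<bar> + 1 \<le> R" for v
  proof -
    have "cmod (G (of_real v)) \<le> 2 * pi * (K / (y * s)) + 4 * y * (K / R)"
      unfolding G_def f_def s_def R_def by (rule contour_kernel_bounds(1)[OF F h y i[unfolded R_def] K])
    thus ?thesis unfolding q_def by (subst norm_mult, intro mult_mono cosb) (use h in auto)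
  qed
  have "p x - p (- r) - (\<Sum>j = - int M..int M. F (of_real (of_int j * h)) *
            of_real (h / pi * (Si (pi * (x - of_int j * h) / h) - Si (pi * (- r - of_int j * h) / h))))
     = A x - A (- r) - q x + q (- r)"
    unfolding A_def Sj_def Fj_def right_diff_distrib of_real_diff sum_subtractf by simp
  also have "cmod \<dots> \<le> cmod (A x - A (- r)) + cmod (q x) + cmod (q (- r))"
    using norm_triangle_ineq4[of "A x - A (- r)" "q x"] norm_triangle_ineq[of "A x - A (- r) - q x" "q (- r)"] by linarith
  also have "\<dots> \<le> h / (2 * pi\<^sup>2) * (2 * pi * (2 * (1 + 1 / y\<^sup>2) * K / s) * pi + 4 * y * (K / R) * (x + r))
      + h / (2 * pi\<^sup>2) * (2 * pi * (K / (y * s)) + 4 * y * (K / R)) + h / (2 * pi\<^sup>2) * (2 * pi * (K / (y * s)) + 4 * y * (K / R))"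
    by (intro add_mono bA bq) (use xr in auto)
  also have "\<dots> = h / (2 * pi\<^sup>2) * (4 * pi\<^sup>2 * (1 + 1 / y\<^sup>2) * K / s + 4 * y * (K / R) * (x + r)
        + 2 * (2 * pi * (K / (y * s)) + 4 * y * (K / R)))"
    by (simp add: power2_eq_square algebra_simps)
  finally show ?thesis .
qed

text \<open>
  The limit \<open>M \<rightarrow> \<infinity>\<close> removes the vertical sides. The boundedness of \<open>Si\<close> bounds the integrals of
  \<open>S j h\<close> by a multiple of \<open>h\<close>, which cancels the factor \<open>1 / h\<close> of the geometric tail.
\<close>

lemma sinc_indefinite_integral_error_inner_strip:
  fixes F :: "complex \<Rightarrow> complex" and p :: "real \<Rightarrow> complex" and h x r y d K K0 B \<beta> :: real and N :: nat
  defines "s \<equiv> sinh (pi * y / h)"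
  assumes F: "F holomorphic_on strip d" and h: "0 < h" and y: "0 < y" "y < d"
    and K: "0 \<le> K" "\<And>\<zeta>. \<zeta> \<in> strip d \<Longrightarrow> cmod (F \<zeta>) \<le> K / (1 + (Re \<zeta>)\<^sup>2)\<^sup>2"
    and \<beta>: "0 < \<beta>" and K0: "0 \<le> K0" "\<And>\<xi>. cmod (F (of_real \<xi>)) \<le> K0 * exp (- \<beta> * \<bar>\<xi>\<bar>)"
    and p: "\<And>x. (p has_vector_derivative F (of_real x)) (at x)"
    and B: "\<And>t. \<bar>Si t\<bar> \<le> B" and xr: "- r < x"
  shows "cmod (p x - p (- r) - (\<Sum>j = - int N..int N. F (of_real (of_int j * h)) *
            of_real (h / pi * (Si (pi * (x - of_int j * h) / h) - Si (pi * (- r - of_int j * h) / h)))))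
     \<le> h * (2 * (1 + 1 / y\<^sup>2) * K / s + 2 / pi * (K / (y * s))) + 4 * B * K0 * exp (- \<beta> * (N * h)) / (pi * \<beta>)"
proof -
  let ?w = "\<lambda>j. h / pi * (Si (pi * (x - of_int j * h) / h) - Si (pi * (- r - of_int j * h) / h))"
  let ?t = "\<lambda>j. F (of_real (of_int j * h)) * of_real (?w j)"
  let ?R = "\<lambda>M::nat. (real M + 1/2) * h"
  let ?X = "\<lambda>M. h / (2 * pi\<^sup>2) * (4 * pi\<^sup>2 * (1 + 1 / y\<^sup>2) * K / s + 4 * y * (K / ?R M) * (x + r)
        + 2 * (2 * pi * (K / (y * s)) + 4 * y * (K / ?R M)))"
  have B0: "0 \<le> B" using B[of 0] by simp
  have lim: "?X \<longlonglongrightarrow> h / (2 * pi\<^sup>2) * (4 * pi\<^sup>2 * (1 + 1 / y\<^sup>2) * K / s + 4 * y * 0 * (x + r)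
        + 2 * (2 * pi * (K / (y * s)) + 4 * y * 0))"
    by (intro tendsto_intros tendsto_divide_0[OF tendsto_const] filterlim_at_top_imp_at_infinity
        filterlim_half_mesh[OF h])
  have "\<forall>\<^sub>F M in sequentially. \<bar>x\<bar> + 1 \<le> ?R M \<and> \<bar>r\<bar> + 1 \<le> ?R M"
    using filterlim_half_mesh[OF h] unfolding filterlim_at_top by (intro eventually_conj) auto
  hence le: "\<forall>\<^sub>F M in sequentially. cmod (p x - p (- r) - (\<Sum>j = - int M..int M. ?t j)) \<le> ?X M"
    unfolding s_def
    by (rule eventually_mono) (use sinc_indefinite_integral_error_rectangle[OF F h y K p xr] in blast)
  have t: "cmod (?t j) \<le> 2 * B * h / pi * K0 * exp (- \<beta> * \<bar>of_int j * h\<bar>)" for j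
  proof -
    have "\<bar>Si (pi * (x - of_int j * h) / h) - Si (pi * (- r - of_int j * h) / h)\<bar> \<le> 2 * B"
      using B[of "pi * (x - of_int j * h) / h"] B[of "pi * (- r - of_int j * h) / h"] by linarith
    hence "h / pi * \<bar>Si (pi * (x - of_int j * h) / h) - Si (pi * (- r - of_int j * h) / h)\<bar> \<le> h / pi * (2 * B)"
      using h by (intro mult_left_mono) auto
    hence w: "\<bar>?w j\<bar> \<le> 2 * B * h / pi" using h by (simp add: abs_mult mult_ac)
    have "cmod (?t j) \<le> K0 * exp (- \<beta> * \<bar>of_int j * h\<bar>) * (2 * B * h / pi)"
      unfolding norm_mult[of "F _"] norm_of_real by (intro mult_mono K0(2) w) (use K0 in auto)
    thus ?thesis by (simp only: mult_ac)
  qed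
  have c0: "0 \<le> 2 * B * h / pi * K0" using B0 h K0 by simp
  have m: "h / (2 * pi\<^sup>2) * (4 * pi\<^sup>2 * m * K / s + 4 * y * 0 * (x + r) + 2 * (2 * pi * q + 4 * y * 0))
      = h * (2 * m * K / s + 2 / pi * q)" for m q
    by (simp add: power2_eq_square distrib_left mult_ac)
  have T: "2 * B * h / pi * K0 * (2 * exp (- \<beta> * (N * h)) / (\<beta> * h)) = 4 * B * K0 * exp (- \<beta> * (N * h)) / (pi * \<beta>)"
    using h by simp
  from norm_diff_truncated_sum_le[OF h \<beta> c0 t lim le, of N] show ?thesis unfolding m T .
qed

text \<open>
  In the limits \<open>r \<rightarrow> \<infinity>\<close> and \<open>y \<rightarrow> d\<close> the lower end \<open>- r\<close> disappears: there \<open>p\<close> tends to \<open>0\<close> and \<open>Si\<close>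
  tends to \<open>- pi / 2\<close>.
\<close>

lemma sinc_indefinite_integral_error:
  fixes F :: "complex \<Rightarrow> complex" and p :: "real \<Rightarrow> complex" and h x d K K0 B \<beta> :: real and N :: nat
  assumes F: "F holomorphic_on strip d" and h: "0 < h" and d: "0 < d"
    and K: "0 \<le> K" "\<And>\<zeta>. \<zeta> \<in> strip d \<Longrightarrow> cmod (F \<zeta>) \<le> K / (1 + (Re \<zeta>)\<^sup>2)\<^sup>2"
    and \<beta>: "0 < \<beta>" and K0: "0 \<le> K0" "\<And>\<xi>. cmod (F (of_real \<xi>)) \<le> K0 * exp (- \<beta> * \<bar>\<xi>\<bar>)"
    and p: "\<And>x. (p has_vector_derivative F (of_real x)) (at x)" and p0: "(p \<longlongrightarrow> 0) at_bot"
    and B: "\<And>t. \<bar>Si t\<bar> \<le> B"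
  shows "cmod (p x - (\<Sum>j = - int N..int N. F (of_real (of_int j * h)) *
            of_real (h * (1 / 2 + 1 / pi * Si (pi * (x - of_int j * h) / h)))))
     \<le> h * (2 * (1 + 1 / d\<^sup>2) * K / sinh (pi * d / h) + 2 / pi * (K / (d * sinh (pi * d / h))))
        + 4 * B * K0 * exp (- \<beta> * (N * h)) / (pi * \<beta>)"
proof -
  let ?u = "\<lambda>j r. h / pi * (Si (pi * (x - of_int j * h) / h) - Si (pi * (- r - of_int j * h) / h))"
  let ?v = "\<lambda>j. h / pi * (Si (pi * (x - of_int j * h) / h) - - (pi / 2))"
  let ?f = "\<lambda>j. F (of_real (of_int j * h))"
  have lim: "((\<lambda>r. cmod (p x - p (- r) - (\<Sum>j = - int N..int N. ?f j * of_real (?u j r))))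
     \<longlongrightarrow> cmod (p x - 0 - (\<Sum>j = - int N..int N. ?f j * of_real (?v j)))) at_top"
  proof (intro tendsto_intros)
    show "((\<lambda>r. p (- r)) \<longlongrightarrow> 0) at_top"
      by (rule filterlim_compose[OF p0 filterlim_uminus_at_bot_at_top])
    show "((\<lambda>r. Si (pi * (- r - real_of_int j * h) / h)) \<longlongrightarrow> - (pi / 2)) at_top" for j
    proof (rule filterlim_compose[OF Si_at_bot])
      show "LIM r at_top. pi * (- r - real_of_int j * h) / h :> at_bot"
        unfolding filterlim_at_bot
      proof
        fix Z :: real
        show "\<forall>\<^sub>F r in at_top. pi * (- r - real_of_int j * h) / h \<le> Z"
        proof (rule eventually_mono[OF eventually_ge_at_top[of "- real_of_int j * h - Z * h / pi"]])
          fix r assume "- real_of_int j * h - Z * h / pi \<le> r"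
          hence "pi * (- r - real_of_int j * h) \<le> pi * (Z * h / pi)"
            by (intro mult_left_mono) auto
          thus "pi * (- r - real_of_int j * h) / h \<le> Z" using h by (simp add: pos_divide_le_eq)
        qed
      qed
    qed
  qed
  have y: "cmod (p x - 0 - (\<Sum>j = - int N..int N. ?f j * of_real (?v j)))
     \<le> h * (2 * (1 + 1 / y\<^sup>2) * K / sinh (pi * y / h) + 2 / pi * (K / (y * sinh (pi * y / h))))
        + 4 * B * K0 * exp (- \<beta> * (N * h)) / (pi * \<beta>)" if y: "0 < y" "y < d" for y
  proof (rule tendsto_upperbound[OF lim])
    show "\<forall>\<^sub>F r in at_top. cmod (p x - p (- r) - (\<Sum>j = - int N..int N. ?f j * of_real (?u j r)))
       \<le> h * (2 * (1 + 1 / y\<^sup>2) * K / sinh (pi * y / h) + 2 / pi * (K / (y * sinh (pi * y / h))))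
        + 4 * B * K0 * exp (- \<beta> * (N * h)) / (pi * \<beta>)"
    proof (rule eventually_mono[OF eventually_gt_at_top[of "- x"]])
      fix r assume "- x < r"
      hence "- r < x" by simp
      from sinc_indefinite_integral_error_inner_strip[OF F h y K \<beta> K0 p B this]
      show "cmod (p x - p (- r) - (\<Sum>j = - int N..int N. ?f j * of_real (?u j r)))
       \<le> h * (2 * (1 + 1 / y\<^sup>2) * K / sinh (pi * y / h) + 2 / pi * (K / (y * sinh (pi * y / h))))
        + 4 * B * K0 * exp (- \<beta> * (N * h)) / (pi * \<beta>)" .
    qed
  qed simp
  have "cmod (p x - 0 - (\<Sum>j = - int N..int N. ?f j * of_real (?v j)))
     \<le> h * (2 * (1 + 1 / d\<^sup>2) * K / sinh (pi * d / h) + 2 / pi * (K / (d * sinh (pi * d / h))))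
        + 4 * B * K0 * exp (- \<beta> * (N * h)) / (pi * \<beta>)"
  proof (rule tendsto_lowerbound)
    show "((\<lambda>y. h * (2 * (1 + 1 / y\<^sup>2) * K / sinh (pi * y / h) + 2 / pi * (K / (y * sinh (pi * y / h))))
        + 4 * B * K0 * exp (- \<beta> * (N * h)) / (pi * \<beta>)) \<longlongrightarrow>
      h * (2 * (1 + 1 / d\<^sup>2) * K / sinh (pi * d / h) + 2 / pi * (K / (d * sinh (pi * d / h))))
        + 4 * B * K0 * exp (- \<beta> * (N * h)) / (pi * \<beta>)) (at_left d)"
      by (intro tendsto_add tendsto_divide tendsto_mult tendsto_power tendsto_sinh_at_left tendsto_const tendsto_ident_at d h)
         (use d h in auto)
    show "\<forall>\<^sub>F y in at_left d. cmod (p x - 0 - (\<Sum>j = - int N..int N. ?f j * of_real (?v j)))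
     \<le> h * (2 * (1 + 1 / y\<^sup>2) * K / sinh (pi * y / h) + 2 / pi * (K / (y * sinh (pi * y / h))))
        + 4 * B * K0 * exp (- \<beta> * (N * h)) / (pi * \<beta>)"
      by (rule eventually_at_leftI[OF _ d], rule y) auto
  qed simp
  moreover have "h / pi * (z - - (pi / 2)) = h * (1 / 2 + 1 / pi * z)" for z
    by (simp add: field_simps)
  ultimately show ?thesis by (simp only: diff_0_right)
qed

section \<open>Volterra equations on a strip\<close>

lemma of_real_in_strip: "0 < d \<Longrightarrow> of_real x \<in> strip d"
  by (simp add: strip_def)

text \<open>
  A substitute for the integral of \<open>F\<close> from \<open>- \<infinity>\<close> to \<open>\<zeta>\<close>. It is linear in \<open>F\<close>, and bounds follow from
  the mean value inequality, so no integrals along paths have to be handled. The condition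
  at \<open>- \<infinity>\<close> on the real axis alone normalises the primitive.
\<close>

definition vanishing_primitive :: "real \<Rightarrow> (complex \<Rightarrow> complex) \<Rightarrow> (complex \<Rightarrow> complex) \<Rightarrow> bool" where
  "vanishing_primitive d F P \<longleftrightarrow> (\<forall>\<zeta>\<in>strip d. (P has_field_derivative F \<zeta>) (at \<zeta>)) \<and>
     ((\<lambda>x. P (of_real x)) \<longlongrightarrow> 0) at_bot"

lemma vanishing_primitive_diff:
  "vanishing_primitive d F P \<Longrightarrow> vanishing_primitive d G Q \<Longrightarrow>
     vanishing_primitive d (\<lambda>\<zeta>. F \<zeta> - G \<zeta>) (\<lambda>\<zeta>. P \<zeta> - Q \<zeta>)"
  unfolding vanishing_primitive_def
  by (auto intro!: derivative_intros intro: tendsto_eq_intros)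

lemma vanishing_primitive_add:
  "vanishing_primitive d F P \<Longrightarrow> vanishing_primitive d G Q \<Longrightarrow>
     vanishing_primitive d (\<lambda>\<zeta>. F \<zeta> + G \<zeta>) (\<lambda>\<zeta>. P \<zeta> + Q \<zeta>)"
  unfolding vanishing_primitive_def
  by (auto intro!: derivative_intros intro: tendsto_eq_intros)

lemma vanishing_primitive_cmult:
  "vanishing_primitive d F P \<Longrightarrow> vanishing_primitive d (\<lambda>\<zeta>. c * F \<zeta>) (\<lambda>\<zeta>. c * P \<zeta>)"
  unfolding vanishing_primitive_def
  by (auto intro!: DERIV_cmult intro: tendsto_mult_right_zero)

lemma vanishing_primitive_zero: "vanishing_primitive d (\<lambda>_. 0) (\<lambda>_. 0)"
  by (simp add: vanishing_primitive_def)

lemma vanishing_primitive_sum: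
  "(\<And>n. n < m \<Longrightarrow> vanishing_primitive d (F n) (P n)) \<Longrightarrow>
    vanishing_primitive d (\<lambda>\<zeta>. \<Sum>n<m. F n \<zeta>) (\<lambda>\<zeta>. \<Sum>n<m. P n \<zeta>)" for m :: nat
proof (induction m)
  case (Suc m)
  thus ?case using vanishing_primitive_add[of d "\<lambda>\<zeta>. \<Sum>n<m. F n \<zeta>" "\<lambda>\<zeta>. \<Sum>n<m. P n \<zeta>" "F m" "P m"] by simp
qed (simp add: vanishing_primitive_zero)

lemma primitive_horizontal_increment:
  assumes P: "\<And>\<zeta>. \<zeta> \<in> strip d \<Longrightarrow> (P has_field_derivative F \<zeta>) (at \<zeta>)"
    and \<sigma>: "\<And>x. (\<sigma> has_real_derivative \<sigma>' x) (at x)"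
    and F: "\<And>\<zeta>. \<zeta> \<in> strip d \<Longrightarrow> cmod (F \<zeta>) \<le> \<sigma>' (Re \<zeta>)"
    and y: "\<bar>y\<bar> < d" and st: "s \<le> t"
  shows "cmod (P (Complex t y) - P (Complex s y)) \<le> \<sigma> t - \<sigma> s"
proof (cases "s = t")
  case False
  hence "s < t" using st by simp
  have in_s: "Complex x y \<in> strip d" for x using y by (simp add: strip_def)
  have D: "((\<lambda>x. P (Complex x y)) has_vector_derivative F (Complex x y)) (at x)" for x
  proof -
    have "((\<lambda>x. Complex x y) has_vector_derivative 1) (at x)"
      unfolding Complex_eq by (auto intro!: derivative_eq_intros)
    from field_vector_diff_chain_at[OF this P[OF in_s]] show ?thesis by (simp add: o_def)
  qed
  show ?thesis
  proof (rule differentiable_bound_general[OF \<open>s < t\<close>, where f' = "\<lambda>x. F (Complex x y)" and \<phi>' = \<sigma>'])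
    show "continuous_on {s..t} (\<lambda>x. P (Complex x y))"
      by (intro continuous_at_imp_continuous_on ballI has_vector_derivative_continuous[OF D])
    show "continuous_on {s..t} \<sigma>"
      by (intro continuous_at_imp_continuous_on ballI DERIV_isCont[OF \<sigma>])
    show "(\<sigma> has_vector_derivative \<sigma>' x) (at x)" for x
      using \<sigma> by (simp add: has_real_derivative_iff_has_vector_derivative)
    show "cmod (F (Complex x y)) \<le> \<sigma>' x" for x using F[OF in_s, of x] by simp
  qed (rule D)
qed simp

lemma primitive_vertical_increment:
  assumes P: "\<And>\<zeta>. \<zeta> \<in> strip d \<Longrightarrow> (P has_field_derivative F \<zeta>) (at \<zeta>)"
    and F: "\<And>\<zeta>. \<zeta> \<in> strip d \<Longrightarrow> cmod (F \<zeta>) \<le> \<sigma>' (Re \<zeta>)"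
    and y: "\<bar>y\<bar> < d"
  shows "cmod (P (Complex x y) - P (of_real x)) \<le> \<sigma>' x * d"
proof -
  have "0 < d" using y by linarith
  have seg: "w \<in> strip d \<and> Re w = x" if "w \<in> closed_segment (of_real x) (Complex x y)" for w
  proof -
    from that obtain u where u: "0 \<le> u" "u \<le> 1" "w = (1 - u) *\<^sub>R of_real x + u *\<^sub>R Complex x y"
      by (auto simp: closed_segment_def)
    have "Re w = x" "Im w = u * y" by (simp_all add: u(3) algebra_simps)
    moreover have "\<bar>u * y\<bar> \<le> 1 * \<bar>y\<bar>" unfolding abs_mult using u by (intro mult_right_mono) auto
    ultimately show ?thesis using y by (simp add: strip_def)
  qed
  have "cmod (P (Complex x y) - P (of_real x)) \<le> \<sigma>' x * cmod (Complex x y - of_real x)"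
  proof (rule field_differentiable_bound[of "closed_segment (of_real x) (Complex x y)" P F])
    show "(P has_field_derivative F w) (at w within closed_segment (of_real x) (Complex x y))"
      if "w \<in> closed_segment (of_real x) (Complex x y)" for w
      using P seg[OF that] has_field_derivative_at_within by blast
    show "cmod (F w) \<le> \<sigma>' x" if "w \<in> closed_segment (of_real x) (Complex x y)" for w
      using F[of w] seg[OF that] by simp
  qed auto
  also have "cmod (Complex x y - of_real x) = \<bar>y\<bar>"
    by (simp add: cmod_def)
  also have "\<sigma>' x * \<bar>y\<bar> \<le> \<sigma>' x * d"
    using F[of "of_real x"] y \<open>0 < d\<close> norm_ge_zero[of "F (of_real x)"]
    by (intro mult_left_mono) (auto simp: of_real_in_strip simp del: norm_ge_zero)
  finally show ?thesis .
qed

text \<open>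
  The point \<open>\<zeta>\<close> is reached from a point \<open>s\<close> far to the left on the real axis by a vertical and a
  horizontal segment. The increment along the vertical segment is at most \<open>\<sigma>' s * d\<close> and vanishes
  as \<open>s \<rightarrow> - \<infinity>\<close>.
\<close>

lemma vanishing_primitive_bound:
  assumes P: "vanishing_primitive d F P"
    and \<sigma>: "\<And>x. (\<sigma> has_real_derivative \<sigma>' x) (at x)" "(\<sigma> \<longlongrightarrow> 0) at_bot" "(\<sigma>' \<longlongrightarrow> 0) at_bot"
    and F: "\<And>\<zeta>. \<zeta> \<in> strip d \<Longrightarrow> cmod (F \<zeta>) \<le> \<sigma>' (Re \<zeta>)"
    and \<zeta>: "\<zeta> \<in> strip d"
  shows "cmod (P \<zeta>) \<le> \<sigma> (Re \<zeta>)"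
proof -
  define x y where "x = Re \<zeta>" and "y = Im \<zeta>"
  have z: "\<zeta> = Complex x y" and y: "\<bar>y\<bar> < d" using \<zeta> by (simp_all add: x_def y_def strip_def)
  have d: "\<And>\<zeta>. \<zeta> \<in> strip d \<Longrightarrow> (P has_field_derivative F \<zeta>) (at \<zeta>)"
    and lim: "((\<lambda>x. P (of_real x)) \<longlongrightarrow> 0) at_bot"
    using P by (auto simp: vanishing_primitive_def)
  have "((\<lambda>s. \<sigma> x - \<sigma> s + \<sigma>' s * d + cmod (P (of_real s))) \<longlongrightarrow> \<sigma> x - 0 + 0 * d + cmod 0) at_bot"
    by (intro tendsto_intros \<sigma> lim)
  moreover have "eventually (\<lambda>s. cmod (P \<zeta>) \<le> \<sigma> x - \<sigma> s + \<sigma>' s * d + cmod (P (of_real s))) at_bot"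
  proof (rule eventually_mono[OF eventually_le_at_bot[of x]])
    fix s assume "s \<le> x"
    have "cmod (P (Complex x y) - P (Complex s y)) \<le> \<sigma> x - \<sigma> s"
      by (rule primitive_horizontal_increment[OF d \<sigma>(1) F y \<open>s \<le> x\<close>])
    moreover have "cmod (P (Complex s y) - P (of_real s)) \<le> \<sigma>' s * d"
      by (rule primitive_vertical_increment[OF d F y])
    moreover have "P \<zeta> = (P (Complex x y) - P (Complex s y)) + (P (Complex s y) - P (of_real s)) + P (of_real s)"
      by (simp add: z)
    ultimately show "cmod (P \<zeta>) \<le> \<sigma> x - \<sigma> s + \<sigma>' s * d + cmod (P (of_real s))"
      using norm_triangle_ineq[of "(P (Complex x y) - P (Complex s y)) + (P (Complex s y) - P (of_real s))" "P (of_real s)"]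
        norm_triangle_ineq[of "P (Complex x y) - P (Complex s y)" "P (Complex s y) - P (of_real s)"]
      by simp
  qed
  ultimately have "cmod (P \<zeta>) \<le> \<sigma> x - 0 + 0 * d + cmod 0"
    by (rule tendsto_lowerbound) simp
  thus ?thesis by (simp add: x_def)
qed

text \<open>
  A primitive exists because the strip is convex. Its values along the negative real axis form a
  Cauchy sequence since the increments are dominated by those of \<open>\<sigma>\<close>; the limit is subtracted.
\<close>

lemma vanishing_primitive_exists:
  assumes d: "0 < d" and holo: "F holomorphic_on strip d"
    and \<sigma>: "\<And>x. (\<sigma> has_real_derivative \<sigma>' x) (at x)" "(\<sigma> \<longlongrightarrow> 0) at_bot"
    and F: "\<And>\<zeta>. \<zeta> \<in> strip d \<Longrightarrow> cmod (F \<zeta>) \<le> \<sigma>' (Re \<zeta>)"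
  obtains P where "vanishing_primitive d F P"
proof -
  obtain P where "\<And>\<zeta>. \<zeta> \<in> strip d \<Longrightarrow> (P has_field_derivative F \<zeta>) (at \<zeta> within strip d)"
    using holomorphic_convex_primitive'[OF strip_convex strip_open holo] by blast
  hence P: "\<And>\<zeta>. \<zeta> \<in> strip d \<Longrightarrow> (P has_field_derivative F \<zeta>) (at \<zeta>)"
    by (simp add: at_within_open[OF _ strip_open])
  define q where "q = (\<lambda>x::real. P (of_real x))"
  have inc: "cmod (q t - q s) \<le> \<sigma> t - \<sigma> s" if "s \<le> t" for s t
    using primitive_horizontal_increment[OF P \<sigma>(1) F, where y = 0 and s = s and t = t] that d
    by (simp add: q_def complex_of_real_def)
  have bot: "filterlim (\<lambda>n::nat. - real n) at_bot sequentially"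
    by (rule filterlim_compose[OF filterlim_uminus_at_bot_at_top filterlim_real_sequentially])
  have "Cauchy (\<lambda>n::nat. q (- real n))"
  proof (rule metric_CauchyI)
    fix e :: real assume e: "0 < e"
    have "Cauchy (\<lambda>n::nat. \<sigma> (- real n))"
      using filterlim_compose[OF \<sigma>(2) bot] by (rule LIMSEQ_imp_Cauchy)
    then obtain M where M: "\<And>m n. m \<ge> M \<Longrightarrow> n \<ge> M \<Longrightarrow> dist (\<sigma> (- real m)) (\<sigma> (- real n)) < e"
      using e unfolding Cauchy_def by metis
    have "dist (q (- real m)) (q (- real n)) < e" if "m \<ge> M" "n \<ge> M" for m n
    proof (cases "m \<le> n")
      case True
      thus ?thesis using inc[of "- real n" "- real m"] M[OF that] by (simp add: dist_norm)
    next
      case False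
      thus ?thesis using inc[of "- real m" "- real n"] M[OF that] by (simp add: dist_norm norm_minus_commute)
    qed
    thus "\<exists>M. \<forall>m\<ge>M. \<forall>n\<ge>M. dist (q (- real m)) (q (- real n)) < e" by blast
  qed
  then obtain l where l: "(\<lambda>n::nat. q (- real n)) \<longlonglongrightarrow> l" by (auto simp: Cauchy_convergent_iff convergent_def)
  have ql: "cmod (q x - l) \<le> \<sigma> x" for x
  proof -
    have "((\<lambda>n::nat. \<sigma> x - \<sigma> (- real n) - cmod (q x - q (- real n))) \<longlonglongrightarrow> \<sigma> x - 0 - cmod (q x - l))"
      by (intro tendsto_intros l filterlim_compose[OF \<sigma>(2) bot])
    moreover have "eventually (\<lambda>n. 0 \<le> \<sigma> x - \<sigma> (- real n) - cmod (q x - q (- real n))) sequentially"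
      using bot[unfolded filterlim_at_bot, rule_format, of x] by (rule eventually_mono) (use inc in auto)
    ultimately have "0 \<le> \<sigma> x - 0 - cmod (q x - l)" by (rule tendsto_lowerbound) simp
    thus ?thesis by simp
  qed
  have "((\<lambda>x. q x - l) \<longlongrightarrow> 0) at_bot"
    by (rule Lim_null_comparison[OF _ \<sigma>(2)]) (use ql in auto)
  hence "vanishing_primitive d F (\<lambda>\<zeta>. P \<zeta> - l)"
    unfolding vanishing_primitive_def q_def using P by (auto intro!: derivative_eq_intros)
  thus ?thesis by (rule that)
qed

text \<open>
  The point is the constant: it depends on \<open>B\<close> and \<open>r\<close> only, so the estimate is uniform over families
  of functions with a common bound.
\<close>

lemma holomorphic_linear_approximation:
  assumes f: "f holomorphic_on A" "open A" and c: "cball c r \<subseteq> A" "0 < r"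
    and B: "\<And>z. z \<in> cball c r \<Longrightarrow> cmod (f z) \<le> B"
    and z: "cmod (z - c) \<le> r / 2"
  shows "cmod (f z - f c - deriv f c * (z - c)) \<le> 8 * B / r\<^sup>2 * (cmod (z - c))\<^sup>2"
proof -
  have sub: "cball c (r / 2) \<subseteq> A" using c by (auto simp: subset_eq)
  have "cmod ((deriv ^^ 0) f z - (\<Sum>i\<le>1. (deriv ^^ i) f c * (z - c) ^ i / fact i))
      \<le> 8 * B / r\<^sup>2 * cmod (z - c) ^ Suc 1 / fact 1"
  proof (rule complex_Taylor[of "cball c (r / 2)"])
    show "((deriv ^^ i) f has_field_derivative (deriv ^^ Suc i) f x) (at x within cball c (r / 2))"
      if "x \<in> cball c (r / 2)" for i x
    proof -
      have "(deriv ^^ i) f holomorphic_on A" by (intro holomorphic_higher_deriv f)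
      hence "((deriv ^^ i) f has_field_derivative deriv ((deriv ^^ i) f) x) (at x)"
        using that sub f(2) holomorphic_derivI by blast
      thus ?thesis by (simp add: has_field_derivative_at_within)
    qed
    show "cmod ((deriv ^^ Suc 1) f x) \<le> 8 * B / r\<^sup>2" if x: "x \<in> cball c (r / 2)" for x
    proof -
      have s: "cball x (r / 2) \<subseteq> cball c r"
      proof
        fix w assume "w \<in> cball x (r / 2)"
        thus "w \<in> cball c r" using x dist_triangle[of c w x] by auto
      qed
      have "cmod ((deriv ^^ 2) f x) \<le> fact 2 * B / (r / 2) ^ 2"
      proof (rule Cauchy_inequality)
        show "f holomorphic_on ball x (r / 2)"
          using s c by (intro holomorphic_on_subset[OF f(1)]) (use ball_subset_cball in blast)
        show "continuous_on (cball x (r / 2)) f"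
          using s c by (intro holomorphic_on_imp_continuous_on holomorphic_on_subset[OF f(1)]) blast
        show "cmod (f w) \<le> B" if "cmod (x - w) = r / 2" for w
          by (rule B) (use s that in \<open>auto simp: dist_norm\<close>)
      qed (use c in auto)
      thus ?thesis by (simp add: numeral_2_eq_2 power2_eq_square fact_numeral)
    qed
  qed (use z c in \<open>auto simp: dist_norm norm_minus_commute\<close>)
  thus ?thesis by (simp add: power2_eq_square algebra_simps)
qed

lemma has_field_derivative_quadratic_remainder:
  fixes f :: "complex \<Rightarrow> complex"
  assumes "0 < e" and "\<And>z. cmod (z - c) \<le> e \<Longrightarrow> cmod (f z) \<le> A * (cmod (z - c))\<^sup>2"
  shows "(f has_field_derivative 0) (at c)"
proof -
  have fc: "f c = 0" using assms(2)[of c] assms(1) by simp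
  have "((\<lambda>z. (f z - f c) / (z - c)) \<longlongrightarrow> 0) (at c)"
  proof (rule Lim_null_comparison)
    show "\<forall>\<^sub>F z in at c. cmod ((f z - f c) / (z - c)) \<le> A * cmod (z - c)"
      unfolding eventually_at
    proof (intro exI[of _ e] conjI ballI impI assms)
      fix z assume z: "z \<noteq> c \<and> dist z c < e"
      hence "cmod (f z) \<le> A * cmod (z - c) * cmod (z - c)"
        using assms(2)[of z] by (simp add: dist_norm power2_eq_square mult.assoc)
      thus "cmod ((f z - f c) / (z - c)) \<le> A * cmod (z - c)"
        using z by (simp add: fc norm_divide pos_divide_le_eq)
    qed
    have "((\<lambda>z. A * cmod (z - c)) \<longlongrightarrow> A * cmod (c - c)) (at c)" by (intro tendsto_intros)
    thus "((\<lambda>z. A * cmod (z - c)) \<longlongrightarrow> 0) (at c)" by simp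
  qed
  thus ?thesis by (simp add: has_field_derivative_iff)
qed

text \<open>
  Integrands on the strip are bounded by multiples of \<open>\<rho> (Re \<zeta>)\<close>, and \<open>\<tau>\<close> is the corresponding
  clock. In the application \<open>\<tau> x\<close> is the distance of \<open>SE_psi a b x\<close> from \<open>a\<close>.
\<close>

locale strip_weight =
  fixes d L A :: real and \<tau> \<rho> :: "real \<Rightarrow> real"
  assumes d: "0 < d"
    and \<tau>: "\<And>x. (\<tau> has_real_derivative \<rho> x) (at x)" "(\<tau> \<longlongrightarrow> 0) at_bot" "\<And>x. \<tau> x \<le> L"
    and \<rho>: "\<And>x. 0 \<le> \<rho> x" "\<And>x. \<rho> x \<le> A" "(\<rho> \<longlongrightarrow> 0) at_bot"
begin

lemma \<tau>_mono: "s \<le> t \<Longrightarrow> \<tau> s \<le> \<tau> t"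
  using \<tau>(1) \<rho>(1) by (meson DERIV_nonneg_imp_nondecreasing)

lemma \<tau>_nonneg: "0 \<le> \<tau> x"
proof (rule tendsto_upperbound[OF \<tau>(2)])
  show "\<forall>\<^sub>F s in at_bot. \<tau> s \<le> \<tau> x"
    by (rule eventually_mono[OF eventually_le_at_bot[of x]]) (rule \<tau>_mono)
qed simp

lemma L_nonneg: "0 \<le> L"
  using \<tau>_nonneg \<tau>(3) order_trans by blast

lemma weighted_primitive_exists:
  assumes "F holomorphic_on strip d" and F: "\<And>\<zeta>. \<zeta> \<in> strip d \<Longrightarrow> cmod (F \<zeta>) \<le> c * \<rho> (Re \<zeta>)"
  shows "\<exists>P. vanishing_primitive d F P"
proof -
  have "((\<lambda>x. c * \<tau> x) \<longlongrightarrow> 0) at_bot" by (intro tendsto_mult_right_zero \<tau>)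
  from vanishing_primitive_exists[OF d assms(1) DERIV_cmult[OF \<tau>(1)] this F] show ?thesis by blast
qed

lemma weighted_primitive_bound:
  assumes "vanishing_primitive d F P" and F: "\<And>\<zeta>. \<zeta> \<in> strip d \<Longrightarrow> cmod (F \<zeta>) \<le> c * \<rho> (Re \<zeta>)"
    and "\<zeta> \<in> strip d"
  shows "cmod (P \<zeta>) \<le> c * \<tau> (Re \<zeta>)"
  by (rule vanishing_primitive_bound[OF assms(1) DERIV_cmult[OF \<tau>(1)] _ _ F assms(3)])
     (intro tendsto_mult_right_zero \<tau> \<rho>)+

text \<open>
  In the norm with weight \<open>exp (- \<mu> * \<tau> (Re \<zeta>))\<close> the passage to the primitive gains a factor
  \<open>1 / \<mu>\<close>. This makes the Neumann series geometric.
\<close>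

lemma exp_weighted_primitive_bound:
  assumes "vanishing_primitive d F P" and \<mu>: "0 < \<mu>" and c: "0 \<le> c"
    and F: "\<And>\<zeta>. \<zeta> \<in> strip d \<Longrightarrow> cmod (F \<zeta>) \<le> c * exp (\<mu> * \<tau> (Re \<zeta>)) * \<rho> (Re \<zeta>)"
    and "\<zeta> \<in> strip d"
  shows "cmod (P \<zeta>) \<le> c / \<mu> * exp (\<mu> * \<tau> (Re \<zeta>))"
proof -
  have "cmod (P \<zeta>) \<le> c / \<mu> * (exp (\<mu> * \<tau> (Re \<zeta>)) - 1)"
  proof (rule vanishing_primitive_bound[OF assms(1) _ _ _ F assms(5)])
    show "((\<lambda>x. c / \<mu> * (exp (\<mu> * \<tau> x) - 1)) has_real_derivative c * exp (\<mu> * \<tau> x) * \<rho> x) (at x)" for x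
      using \<mu> by (auto intro!: derivative_eq_intros \<tau>(1) simp: field_simps)
    have "((\<lambda>x. c / \<mu> * (exp (\<mu> * \<tau> x) - 1)) \<longlongrightarrow> c / \<mu> * (exp (\<mu> * 0) - 1)) at_bot"
      by (intro tendsto_intros \<tau>)
    thus "((\<lambda>x. c / \<mu> * (exp (\<mu> * \<tau> x) - 1)) \<longlongrightarrow> 0) at_bot" by simp
    have "((\<lambda>x. c * exp (\<mu> * \<tau> x) * \<rho> x) \<longlongrightarrow> c * exp (\<mu> * 0) * 0) at_bot"
      by (intro tendsto_intros \<tau> \<rho>)
    thus "((\<lambda>x. c * exp (\<mu> * \<tau> x) * \<rho> x) \<longlongrightarrow> 0) at_bot" by simp
  qed
  also have "\<dots> \<le> c / \<mu> * exp (\<mu> * \<tau> (Re \<zeta>))" using c \<mu> by (intro mult_left_mono) auto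
  finally show ?thesis .
qed

end

text \<open>
  The kernel \<open>\<kappa>\<close> contains the Jacobian of the change of variables, whence the bound by \<open>\<rho>\<close>.
\<close>

locale strip_kernel = strip_weight +
  fixes \<kappa> :: "complex \<Rightarrow> complex \<Rightarrow> complex" and C :: real
  assumes C: "0 < C"
    and \<kappa>_holo1: "\<And>\<omega>. \<omega> \<in> strip d \<Longrightarrow> (\<lambda>\<zeta>. \<kappa> \<zeta> \<omega>) holomorphic_on strip d"
    and \<kappa>_holo2: "\<And>\<zeta>. \<zeta> \<in> strip d \<Longrightarrow> \<kappa> \<zeta> holomorphic_on strip d"
    and \<kappa>_bound: "\<And>\<zeta> \<omega>. \<zeta> \<in> strip d \<Longrightarrow> \<omega> \<in> strip d \<Longrightarrow> cmod (\<kappa> \<zeta> \<omega>) \<le> C * \<rho> (Re \<omega>)"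
begin

lemma kernel_linear_approximation:
  assumes c: "cball c r \<subseteq> strip d" "0 < r" and \<omega>: "\<omega> \<in> strip d" and z: "cmod (z - c) \<le> r / 2"
  shows "cmod (\<kappa> z \<omega> - \<kappa> c \<omega> - deriv (\<lambda>z. \<kappa> z \<omega>) c * (z - c)) \<le> 8 * C / r\<^sup>2 * (cmod (z - c))\<^sup>2 * \<rho> (Re \<omega>)"
proof -
  have "cmod (\<kappa> z \<omega>) \<le> C * \<rho> (Re \<omega>)" if "z \<in> cball c r" for z
    using \<kappa>_bound[OF _ \<omega>] c that by blast
  from holomorphic_linear_approximation[OF \<kappa>_holo1[OF \<omega>] strip_open c this z]
  show ?thesis by (simp add: mult_ac)
qed

lemma kernel_deriv_bound:
  assumes c: "cball c r \<subseteq> strip d" "0 < r" and \<omega>: "\<omega> \<in> strip d"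
  shows "cmod (deriv (\<lambda>z. \<kappa> z \<omega>) c) \<le> C / r * \<rho> (Re \<omega>)"
proof -
  have "cmod ((deriv ^^ 1) (\<lambda>z. \<kappa> z \<omega>) c) \<le> fact 1 * (C * \<rho> (Re \<omega>)) / r ^ 1"
  proof (rule Cauchy_inequality)
    show "(\<lambda>z. \<kappa> z \<omega>) holomorphic_on ball c r"
      using c by (intro holomorphic_on_subset[OF \<kappa>_holo1[OF \<omega>]]) (use ball_subset_cball in blast)
    show "continuous_on (cball c r) (\<lambda>z. \<kappa> z \<omega>)"
      using c by (intro holomorphic_on_imp_continuous_on holomorphic_on_subset[OF \<kappa>_holo1[OF \<omega>]])
    show "cmod (\<kappa> w \<omega>) \<le> C * \<rho> (Re \<omega>)" if "cmod (c - w) = r" for w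
      using that c by (intro \<kappa>_bound \<omega>) (auto simp: dist_norm subset_eq)
  qed (rule c)
  thus ?thesis by simp
qed

text \<open>
  The derivative in the first variable is a uniform limit of difference quotients, each of which
  is holomorphic in the second variable.
\<close>

lemma kernel_deriv_holomorphic:
  assumes c: "c \<in> strip d"
  shows "(\<lambda>\<omega>. deriv (\<lambda>z. \<kappa> z \<omega>) c) holomorphic_on strip d"
proof -
  obtain r where r: "0 < r" "cball c r \<subseteq> strip d"
    using c strip_open open_contains_cball by blast
  define \<delta> where "\<delta> = (\<lambda>n::nat. complex_of_real (r / (real n + 2)))"
  have \<delta>: "\<delta> n \<noteq> 0" "cmod (\<delta> n) \<le> r / 2" for n
  proof -
    have "0 < r / (real n + 2)" "r / (real n + 2) \<le> r / 2"
      using r by (simp, intro divide_left_mono) auto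
    thus "\<delta> n \<noteq> 0" "cmod (\<delta> n) \<le> r / 2"
      unfolding \<delta>_def norm_of_real of_real_eq_0_iff by linarith+
  qed
  have \<delta>0: "(\<lambda>n. cmod (\<delta> n)) \<longlonglongrightarrow> 0"
  proof -
    have "(\<lambda>n. r / (real n + 2)) \<longlonglongrightarrow> 0" by real_asymp
    hence "(\<lambda>n. \<bar>r / (real n + 2)\<bar>) \<longlonglongrightarrow> 0" by (rule tendsto_rabs_zero)
    thus ?thesis by (simp only: \<delta>_def norm_of_real)
  qed
  have cd: "c + \<delta> n \<in> strip d" for n
    using r \<delta>(2)[of n] by (auto simp: subset_eq dist_norm)
  define q where "q = (\<lambda>n \<omega>. (\<kappa> (c + \<delta> n) \<omega> - \<kappa> c \<omega>) / \<delta> n)"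
  have lim: "(\<lambda>n. 8 * C / r\<^sup>2 * cmod (\<delta> n) * A) \<longlonglongrightarrow> 0"
    using \<delta>0 by (intro tendsto_mult_left_zero tendsto_mult_right_zero)
  have qb: "cmod (q n \<omega> - deriv (\<lambda>z. \<kappa> z \<omega>) c) \<le> 8 * C / r\<^sup>2 * cmod (\<delta> n) * A" if \<omega>: "\<omega> \<in> strip d" for n \<omega>
  proof -
    have "q n \<omega> - deriv (\<lambda>z. \<kappa> z \<omega>) c = (\<kappa> (c + \<delta> n) \<omega> - \<kappa> c \<omega> - deriv (\<lambda>z. \<kappa> z \<omega>) c * \<delta> n) / \<delta> n"
      using \<delta>(1) by (simp add: q_def diff_divide_distrib)
    also have "cmod \<dots> \<le> (8 * C / r\<^sup>2 * (cmod (\<delta> n))\<^sup>2 * \<rho> (Re \<omega>)) / cmod (\<delta> n)"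
      unfolding norm_divide
      using kernel_linear_approximation[OF r(2,1) \<omega>, of "c + \<delta> n"] \<delta>(2)[of n]
      by (intro divide_right_mono) auto
    also have "\<dots> = 8 * C / r\<^sup>2 * cmod (\<delta> n) * \<rho> (Re \<omega>)"
      using \<delta>(1)[of n] by (simp add: power2_eq_square)
    also have "\<dots> \<le> 8 * C / r\<^sup>2 * cmod (\<delta> n) * A"
      using C \<rho> by (intro mult_left_mono) auto
    finally show ?thesis .
  qed
  show ?thesis
  proof (rule holomorphic_uniform_sequence[OF strip_open])
    show "q n holomorphic_on strip d" for n
      unfolding q_def using \<delta>(1) by (intro holomorphic_intros \<kappa>_holo2 cd c)
    fix x assume "x \<in> strip d"
    then obtain e where e: "0 < e" "cball x e \<subseteq> strip d"
      using strip_open open_contains_cball by blast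
    have "uniform_limit (cball x e) q (\<lambda>\<omega>. deriv (\<lambda>z. \<kappa> z \<omega>) c) sequentially"
    proof (rule uniform_limitI)
      fix \<epsilon> :: real assume "0 < \<epsilon>"
      with lim have "\<forall>\<^sub>F n in sequentially. 8 * C / r\<^sup>2 * cmod (\<delta> n) * A < \<epsilon>"
        by (rule order_tendstoD(2))
      thus "\<forall>\<^sub>F n in sequentially. \<forall>\<omega>\<in>cball x e. dist (q n \<omega>) (deriv (\<lambda>z. \<kappa> z \<omega>) c) < \<epsilon>"
      proof (rule eventually_mono, intro ballI)
        fix n \<omega> assume *: "8 * C / r\<^sup>2 * cmod (\<delta> n) * A < \<epsilon>" "\<omega> \<in> cball x e"
        have "\<omega> \<in> strip d" using e *(2) by blast
        from qb[OF this, of n] *(1) show "dist (q n \<omega>) (deriv (\<lambda>z. \<kappa> z \<omega>) c) < \<epsilon>"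
          unfolding dist_norm by linarith
      qed
    qed
    thus "\<exists>e. 0 < e \<and> cball x e \<subseteq> strip d \<and>
        uniform_limit (cball x e) q (\<lambda>\<omega>. deriv (\<lambda>z. \<kappa> z \<omega>) c) sequentially"
      using e by blast
  qed
qed

text \<open>
  Here \<open>\<zeta>\<close> enters twice, as the parameter of the kernel and as the end point of the integral. Near
  \<open>c\<close> one has \<open>\<Phi> \<zeta> \<zeta> = \<Phi> c \<zeta> + (\<zeta> - c) * \<Psi> \<zeta> + E \<zeta>\<close>, where \<open>\<Psi>\<close> is the vanishing primitive of
  the kernel differentiated in the first variable at \<open>c\<close>. The first two terms are differentiable
  because \<open>\<Phi> c\<close> and \<open>\<Psi>\<close> are primitives, and \<open>E\<close> is of second order because the passage to the
  primitive is linear and bounded.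
\<close>

lemma diagonal_primitive_holomorphic:
  assumes U: "U holomorphic_on strip d" and m: "\<And>\<zeta>. \<zeta> \<in> strip d \<Longrightarrow> cmod (U \<zeta>) \<le> m"
    and \<Phi>: "\<And>\<zeta>. \<zeta> \<in> strip d \<Longrightarrow> vanishing_primitive d (\<lambda>\<omega>. \<kappa> \<zeta> \<omega> * U \<omega>) (\<Phi> \<zeta>)"
  shows "(\<lambda>\<zeta>. \<Phi> \<zeta> \<zeta>) holomorphic_on strip d"
  unfolding holomorphic_on_open[OF strip_open]
proof
  fix c assume c: "c \<in> strip d"
  have m0: "0 \<le> m" using m[OF c] norm_ge_zero order_trans by blast
  obtain r where r: "0 < r" "cball c r \<subseteq> strip d"
    using c strip_open open_contains_cball by blast
  define D where "D = (\<lambda>\<omega>. deriv (\<lambda>z. \<kappa> z \<omega>) c)"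
  have "cmod (D \<omega> * U \<omega>) \<le> C / r * m * \<rho> (Re \<omega>)" if "\<omega> \<in> strip d" for \<omega>
  proof -
    have "cmod (D \<omega> * U \<omega>) \<le> (C / r * \<rho> (Re \<omega>)) * m" unfolding norm_mult D_def
      by (intro mult_mono kernel_deriv_bound[OF r(2,1) that] m[OF that]) (use C r \<rho> in auto)
    thus ?thesis by (simp add: mult_ac)
  qed
  then obtain \<Psi> where \<Psi>: "vanishing_primitive d (\<lambda>\<omega>. D \<omega> * U \<omega>) \<Psi>"
    using weighted_primitive_exists[of "\<lambda>\<omega>. D \<omega> * U \<omega>"] kernel_deriv_holomorphic[OF c] U
    unfolding D_def by (metis holomorphic_on_mult)
  \<comment> \<open>The second order remainder, estimated below at the point \<open>\<zeta>\<close> as a primitive with fixed parameters \<open>\<zeta>\<close> and \<open>c\<close>.\<close>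
  define E where "E = (\<lambda>\<zeta>. \<Phi> \<zeta> \<zeta> - \<Phi> c \<zeta> - (\<zeta> - c) * \<Psi> \<zeta>)"
  have E: "cmod (E \<zeta>) \<le> 8 * C / r\<^sup>2 * m * L * (cmod (\<zeta> - c))\<^sup>2" if \<zeta>: "cmod (\<zeta> - c) \<le> r / 2" for \<zeta>
  proof -
    have \<zeta>s: "\<zeta> \<in> strip d" using \<zeta> r by (auto simp: subset_eq dist_norm norm_minus_commute)
    have vp: "vanishing_primitive d (\<lambda>\<omega>. (\<kappa> \<zeta> \<omega> * U \<omega> - \<kappa> c \<omega> * U \<omega>) - (\<zeta> - c) * (D \<omega> * U \<omega>))
        (\<lambda>\<omega>. \<Phi> \<zeta> \<omega> - \<Phi> c \<omega> - (\<zeta> - c) * \<Psi> \<omega>)"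
      by (intro vanishing_primitive_diff vanishing_primitive_cmult \<Phi> \<Psi> \<zeta>s c)
    have "cmod (E \<zeta>) \<le> (8 * C / r\<^sup>2 * m * (cmod (\<zeta> - c))\<^sup>2) * \<tau> (Re \<zeta>)"
      unfolding E_def
    proof (rule weighted_primitive_bound[OF vp _ \<zeta>s])
      fix \<omega> assume \<omega>: "\<omega> \<in> strip d"
      have "(\<kappa> \<zeta> \<omega> * U \<omega> - \<kappa> c \<omega> * U \<omega>) - (\<zeta> - c) * (D \<omega> * U \<omega>) = (\<kappa> \<zeta> \<omega> - \<kappa> c \<omega> - D \<omega> * (\<zeta> - c)) * U \<omega>"
        by (simp add: algebra_simps)
      also have "cmod \<dots> \<le> 8 * C / r\<^sup>2 * (cmod (\<zeta> - c))\<^sup>2 * \<rho> (Re \<omega>) * m"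
        unfolding norm_mult D_def
        by (intro mult_mono kernel_linear_approximation[OF r(2,1) \<omega> \<zeta>] m[OF \<omega>]) (use C \<rho> in auto)
      finally show "cmod ((\<kappa> \<zeta> \<omega> * U \<omega> - \<kappa> c \<omega> * U \<omega>) - (\<zeta> - c) * (D \<omega> * U \<omega>))
          \<le> 8 * C / r\<^sup>2 * m * (cmod (\<zeta> - c))\<^sup>2 * \<rho> (Re \<omega>)" by (simp add: mult_ac)
    qed
    also have "\<dots> \<le> (8 * C / r\<^sup>2 * m * (cmod (\<zeta> - c))\<^sup>2) * L"
      using C m0 \<tau>(3) by (intro mult_left_mono) auto
    finally show ?thesis by (simp add: mult_ac)
  qed
  have dE: "(E has_field_derivative 0) (at c)"
    by (rule has_field_derivative_quadratic_remainder[of "r / 2", OF _ E]) (use r in auto)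
  have d\<Phi>: "(\<Phi> c has_field_derivative \<kappa> c c * U c) (at c)" using \<Phi>[OF c] c by (auto simp: vanishing_primitive_def)
  have d\<Psi>: "(\<Psi> has_field_derivative D c * U c) (at c)" using \<Psi> c by (auto simp: vanishing_primitive_def)
  have "((\<lambda>\<zeta>. \<Phi> c \<zeta> + (\<zeta> - c) * \<Psi> \<zeta> + E \<zeta>) has_field_derivative \<kappa> c c * U c + \<Psi> c) (at c)"
    by (auto intro!: derivative_eq_intros dE d\<Phi> d\<Psi>)
  moreover have "(\<lambda>\<zeta>. \<Phi> c \<zeta> + (\<zeta> - c) * \<Psi> \<zeta> + E \<zeta>) = (\<lambda>\<zeta>. \<Phi> \<zeta> \<zeta>)"
    by (simp add: E_def fun_eq_iff)
  ultimately show "\<exists>f'. ((\<lambda>\<zeta>. \<Phi> \<zeta> \<zeta>) has_field_derivative f') (at c)" by auto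
qed

lemma kernel_primitive_exists:
  assumes U: "U holomorphic_on strip d" and m: "\<And>\<zeta>. \<zeta> \<in> strip d \<Longrightarrow> cmod (U \<zeta>) \<le> m"
    and \<zeta>: "\<zeta> \<in> strip d"
  shows "\<exists>P. vanishing_primitive d (\<lambda>\<omega>. \<kappa> \<zeta> \<omega> * U \<omega>) P"
proof (rule weighted_primitive_exists)
  show "(\<lambda>\<omega>. \<kappa> \<zeta> \<omega> * U \<omega>) holomorphic_on strip d"
    by (intro holomorphic_on_mult \<kappa>_holo2 \<zeta> U)
  fix \<omega> assume \<omega>: "\<omega> \<in> strip d"
  have "cmod (\<kappa> \<zeta> \<omega> * U \<omega>) \<le> C * \<rho> (Re \<omega>) * m"
    unfolding norm_mult by (intro mult_mono \<kappa>_bound \<zeta> \<omega> m) (use C \<rho> in auto)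
  thus "cmod (\<kappa> \<zeta> \<omega> * U \<omega>) \<le> C * m * \<rho> (Re \<omega>)" by (simp add: mult_ac)
qed

lemma kernel_primitive_bound:
  assumes "vanishing_primitive d (\<lambda>\<omega>. \<kappa> \<zeta> \<omega> * U \<omega>) P"
    and m: "\<And>\<zeta>. \<zeta> \<in> strip d \<Longrightarrow> cmod (U \<zeta>) \<le> m"
    and \<zeta>: "\<zeta> \<in> strip d" and \<eta>: "\<eta> \<in> strip d"
  shows "cmod (P \<eta>) \<le> C * m * \<tau> (Re \<eta>)"
proof (rule weighted_primitive_bound[OF assms(1) _ \<eta>])
  fix \<omega> assume \<omega>: "\<omega> \<in> strip d"
  have "cmod (\<kappa> \<zeta> \<omega> * U \<omega>) \<le> C * \<rho> (Re \<omega>) * m"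
    unfolding norm_mult by (intro mult_mono \<kappa>_bound \<zeta> \<omega> m) (use C \<rho> in auto)
  thus "cmod (\<kappa> \<zeta> \<omega> * U \<omega>) \<le> C * m * \<rho> (Re \<omega>)" by (simp add: mult_ac)
qed

definition volterra_op :: "(complex \<Rightarrow> complex) \<Rightarrow> complex \<Rightarrow> complex" where
  "volterra_op U \<zeta> = (SOME P. vanishing_primitive d (\<lambda>\<omega>. \<kappa> \<zeta> \<omega> * U \<omega>) P) \<zeta>"

lemma volterra_op_primitive:
  assumes U: "U holomorphic_on strip d" and m: "\<And>\<zeta>. \<zeta> \<in> strip d \<Longrightarrow> cmod (U \<zeta>) \<le> m"
  obtains \<Phi> where "\<And>\<zeta>. \<zeta> \<in> strip d \<Longrightarrow> vanishing_primitive d (\<lambda>\<omega>. \<kappa> \<zeta> \<omega> * U \<omega>) (\<Phi> \<zeta>)"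
    and "volterra_op U = (\<lambda>\<zeta>. \<Phi> \<zeta> \<zeta>)"
proof (rule that)
  show "vanishing_primitive d (\<lambda>\<omega>. \<kappa> \<zeta> \<omega> * U \<omega>) (SOME P. vanishing_primitive d (\<lambda>\<omega>. \<kappa> \<zeta> \<omega> * U \<omega>) P)"
    if "\<zeta> \<in> strip d" for \<zeta>
    using kernel_primitive_exists[OF U m that] by (rule someI_ex)
qed (auto simp: volterra_op_def)

text \<open>
  Neumann series. With \<open>\<mu> = 2 * C\<close> every application of the integral operator halves the norm with
  weight \<open>exp (- \<mu> * \<tau> (Re \<zeta>))\<close>, so that the series converges uniformly on the strip.
\<close>

lemma volterra_equation_holomorphic_solution:
  assumes G: "G holomorphic_on strip d" and B: "\<And>\<zeta>. \<zeta> \<in> strip d \<Longrightarrow> cmod (G \<zeta>) \<le> B"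
  obtains U \<Phi> m where "U holomorphic_on strip d" "\<And>\<zeta>. \<zeta> \<in> strip d \<Longrightarrow> cmod (U \<zeta>) \<le> m"
    "\<And>\<zeta>. \<zeta> \<in> strip d \<Longrightarrow> vanishing_primitive d (\<lambda>\<omega>. \<kappa> \<zeta> \<omega> * U \<omega>) (\<Phi> \<zeta>)"
    "\<And>\<zeta>. \<zeta> \<in> strip d \<Longrightarrow> U \<zeta> = G \<zeta> + \<Phi> \<zeta> \<zeta>"
proof -
  have B0: "0 \<le> B" using B[OF of_real_in_strip[OF d]] norm_ge_zero order_trans by blast
  define \<mu> where "\<mu> = 2 * C"
  have \<mu>: "0 < \<mu>" using C by (simp add: \<mu>_def)
  define V where "V = (\<lambda>n. (volterra_op ^^ n) G)"
  define M where "M = B * exp (\<mu> * L)"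
  have M0: "0 \<le> M" using B0 by (simp add: M_def)
  have expL: "exp (\<mu> * \<tau> x) \<le> exp (\<mu> * L)" for x using \<tau>(3) \<mu> by simp
  have step: "V n holomorphic_on strip d \<and> (\<forall>\<zeta>\<in>strip d. cmod (V n \<zeta>) \<le> B / 2 ^ n * exp (\<mu> * \<tau> (Re \<zeta>)))" for n
  proof (induction n)
    case 0
    have "cmod (G \<zeta>) \<le> B * exp (\<mu> * \<tau> (Re \<zeta>))" if "\<zeta> \<in> strip d" for \<zeta>
    proof -
      have "1 \<le> exp (\<mu> * \<tau> (Re \<zeta>))" using \<mu> \<tau>_nonneg by simp
      hence "B * 1 \<le> B * exp (\<mu> * \<tau> (Re \<zeta>))" using B0 by (rule mult_left_mono)
      thus ?thesis using B[OF that] by simp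
    qed
    thus ?case using G by (simp add: V_def)
  next
    case (Suc n)
    let ?b = "B / 2 ^ n"
    have b0: "0 \<le> ?b" using B0 by simp
    have bd: "cmod (V n \<zeta>) \<le> ?b * exp (\<mu> * L)" if "\<zeta> \<in> strip d" for \<zeta>
      using Suc that mult_left_mono[OF expL b0] order_trans by blast
    obtain \<Phi> where \<Phi>: "\<And>\<zeta>. \<zeta> \<in> strip d \<Longrightarrow> vanishing_primitive d (\<lambda>\<omega>. \<kappa> \<zeta> \<omega> * V n \<omega>) (\<Phi> \<zeta>)"
      and op: "volterra_op (V n) = (\<lambda>\<zeta>. \<Phi> \<zeta> \<zeta>)"
      using volterra_op_primitive[where U = "V n", OF _ bd] Suc by blast
    have eq: "V (Suc n) = (\<lambda>\<zeta>. \<Phi> \<zeta> \<zeta>)" using op by (simp add: V_def)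
    have "cmod (\<Phi> \<zeta> \<zeta>) \<le> C * ?b / \<mu> * exp (\<mu> * \<tau> (Re \<zeta>))" if \<zeta>: "\<zeta> \<in> strip d" for \<zeta>
    proof (rule exp_weighted_primitive_bound[OF \<Phi>[OF \<zeta>] \<mu> _ _ \<zeta>])
      fix \<omega> assume \<omega>: "\<omega> \<in> strip d"
      have "cmod (\<kappa> \<zeta> \<omega> * V n \<omega>) \<le> C * \<rho> (Re \<omega>) * (?b * exp (\<mu> * \<tau> (Re \<omega>)))"
        unfolding norm_mult using Suc \<omega> by (intro mult_mono \<kappa>_bound \<zeta> \<omega>) (use C \<rho> in auto)
      thus "cmod (\<kappa> \<zeta> \<omega> * V n \<omega>) \<le> C * ?b * exp (\<mu> * \<tau> (Re \<omega>)) * \<rho> (Re \<omega>)" by (simp add: mult_ac)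
    qed (use C b0 in \<open>intro mult_nonneg_nonneg; simp\<close>)
    moreover have eqb: "C * ?b / \<mu> = B / 2 ^ Suc n" using C by (simp add: \<mu>_def)
    moreover have "(\<lambda>\<zeta>. \<Phi> \<zeta> \<zeta>) holomorphic_on strip d"
      by (rule diagonal_primitive_holomorphic[OF _ bd \<Phi>]) (use Suc in auto)
    ultimately show ?case unfolding eq eqb[symmetric] by blast
  qed
  have Vb: "cmod (V n \<zeta>) \<le> M * (1 / 2) ^ n" if "\<zeta> \<in> strip d" for n \<zeta>
  proof -
    have "cmod (V n \<zeta>) \<le> B / 2 ^ n * exp (\<mu> * L)"
      using step[of n] that mult_left_mono[OF expL, of "B / 2 ^ n"] B0 order_trans
      by (meson divide_nonneg_nonneg zero_le_numeral zero_le_power)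
    thus ?thesis by (simp add: M_def power_one_over mult_ac)
  qed
  define U where "U = (\<lambda>\<zeta>. \<Sum>n. V n \<zeta>)"
  have sm: "summable (\<lambda>n. M * (1 / 2) ^ n :: real)" by (intro summable_mult summable_geometric) simp
  have ul: "uniform_limit (strip d) (\<lambda>n \<zeta>. \<Sum>i<n. V i \<zeta>) U sequentially"
    unfolding U_def by (rule Weierstrass_m_test[OF Vb sm])
  have Sh: "(\<lambda>\<zeta>. \<Sum>i<n. V i \<zeta>) holomorphic_on strip d" for n
    using step by (intro holomorphic_on_sum) auto
  have Uh: "U holomorphic_on strip d"
  proof (rule holomorphic_uniform_sequence[OF strip_open Sh])
    fix x assume "x \<in> strip d"
    then obtain e where "0 < e" "cball x e \<subseteq> strip d"
      using strip_open open_contains_cball by blast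
    thus "\<exists>e>0. cball x e \<subseteq> strip d \<and> uniform_limit (cball x e) (\<lambda>n \<zeta>. \<Sum>i<n. V i \<zeta>) U sequentially"
      using uniform_limit_on_subset[OF ul] by blast
  qed
  have Um: "cmod (U \<zeta>) \<le> (\<Sum>n. M * (1 / 2) ^ n)" if "\<zeta> \<in> strip d" for \<zeta>
    unfolding U_def by (rule norm_suminf_le[OF Vb[OF that] sm])
  obtain \<Phi> where \<Phi>: "\<And>\<zeta>. \<zeta> \<in> strip d \<Longrightarrow> vanishing_primitive d (\<lambda>\<omega>. \<kappa> \<zeta> \<omega> * U \<omega>) (\<Phi> \<zeta>)"
    using volterra_op_primitive[OF Uh Um] by blast
  have "\<exists>\<Phi>. (\<forall>\<zeta>\<in>strip d. vanishing_primitive d (\<lambda>\<omega>. \<kappa> \<zeta> \<omega> * V n \<omega>) (\<Phi> \<zeta>)) \<and> V (Suc n) = (\<lambda>\<zeta>. \<Phi> \<zeta> \<zeta>)" for n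
    using volterra_op_primitive[where U = "V n", OF _ Vb] step[of n] by (simp add: V_def) metis
  then obtain \<Theta> where \<Theta>: "\<And>n \<zeta>. \<zeta> \<in> strip d \<Longrightarrow> vanishing_primitive d (\<lambda>\<omega>. \<kappa> \<zeta> \<omega> * V n \<omega>) (\<Theta> n \<zeta>)"
    "\<And>n. V (Suc n) = (\<lambda>\<zeta>. \<Theta> n \<zeta> \<zeta>)" by metis
  have "U \<zeta> = G \<zeta> + \<Phi> \<zeta> \<zeta>" if \<zeta>: "\<zeta> \<in> strip d" for \<zeta>
  proof -
    have V0: "V 0 = G" by (simp add: V_def)
    have "(\<lambda>n. (\<Sum>i<Suc n. V i \<zeta>) - G \<zeta>) \<longlonglongrightarrow> U \<zeta> - G \<zeta>"
      by (intro tendsto_diff tendsto_const LIMSEQ_Suc tendsto_uniform_limitI[OF ul \<zeta>])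
    hence 1: "(\<lambda>n. \<Sum>i<n. \<Theta> i \<zeta> \<zeta>) \<longlonglongrightarrow> U \<zeta> - G \<zeta>"
      unfolding sum.lessThan_Suc_shift \<Theta>(2) V0 by simp
    have 2: "(\<lambda>n. \<Sum>i<n. \<Theta> i \<zeta> \<zeta>) \<longlonglongrightarrow> \<Phi> \<zeta> \<zeta>"
    proof (rule metric_LIMSEQ_I)
      fix e :: real assume e: "0 < e"
      define e' where "e' = e / (C * (L + 1))"
      have e': "0 < e'" using e C L_nonneg by (simp add: e'_def)
      have "\<forall>\<^sub>F n in sequentially. \<forall>\<omega>\<in>strip d. dist (\<Sum>i<n. V i \<omega>) (U \<omega>) < e'"
        by (rule uniform_limitD[OF ul e'])
      then obtain n0 where n0: "\<And>n \<omega>. n \<ge> n0 \<Longrightarrow> \<omega> \<in> strip d \<Longrightarrow> dist (\<Sum>i<n. V i \<omega>) (U \<omega>) < e'"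
        by (auto simp: eventually_sequentially)
      have "dist (\<Sum>i<n. \<Theta> i \<zeta> \<zeta>) (\<Phi> \<zeta> \<zeta>) < e" if n: "n \<ge> n0" for n
      proof -
        have "vanishing_primitive d (\<lambda>\<omega>. (\<Sum>i<n. \<kappa> \<zeta> \<omega> * V i \<omega>) - \<kappa> \<zeta> \<omega> * U \<omega>)
            (\<lambda>\<omega>. (\<Sum>i<n. \<Theta> i \<zeta> \<omega>) - \<Phi> \<zeta> \<omega>)"
          by (intro vanishing_primitive_diff vanishing_primitive_sum \<Theta> \<Phi> \<zeta>)
        hence vp: "vanishing_primitive d (\<lambda>\<omega>. \<kappa> \<zeta> \<omega> * ((\<Sum>i<n. V i \<omega>) - U \<omega>))
            (\<lambda>\<omega>. (\<Sum>i<n. \<Theta> i \<zeta> \<omega>) - \<Phi> \<zeta> \<omega>)"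
          by (simp add: right_diff_distrib sum_distrib_left)
        have "cmod ((\<Sum>i<n. \<Theta> i \<zeta> \<zeta>) - \<Phi> \<zeta> \<zeta>) \<le> C * e' * \<tau> (Re \<zeta>)"
          by (rule kernel_primitive_bound[OF vp _ \<zeta> \<zeta>])
             (use n0[OF n] in \<open>auto simp: dist_norm intro: less_imp_le\<close>)
        also have "\<dots> \<le> C * e' * L" using C e' \<tau>(3) by (intro mult_left_mono) auto
        also have "\<dots> < C * e' * (L + 1)" using C e' by (intro mult_strict_left_mono) auto
        also have "\<dots> = e" using C L_nonneg by (simp add: e'_def)
        finally show ?thesis by (simp add: dist_norm)
      qed
      thus "\<exists>n0. \<forall>n\<ge>n0. dist (\<Sum>i<n. \<Theta> i \<zeta> \<zeta>) (\<Phi> \<zeta> \<zeta>) < e" by blast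
    qed
    from LIMSEQ_unique[OF 1 2] show ?thesis by (simp add: algebra_simps)
  qed
  thus ?thesis using that Uh Um \<Phi> by blast
qed

end

context strip_kernel
begin

text \<open>
  Near the left end the integral is bounded by the clock \<open>\<tau>\<close>, which is exponentially small there.
\<close>

lemma solution_near_left_end:
  assumes sol: "\<And>\<zeta>. \<zeta> \<in> strip d \<Longrightarrow> cmod (U \<zeta>) \<le> m"
      "\<And>\<zeta>. \<zeta> \<in> strip d \<Longrightarrow> vanishing_primitive d (\<lambda>\<omega>. \<kappa> \<zeta> \<omega> * U \<omega>) (\<Phi> \<zeta>)"
      "\<And>\<zeta>. \<zeta> \<in> strip d \<Longrightarrow> U \<zeta> = G \<zeta> + \<Phi> \<zeta> \<zeta>"
    and \<zeta>: "\<zeta> \<in> strip d" "Re \<zeta> \<le> 0" and \<alpha>: "\<alpha> \<le> 1"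
    and G: "cmod (G \<zeta> - ga) \<le> H * exp (\<alpha> * Re \<zeta>)"
    and \<tau>e: "\<tau> (Re \<zeta>) \<le> E * exp (Re \<zeta>)"
  shows "cmod (U \<zeta> - ga) \<le> (H + C * m * E) * exp (\<alpha> * Re \<zeta>)"
proof -
  have m0: "0 \<le> m" using sol(1)[OF \<zeta>(1)] norm_ge_zero order_trans by blast
  have E0: "0 \<le> E" using \<tau>e \<tau>_nonneg[of "Re \<zeta>"] by (smt (verit) exp_gt_zero mult_neg_pos)
  have "cmod (\<Phi> \<zeta> \<zeta>) \<le> C * m * \<tau> (Re \<zeta>)"
    by (rule kernel_primitive_bound[OF sol(2)[OF \<zeta>(1)] sol(1) \<zeta>(1) \<zeta>(1)])
  also have "\<dots> \<le> C * m * (E * exp (\<alpha> * Re \<zeta>))"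
  proof (rule mult_left_mono)
    have "Re \<zeta> \<le> \<alpha> * Re \<zeta>" using \<zeta>(2) \<alpha> mult_right_mono_neg[of \<alpha> 1 "Re \<zeta>"] by simp
    hence "E * exp (Re \<zeta>) \<le> E * exp (\<alpha> * Re \<zeta>)" using E0 by (intro mult_left_mono) auto
    thus "\<tau> (Re \<zeta>) \<le> E * exp (\<alpha> * Re \<zeta>)" using \<tau>e by linarith
  qed (use C m0 in auto)
  finally have "cmod (\<Phi> \<zeta> \<zeta>) \<le> C * m * E * exp (\<alpha> * Re \<zeta>)" by (simp add: mult_ac)
  moreover have "U \<zeta> - ga = (G \<zeta> - ga) + \<Phi> \<zeta> \<zeta>" using sol(3)[OF \<zeta>(1)] by simp
  hence "cmod (U \<zeta> - ga) \<le> cmod (G \<zeta> - ga) + cmod (\<Phi> \<zeta> \<zeta>)" by (simp only: norm_triangle_ineq)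
  ultimately show ?thesis using G unfolding distrib_right by linarith
qed

text \<open>
  The comparison is with \<open>U R\<close> for real \<open>R\<close>, which will tend to infinity, and not with a boundary
  value of the kernel. The passage from
  \<open>\<Phi> \<zeta> \<zeta>\<close> to \<open>\<Phi> R R\<close> is made in three steps. First the parameter of the kernel is changed
  from \<open>\<zeta>\<close> to \<open>R\<close>; then the end point moves vertically to the real axis, and along the axis to \<open>R\<close>.
\<close>

lemma solution_near_right_end:
  assumes U: "\<And>\<zeta>. \<zeta> \<in> strip d \<Longrightarrow> cmod (U \<zeta>) \<le> m"
    and \<Phi>: "\<And>\<zeta>. \<zeta> \<in> strip d \<Longrightarrow> vanishing_primitive d (\<lambda>\<omega>. \<kappa> \<zeta> \<omega> * U \<omega>) (\<Phi> \<zeta>)"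
    and eq: "\<And>\<zeta>. \<zeta> \<in> strip d \<Longrightarrow> U \<zeta> = G \<zeta> + \<Phi> \<zeta> \<zeta>"
    and \<zeta>: "\<zeta> \<in> strip d" "0 \<le> Re \<zeta>" "Re \<zeta> \<le> R" and \<alpha>: "\<alpha> \<le> 1"
    and G: "cmod (G \<zeta> - G (of_real R)) \<le> H1 * exp (- \<alpha> * Re \<zeta>)"
    and \<kappa>: "\<And>\<omega>. \<omega> \<in> strip d \<Longrightarrow> cmod (\<kappa> \<zeta> \<omega> - \<kappa> (of_real R) \<omega>) \<le> H2 * exp (- \<alpha> * Re \<zeta>) * \<rho> (Re \<omega>)"
    and H2: "0 \<le> H2"
    and \<rho>e: "\<rho> (Re \<zeta>) \<le> E * exp (- Re \<zeta>)"
    and \<tau>e: "\<tau> R - \<tau> (Re \<zeta>) \<le> E * exp (- Re \<zeta>)"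
  shows "cmod (U \<zeta> - U (of_real R)) \<le> (H1 + H2 * m * L + C * m * E * d + C * m * E) * exp (- \<alpha> * Re \<zeta>)"
proof -
  define x y where "x = Re \<zeta>" and "y = Im \<zeta>"
  have z: "\<zeta> = Complex x y" and y: "\<bar>y\<bar> < d" using \<zeta> by (simp_all add: x_def y_def strip_def)
  have m0: "0 \<le> m" using U[OF \<zeta>(1)] norm_ge_zero order_trans by blast
  have Rs: "of_real R \<in> strip d" by (rule of_real_in_strip[OF d])
  let ?e = "exp (- \<alpha> * x)"
  have E0: "0 \<le> E" using \<rho>e \<rho>(1)[of "Re \<zeta>"] by (smt (verit) exp_gt_zero mult_neg_pos)
  have ee: "E * exp (- x) \<le> E * ?e"
  proof -
    have "\<alpha> * x \<le> x" using \<zeta>(2) \<alpha> mult_right_mono[of \<alpha> 1 x] by (simp add: x_def)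
    thus ?thesis using E0 by (intro mult_left_mono) auto
  qed
  let ?P = "\<Phi> (of_real R)"
  have "cmod (\<Phi> \<zeta> \<zeta> - ?P \<zeta>) \<le> H2 * ?e * m * \<tau> (Re \<zeta>)"
  proof (rule weighted_primitive_bound[OF vanishing_primitive_diff[OF \<Phi>[OF \<zeta>(1)] \<Phi>[OF Rs]] _ \<zeta>(1)])
    fix \<omega> assume \<omega>: "\<omega> \<in> strip d"
    have "\<kappa> \<zeta> \<omega> * U \<omega> - \<kappa> (of_real R) \<omega> * U \<omega> = (\<kappa> \<zeta> \<omega> - \<kappa> (of_real R) \<omega>) * U \<omega>"
      by (simp add: left_diff_distrib)
    also have "cmod \<dots> \<le> H2 * ?e * \<rho> (Re \<omega>) * m"
      unfolding norm_mult using \<kappa>[OF \<omega>] U[OF \<omega>] H2 \<rho>(1)[of "Re \<omega>"] by (intro mult_mono) (auto simp: x_def)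
    finally show "cmod (\<kappa> \<zeta> \<omega> * U \<omega> - \<kappa> (of_real R) \<omega> * U \<omega>) \<le> H2 * ?e * m * \<rho> (Re \<omega>)"
      by (simp add: mult_ac)
  qed
  also have "\<dots> \<le> H2 * ?e * m * L" using H2 m0 \<tau>(3) by (intro mult_left_mono) auto
  finally have 1: "cmod (\<Phi> \<zeta> \<zeta> - ?P \<zeta>) \<le> H2 * m * L * ?e" by (simp add: mult_ac)
  have dP: "\<And>\<omega>. \<omega> \<in> strip d \<Longrightarrow> (?P has_field_derivative \<kappa> (of_real R) \<omega> * U \<omega>) (at \<omega>)"
    using \<Phi>[OF Rs] by (auto simp: vanishing_primitive_def)
  have b: "cmod (\<kappa> (of_real R) \<omega> * U \<omega>) \<le> C * m * \<rho> (Re \<omega>)" if \<omega>: "\<omega> \<in> strip d" for \<omega>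
  proof -
    have "cmod (\<kappa> (of_real R) \<omega> * U \<omega>) \<le> C * \<rho> (Re \<omega>) * m"
      unfolding norm_mult by (intro mult_mono \<kappa>_bound Rs \<omega> U) (use C \<rho> in auto)
    thus ?thesis by (simp add: mult_ac)
  qed
  have "cmod (?P (Complex x y) - ?P (of_real x)) \<le> C * m * \<rho> x * d"
    by (rule primitive_vertical_increment[OF dP b y])
  also have "\<dots> \<le> C * m * (E * ?e) * d"
    using \<rho>e ee C m0 d unfolding x_def[symmetric] by (intro mult_right_mono mult_left_mono) auto
  finally have 2: "cmod (?P \<zeta> - ?P (of_real x)) \<le> C * m * E * d * ?e" by (simp add: z mult_ac)
  have "cmod (?P (Complex R 0) - ?P (Complex x 0)) \<le> C * m * \<tau> R - C * m * \<tau> x"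
    by (rule primitive_horizontal_increment[OF dP DERIV_cmult[OF \<tau>(1)] b]) (use d \<zeta> in \<open>auto simp: x_def\<close>)
  also have "\<dots> = C * m * (\<tau> R - \<tau> x)" by (simp add: algebra_simps)
  also have "\<dots> \<le> C * m * (E * ?e)"
    using \<tau>e ee C m0 unfolding x_def[symmetric] by (intro mult_left_mono) auto
  finally have 3: "cmod (?P (of_real x) - ?P (of_real R)) \<le> C * m * E * ?e"
    by (simp add: complex_of_real_def norm_minus_commute mult_ac)
  have "U \<zeta> - U (of_real R) = (G \<zeta> - G (of_real R)) + (\<Phi> \<zeta> \<zeta> - ?P \<zeta>) + (?P \<zeta> - ?P (of_real x))
      + (?P (of_real x) - ?P (of_real R))"
    by (simp add: eq[OF \<zeta>(1)] eq[OF Rs])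
  also have "cmod \<dots> \<le> H1 * ?e + H2 * m * L * ?e + C * m * E * d * ?e + C * m * E * ?e"
    by (intro order_trans[OF norm_triangle_ineq] add_mono 1 2 3 G[folded x_def])
  finally show ?thesis by (simp add: x_def distrib_right)
qed

end

text \<open>
  Each use of the equation halves the bound in the norm with weight \<open>exp (- 2 * M * (t - a))\<close>.
\<close>

lemma volterra_homogeneous_zero:
  fixes e :: "real \<Rightarrow> complex" and kk :: "real \<Rightarrow> real \<Rightarrow> complex"
  assumes M: "0 < M" and B: "\<And>t. a < t \<Longrightarrow> t < b \<Longrightarrow> cmod (e t) \<le> B"
    and he: "\<And>t. a < t \<Longrightarrow> t < b \<Longrightarrow> ((\<lambda>s. kk t s * e s) has_integral e t) {a..t}"
    and kb: "\<And>t s. a < s \<Longrightarrow> s < b \<Longrightarrow> a < t \<Longrightarrow> t < b \<Longrightarrow> cmod (kk t s) \<le> M"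
    and ea: "e a = 0" and t: "a < t" "t < b"
  shows "e t = 0"
proof -
  have B0: "0 \<le> B" using B[OF t] norm_ge_zero order_trans by blast
  have step: "a < t \<Longrightarrow> t < b \<Longrightarrow> cmod (e t) \<le> B / 2 ^ n * exp (2 * M * (t - a))" for n t
  proof (induction n arbitrary: t)
    case 0
    have "B * 1 \<le> B * exp (2 * M * (t - a))" using B0 M 0 by (intro mult_left_mono) auto
    thus ?case using B[OF 0] by simp
  next
    case (Suc n)
    let ?c = "B / 2 ^ n"
    have c0: "0 \<le> ?c" using B0 by simp
    have "((\<lambda>s. M * ?c * exp (2 * M * (s - a))) has_integral
        (?c / 2 * exp (2 * M * (t - a)) - ?c / 2 * exp (2 * M * (a - a)))) {a..t}"
    proof (rule fundamental_theorem_of_calculus)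
      fix s :: real
      have "((\<lambda>s. ?c / 2 * exp (2 * M * (s - a))) has_real_derivative M * ?c * exp (2 * M * (s - a))) (at s)"
        by (auto intro!: derivative_eq_intros)
      thus "((\<lambda>s. ?c / 2 * exp (2 * M * (s - a))) has_vector_derivative M * ?c * exp (2 * M * (s - a))) (at s within {a..t})"
        by (simp add: has_real_derivative_iff_has_vector_derivative has_vector_derivative_at_within)
    qed (use Suc.prems in simp)
    hence hi: "((\<lambda>s. M * ?c * exp (2 * M * (s - a))) has_integral (?c / 2 * exp (2 * M * (t - a)) - ?c / 2)) {a..t}"
      by simp
    have "cmod (integral {a..t} (\<lambda>s. kk t s * e s)) \<le> integral {a..t} (\<lambda>s. M * ?c * exp (2 * M * (s - a)))"
    proof (rule integral_norm_bound_integral)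
      fix s assume s: "s \<in> {a..t}"
      show "cmod (kk t s * e s) \<le> M * ?c * exp (2 * M * (s - a))"
      proof (cases "s = a")
        case True
        have "0 \<le> M * ?c * exp (2 * M * (s - a))"
          by (intro mult_nonneg_nonneg c0) (use M in auto)
        thus ?thesis using True ea by simp
      next
        case False
        hence s': "a < s" "s < b" using s Suc.prems by auto
        have "cmod (kk t s * e s) \<le> M * (?c * exp (2 * M * (s - a)))"
          unfolding norm_mult using M c0 by (intro mult_mono kb s' Suc) auto
        thus ?thesis by (simp add: mult_ac)
      qed
    qed (use he[OF Suc.prems] hi in blast)+
    hence "cmod (e t) \<le> ?c / 2 * exp (2 * M * (t - a)) - ?c / 2"
      unfolding integral_unique[OF he[OF Suc.prems]] integral_unique[OF hi] .
    also have "\<dots> \<le> ?c / 2 * exp (2 * M * (t - a))" using c0 by simp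
    finally show ?case by (simp add: mult_ac)
  qed
  have "(\<lambda>n. B * (1 / 2) ^ n * exp (2 * M * (t - a))) \<longlonglongrightarrow> B * 0 * exp (2 * M * (t - a))"
    by (intro tendsto_intros LIMSEQ_realpow_zero) auto
  hence "cmod (e t) \<le> B * 0 * exp (2 * M * (t - a))"
    by (rule tendsto_lowerbound) (use step[OF t] in \<open>auto simp: power_one_over divide_simps\<close>)
  thus ?thesis by simp
qed

section \<open>The SE transformation\<close>

lemma tanh_half_eq:
  fixes x :: "'a::{banach,real_normed_field}"
  shows "tanh (x / 2) = (exp x - 1) / (exp x + 1)"
proof -
  define E where "E = exp (x / 2)"
  have E: "E \<noteq> 0" by (simp add: E_def)
  have EE: "exp x = E * E" unfolding E_def by (simp flip: exp_add)
  have "tanh (x / 2) = (E - inverse E) / (E + inverse E)"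
  proof -
    have "(p / 2) / (q / 2) = p / q" for p q :: 'a by simp
    thus ?thesis unfolding tanh_def sinh_field_def cosh_field_def exp_minus E_def by blast
  qed
  also have "\<dots> = (E * (E - inverse E)) / (E * (E + inverse E))"
    using E by (rule mult_divide_mult_cancel_left[symmetric])
  also have "\<dots> = (E * E - 1) / (E * E + 1)" using E by (simp add: algebra_simps)
  finally show ?thesis by (simp add: EE)
qed

lemma SE_psi_sub_left:
  fixes x :: "'a::{banach,real_normed_field}"
  assumes "1 + exp x \<noteq> 0"
  shows "SE_psi a b x - of_real a = of_real (b - a) * (exp x / (1 + exp x))"
proof -
  have 1: "of_real ((b + a) / 2) - of_real a = (of_real ((b - a) / 2) :: 'a)"
    unfolding of_real_diff[symmetric] by (rule arg_cong[of _ _ of_real]) (simp add: field_simps)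
  have "exp x + 1 \<noteq> 0" using assms by (simp add: add.commute)
  hence 2: "(exp x - 1) / (exp x + 1) + 1 = 2 * (exp x / (1 + exp x))"
  proof -
    assume e: "exp x + 1 \<noteq> 0"
    have "(exp x - 1) / (exp x + 1) + (exp x + 1) / (exp x + 1) = ((exp x - 1) + (exp x + 1)) / (exp x + 1)"
      by (rule add_divide_distrib[symmetric])
    thus ?thesis using e by (simp add: add.commute[of 1 "exp x"])
  qed
  have "SE_psi a b x - of_real a = of_real ((b - a) / 2) * ((exp x - 1) / (exp x + 1)) + of_real ((b - a) / 2)"
    unfolding SE_psi_def tanh_half_eq using 1 by (simp only: add_diff_eq[symmetric])
  also have "\<dots> = of_real ((b - a) / 2) * ((exp x - 1) / (exp x + 1) + 1)"
    by (simp only: distrib_left mult_1_right)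
  also have "\<dots> = of_real (b - a) * (exp x / (1 + exp x))"
    unfolding 2 by (simp only: of_real_divide) simp
  finally show ?thesis .
qed

lemma SE_psi_sub_right:
  fixes x :: "'a::{banach,real_normed_field}"
  assumes "1 + exp x \<noteq> 0"
  shows "of_real b - SE_psi a b x = of_real (b - a) * (1 / (1 + exp x))"
proof -
  have "of_real b - SE_psi a b x = of_real (b - a) - (SE_psi a b x - of_real a)" by simp
  also have "\<dots> = of_real (b - a) * (1 - exp x / (1 + exp x))"
    unfolding SE_psi_sub_left[OF assms] by (simp add: algebra_simps)
  also have "1 - exp x / (1 + exp x) = 1 / (1 + exp x)" using assms by (simp add: field_simps)
  finally show ?thesis .
qed

definition dpsi :: "real \<Rightarrow> real \<Rightarrow> 'a::{banach,real_normed_field} \<Rightarrow> 'a" where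
  "dpsi a b x = of_real (b - a) * (exp x / (1 + exp x)\<^sup>2)"

lemma SE_psi_has_field_derivative:
  fixes x :: "'a::{banach,real_normed_field}"
  assumes "1 + exp x \<noteq> 0"
  shows "(SE_psi a b has_field_derivative dpsi a b x) (at x)"
proof -
  have "exp (x / 2) * (exp (x / 2) + exp (- (x / 2))) = exp x + 1"
    by (simp add: distrib_left flip: exp_add)
  hence c: "cosh (x / 2) \<noteq> 0" using assms by (auto simp: cosh_field_def add.commute)
  have "(SE_psi a b has_field_derivative of_real ((b - a) / 2) * ((1 - tanh (x / 2) ^ 2) * (1 / 2)) + 0) (at x)"
    unfolding SE_psi_def[abs_def]
    by (intro DERIV_add DERIV_cmult DERIV_const has_field_derivative_tanh DERIV_cdivide DERIV_ident c)
  moreover have "1 - tanh (x / 2) ^ 2 = 4 * (exp x / (1 + exp x)\<^sup>2)"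
  proof -
    have "1 - ((e - 1) / (e + 1))\<^sup>2 = 4 * (e / (1 + e)\<^sup>2)" if "1 + e \<noteq> 0" for e :: 'a
    proof -
      define q where "q = 1 + e"
      have q: "q \<noteq> 0" using that by (simp add: q_def)
      have main: "1 - ((q - 2) / q)\<^sup>2 = 4 * ((q - 1) / q\<^sup>2)"
        using q by (simp add: power_divide field_simps power2_eq_square)
      have e: "e - 1 = q - 2" "e + 1 = q" "1 + e = q" "e = q - 1" by (simp_all add: q_def)
      show ?thesis unfolding e(1-3) using main e(4) by simp
    qed
    thus ?thesis unfolding tanh_half_eq using assms by blast
  qed
  ultimately show ?thesis by (simp add: dpsi_def of_real_divide)
qed

lemma one_plus_exp_real_nonzero [simp]: "1 + exp (x::real) \<noteq> 0"
  using exp_gt_zero[of x] by linarith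

lemma SE_psi_of_real: "SE_psi a b (of_real x :: complex) = of_real (SE_psi a b x)"
proof -
  have "tanh (of_real x / 2 :: complex) = of_real (tanh (x / 2))"
    unfolding tanh_half_eq by (simp add: exp_of_real)
  thus ?thesis by (simp add: SE_psi_def)
qed

lemma dpsi_of_real: "dpsi a b (of_real x :: complex) = of_real (dpsi a b x)"
  by (simp add: dpsi_def exp_of_real)

text \<open>
  Hence on the strip all quantities built from \<open>exp \<zeta> / (1 + exp \<zeta>)\<close> are comparable to their values
  at \<open>Re \<zeta>\<close>. Equality would hold at \<open>\<zeta> = i d\<close>.
\<close>

lemma cmod_one_plus_exp_ge:
  assumes "\<zeta> \<in> strip d" "d < pi"
  shows "cos (d / 2) * (1 + exp (Re \<zeta>)) \<le> cmod (1 + exp \<zeta>)"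
proof (rule power2_le_imp_le)
  define e c where "e = exp (Re \<zeta>)" and "c = cos (Im \<zeta>)"
  have im: "\<bar>Im \<zeta>\<bar> < d" using assms by (simp add: strip_def)
  have "cos d \<le> cos \<bar>Im \<zeta>\<bar>" using im assms by (intro cos_monotone_0_pi_le) auto
  hence cd: "cos d \<le> c" by (simp add: c_def)
  have "cos d = 2 * (cos (d / 2))\<^sup>2 - 1" using cos_double_cos[of "d / 2"] by simp
  hence k: "(cos (d / 2))\<^sup>2 \<le> (1 + c) / 2" using cd by simp
  have "(cmod (1 + exp \<zeta>))\<^sup>2 = (1 + e * cos (Im \<zeta>))\<^sup>2 + (e * sin (Im \<zeta>))\<^sup>2"
    by (simp add: cmod_power2 Re_exp Im_exp e_def)
  also have "\<dots> = 1 + 2 * e * c + e\<^sup>2"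
  proof -
    have "(1 + e * c)\<^sup>2 + (e * sin (Im \<zeta>))\<^sup>2 = 1 + 2 * e * c + e\<^sup>2 * ((sin (Im \<zeta>))\<^sup>2 + c\<^sup>2)"
      by (simp add: power2_eq_square algebra_simps)
    thus ?thesis by (simp add: c_def)
  qed
  finally have n: "(cmod (1 + exp \<zeta>))\<^sup>2 = 1 + 2 * e * c + e\<^sup>2" .
  have "(cos (d / 2) * (1 + e))\<^sup>2 \<le> (1 + c) / 2 * (1 + e)\<^sup>2"
    unfolding power_mult_distrib by (intro mult_right_mono k) auto
  also have "\<dots> \<le> 1 + 2 * e * c + e\<^sup>2"
  proof -
    have "0 \<le> (1 - c) * (1 - e)\<^sup>2" by (simp add: c_def)
    hence "(1 + c) * (1 + e)\<^sup>2 \<le> 2 * (1 + 2 * e * c + e\<^sup>2)" by (simp add: power2_eq_square algebra_simps)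
    thus ?thesis by simp
  qed
  finally show "(cos (d / 2) * (1 + exp (Re \<zeta>)))\<^sup>2 \<le> (cmod (1 + exp \<zeta>))\<^sup>2"
    unfolding n e_def .
qed simp

lemma cos_half_pos:
  assumes "0 < d" "d < pi"
  shows "0 < cos (d / 2)"
  using assms by (intro cos_gt_zero_pi) auto

context
  fixes a b d :: real and \<zeta> :: complex
  assumes ab: "a < b" and d: "0 < d" "d < pi" and \<zeta>: "\<zeta> \<in> strip d"
begin

lemma one_plus_exp_strip_nonzero: "1 + exp \<zeta> \<noteq> 0"
proof
  assume "1 + exp \<zeta> = 0"
  hence "cos (d / 2) * (1 + exp (Re \<zeta>)) \<le> 0" using cmod_one_plus_exp_ge[OF \<zeta> d(2)] by simp
  moreover have "0 < cos (d / 2) * (1 + exp (Re \<zeta>))"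
    using cos_half_pos[OF d] by (intro mult_pos_pos add_pos_pos) auto
  ultimately show False by linarith
qed

lemma cmod_SE_psi_sub_left: "cmod (SE_psi a b \<zeta> - of_real a) \<le> (SE_psi a b (Re \<zeta>) - a) / cos (d / 2)"
proof -
  have p: "0 < cos (d / 2) * (1 + exp (Re \<zeta>))"
    using cos_half_pos[OF d] by (intro mult_pos_pos add_pos_pos) auto
  hence q: "0 < cmod (1 + exp \<zeta>)" using cmod_one_plus_exp_ge[OF \<zeta> d(2)] by linarith
  have "cmod (SE_psi a b \<zeta> - of_real a) = (b - a) * (exp (Re \<zeta>) / cmod (1 + exp \<zeta>))"
    unfolding SE_psi_sub_left[OF one_plus_exp_strip_nonzero] using ab by (simp add: norm_mult norm_divide del: of_real_diff)
  also have "\<dots> \<le> (b - a) * (exp (Re \<zeta>) / (cos (d / 2) * (1 + exp (Re \<zeta>))))"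
    using ab by (intro mult_left_mono divide_left_mono mult_pos_pos[OF q p] cmod_one_plus_exp_ge[OF \<zeta> d(2)]) auto
  also have "\<dots> = (SE_psi a b (Re \<zeta>) - a) / cos (d / 2)"
    using SE_psi_sub_left[of "Re \<zeta>" a b] by simp
  finally show ?thesis .
qed

lemma cmod_SE_psi_sub_right: "cmod (of_real b - SE_psi a b \<zeta>) \<le> (b - SE_psi a b (Re \<zeta>)) / cos (d / 2)"
proof -
  have p: "0 < cos (d / 2) * (1 + exp (Re \<zeta>))"
    using cos_half_pos[OF d] by (intro mult_pos_pos add_pos_pos) auto
  hence q: "0 < cmod (1 + exp \<zeta>)" using cmod_one_plus_exp_ge[OF \<zeta> d(2)] by linarith
  have "cmod (of_real b - SE_psi a b \<zeta>) = (b - a) * (1 / cmod (1 + exp \<zeta>))"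
    unfolding SE_psi_sub_right[OF one_plus_exp_strip_nonzero] using ab by (simp add: norm_mult norm_divide del: of_real_diff)
  also have "\<dots> \<le> (b - a) * (1 / (cos (d / 2) * (1 + exp (Re \<zeta>))))"
    using ab by (intro mult_left_mono divide_left_mono mult_pos_pos[OF q p] cmod_one_plus_exp_ge[OF \<zeta> d(2)]) auto
  also have "\<dots> = (b - SE_psi a b (Re \<zeta>)) / cos (d / 2)"
    using SE_psi_sub_right[of "Re \<zeta>" b a] by simp
  finally show ?thesis .
qed

lemma cmod_dpsi_le: "cmod (dpsi a b \<zeta>) \<le> dpsi a b (Re \<zeta>) / (cos (d / 2))\<^sup>2"
proof -
  have p: "0 < cos (d / 2) * (1 + exp (Re \<zeta>))"
    using cos_half_pos[OF d] by (intro mult_pos_pos add_pos_pos) auto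
  hence q: "0 < cmod (1 + exp \<zeta>)" using cmod_one_plus_exp_ge[OF \<zeta> d(2)] by linarith
  have "cmod (dpsi a b \<zeta>) = (b - a) * (exp (Re \<zeta>) / (cmod (1 + exp \<zeta>))\<^sup>2)"
    unfolding dpsi_def using ab by (simp add: norm_mult norm_divide norm_power del: of_real_diff)
  also have "\<dots> \<le> (b - a) * (exp (Re \<zeta>) / (cos (d / 2) * (1 + exp (Re \<zeta>)))\<^sup>2)"
    using ab p
    by (intro mult_left_mono divide_left_mono mult_pos_pos[OF zero_less_power[OF q] zero_less_power[OF p]]
        power_mono cmod_one_plus_exp_ge[OF \<zeta> d(2)]) auto
  also have "\<dots> = dpsi a b (Re \<zeta>) / (cos (d / 2))\<^sup>2"
    by (simp add: dpsi_def power_mult_distrib)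
  finally show ?thesis .
qed

end

lemma dpsi_holomorphic: "0 < d \<Longrightarrow> d < pi \<Longrightarrow> dpsi a b holomorphic_on strip d"
  unfolding dpsi_def[abs_def] using one_plus_exp_strip_nonzero
  by (intro holomorphic_intros) auto

lemma SE_psi_holomorphic: "0 < d \<Longrightarrow> d < pi \<Longrightarrow> SE_psi a b holomorphic_on strip d"
  unfolding holomorphic_on_open[OF strip_open]
  using SE_psi_has_field_derivative one_plus_exp_strip_nonzero by blast

lemma S_tendsto_0:
  assumes h: "0 < h"
  shows "(S j h \<longlongrightarrow> 0) at_bot" "(S j h \<longlongrightarrow> 0) at_top"
proof -
  have b: "norm (S j h x) \<le> h / pi * inverse \<bar>x - of_int j * h\<bar>" if "x \<noteq> of_int j * h" for x
  proof -
    have "\<bar>S j h x\<bar> = \<bar>sin (pi * (x - of_int j * h) / h)\<bar> * (h / pi * inverse \<bar>x - of_int j * h\<bar>)"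
      using that h by (simp add: S_def abs_mult divide_simps)
    also have "\<dots> \<le> 1 * (h / pi * inverse \<bar>x - of_int j * h\<bar>)"
      using h by (intro mult_right_mono) auto
    finally show ?thesis by simp
  qed
  have t: "filterlim (\<lambda>x::real. \<bar>x - c\<bar>) at_top at_top" for c
    unfolding filterlim_at_top
    by (intro allI, rule_tac P = "\<lambda>x. c + \<bar>Z\<bar> \<le> x" in eventually_mono) (auto simp: eventually_ge_at_top)
  have "filterlim (\<lambda>x::real. \<bar>x - c\<bar>) at_top at_bot" for c
    unfolding filterlim_at_top
    by (intro allI, rule_tac P = "\<lambda>x. x \<le> c - \<bar>Z\<bar>" in eventually_mono) (auto simp: eventually_le_at_bot)
  note lims = this t
  show "(S j h \<longlongrightarrow> 0) at_bot"
  proof (rule Lim_null_comparison)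
    show "\<forall>\<^sub>F x in at_bot. norm (S j h x) \<le> h / pi * inverse \<bar>x - of_int j * h\<bar>"
      by (rule eventually_mono[OF eventually_le_at_bot[of "of_int j * h - 1"]]) (rule b, force)
    show "((\<lambda>x. h / pi * inverse \<bar>x - of_int j * h\<bar>) \<longlongrightarrow> 0) at_bot"
      by (intro tendsto_mult_right_zero tendsto_inverse_0_at_top lims)
  qed
  show "(S j h \<longlongrightarrow> 0) at_top"
  proof (rule Lim_null_comparison)
    show "\<forall>\<^sub>F x in at_top. norm (S j h x) \<le> h / pi * inverse \<bar>x - of_int j * h\<bar>"
      by (rule eventually_mono[OF eventually_gt_at_top[of "of_int j * h"]]) (rule b, force)
    show "((\<lambda>x. h / pi * inverse \<bar>x - of_int j * h\<bar>) \<longlongrightarrow> 0) at_top"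
      by (intro tendsto_mult_right_zero tendsto_inverse_0_at_top lims)
  qed
qed

context
  fixes a b :: real
  assumes ab: "a < b"
begin

lemma SE_psi_real_bounds: "a < SE_psi a b x" "SE_psi a b x < b"
proof -
  have "0 < SE_psi a b x - of_real a"
    unfolding SE_psi_sub_left[OF one_plus_exp_real_nonzero] using ab
    by (simp add: add_pos_pos)
  thus "a < SE_psi a b x" by simp
  have "0 < of_real b - SE_psi a b x"
    unfolding SE_psi_sub_right[OF one_plus_exp_real_nonzero] using ab
    by (simp add: add_pos_pos)
  thus "SE_psi a b x < b" by simp
qed

lemma SE_psi_sub_left_le_exp: "SE_psi a b x - a \<le> (b - a) * exp x"
proof -
  have "SE_psi a b x - of_real a \<le> (b - a) * (exp x / 1)"
    unfolding SE_psi_sub_left[OF one_plus_exp_real_nonzero]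
    using ab by (simp only: of_real_eq_id id_apply, intro mult_left_mono divide_left_mono) (auto simp: add_pos_pos)
  thus ?thesis by simp
qed

lemma SE_psi_sub_right_le_exp: "b - SE_psi a b x \<le> (b - a) * exp (- x)"
proof -
  have "of_real b - SE_psi a b x \<le> (b - a) * (1 / exp x)"
    unfolding SE_psi_sub_right[OF one_plus_exp_real_nonzero]
    using ab by (simp only: of_real_eq_id id_apply, intro mult_left_mono divide_left_mono) (auto simp: add_pos_pos)
  thus ?thesis by (simp add: exp_minus divide_inverse)
qed

lemma dpsi_real_nonneg: "0 \<le> dpsi a b (x::real)"
  using ab by (simp add: dpsi_def)

lemma dpsi_real_le_exp: "dpsi a b (x::real) \<le> (b - a) * exp (- \<bar>x\<bar>)"
proof -
  have e: "exp x / (1 + exp x)\<^sup>2 \<le> exp (- \<bar>x\<bar>)"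
  proof -
    have p: "0 < (1 + exp x)\<^sup>2" by (simp add: add_pos_pos)
    show ?thesis
    proof (cases "0 \<le> x")
      case True
      have "exp x * exp x \<le> (1 + exp x)\<^sup>2" by (simp add: power2_eq_square mult_mono)
      hence "exp x \<le> exp (- x) * (1 + exp x)\<^sup>2" by (simp add: exp_minus field_simps)
      thus ?thesis using True p by (simp add: pos_divide_le_eq)
    next
      case False
      have "1 \<le> (1 + exp x)\<^sup>2" by (simp add: one_le_power)
      hence "exp x * 1 \<le> exp x * (1 + exp x)\<^sup>2" by (intro mult_left_mono) auto
      thus ?thesis using False p by (simp add: pos_divide_le_eq)
    qed
  qed
  have "dpsi a b x = (b - a) * (exp x / (1 + exp x)\<^sup>2)" by (simp add: dpsi_def)
  also have "\<dots> \<le> (b - a) * exp (- \<bar>x\<bar>)" using ab e by (intro mult_left_mono) auto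
  finally show ?thesis .
qed

definition phi_log :: "real \<Rightarrow> real" where "phi_log t = ln ((t - a) / (b - t))"

lemma SE_psi_phi_log:
  assumes "a < t" "t < b"
  shows "SE_psi a b (phi_log t) = t"
proof -
  have e: "exp (phi_log t) = (t - a) / (b - t)" using assms by (simp add: phi_log_def)
  have s: "1 + (t - a) / (b - t) = (b - a) / (b - t)" using assms by (simp add: field_simps)
  have "SE_psi a b (phi_log t) - of_real a = (b - a) * ((t - a) / (b - t) / ((b - a) / (b - t)))"
    unfolding SE_psi_sub_left[OF one_plus_exp_real_nonzero] e s by simp
  also have "\<dots> = t - a" using assms by simp
  finally show ?thesis by simp
qed

lemma SE_psi_strict_mono: "strict_mono (SE_psi a b :: real \<Rightarrow> real)"
proof (rule strict_monoI)
  fix x y :: real assume "x < y"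
  thus "SE_psi a b x < SE_psi a b y" using ab by (simp add: SE_psi_def)
qed

lemma SE_phi_psi: "SE_phi a b (SE_psi a b x) = x"
  unfolding SE_phi_def by (rule inv_f_f) (rule strict_mono_imp_inj_on[OF SE_psi_strict_mono])

lemma SE_phi_eq_log: "a < t \<Longrightarrow> t < b \<Longrightarrow> SE_phi a b t = phi_log t"
  using SE_phi_psi[of "phi_log t"] by (simp add: SE_psi_phi_log)

lemma SE_psi_phi: "a < t \<Longrightarrow> t < b \<Longrightarrow> SE_psi a b (SE_phi a b t) = t"
  by (simp add: SE_phi_eq_log SE_psi_phi_log)

lemma SE_phi_has_derivative:
  assumes t: "a < t" "t < b"
  shows "(SE_phi a b has_real_derivative inverse (dpsi a b (SE_phi a b t))) (at t)"
proof (rule DERIV_inverse_function[where f = "SE_psi a b" and a = a and b = b])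
  show "(SE_psi a b has_real_derivative dpsi a b (SE_phi a b t)) (at (SE_phi a b t))"
    by (rule SE_psi_has_field_derivative) simp
  show "dpsi a b (SE_phi a b t) \<noteq> 0" using ab by (simp add: dpsi_def)
  have "isCont phi_log t" unfolding phi_log_def using t by (intro continuous_intros) auto
  moreover have "\<forall>\<^sub>F s in nhds t. phi_log s = SE_phi a b s"
    using t by (intro eventually_mono[OF eventually_nhds_in_open[of "{a<..<b}"]]) (auto simp: SE_phi_eq_log)
  ultimately show "isCont (SE_phi a b) t" using isCont_cong by blast
qed (use t SE_psi_phi in auto)

lemma SE_phi_at_left_end: "filterlim (SE_phi a b) at_bot (at_right a)"
  unfolding filterlim_at_bot
proof
  fix Z
  show "\<forall>\<^sub>F t in at_right a. SE_phi a b t \<le> Z"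
  proof (rule eventually_at_rightI[OF _ SE_psi_real_bounds(1)])
    fix t assume t: "t \<in> {a<..<SE_psi a b Z}"
    hence tb: "a < t" "t < b" using SE_psi_real_bounds(2)[of Z] by auto
    have "SE_psi a b (SE_phi a b t) < SE_psi a b Z" using t by (simp add: SE_psi_phi[OF tb])
    thus "SE_phi a b t \<le> Z" using strict_mono_less[OF SE_psi_strict_mono] by fastforce
  qed
qed

lemma SE_phi_at_right_end: "filterlim (SE_phi a b) at_top (at_left b)"
  unfolding filterlim_at_top
proof
  fix Z
  show "\<forall>\<^sub>F t in at_left b. Z \<le> SE_phi a b t"
  proof (rule eventually_at_leftI[OF _ SE_psi_real_bounds(2)])
    fix t assume t: "t \<in> {SE_psi a b Z<..<b}"
    hence tb: "a < t" "t < b" using SE_psi_real_bounds(1)[of Z] by auto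
    have "SE_psi a b Z < SE_psi a b (SE_phi a b t)" using t by (simp add: SE_psi_phi[OF tb])
    thus "Z \<le> SE_phi a b t" using strict_mono_less[OF SE_psi_strict_mono] by fastforce
  qed
qed

lemma at_within_left_end: "at a within {a<..<b} = at_right a"
  by (rule at_within_nhd[of a "{..<b}"]) (use ab in auto)

lemma at_within_right_end: "at b within {a<..<b} = at_left b"
  by (rule at_within_nhd[of b "{a<..}"]) (use ab in auto)

lemma S_phi_left_end:
  assumes "0 < h"
  shows "S_phi a b j h a = 0"
proof -
  have "((\<lambda>s. S j h (SE_phi a b s)) \<longlongrightarrow> 0) (at a within {a<..<b})"
    unfolding at_within_left_end
    by (rule filterlim_compose[OF S_tendsto_0(1)[OF assms] SE_phi_at_left_end])
  moreover have "\<not> trivial_limit (at a within {a<..<b})"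
    unfolding at_within_left_end by simp
  ultimately show ?thesis unfolding S_phi_def by (simp add: tendsto_Lim)
qed

lemma S_phi_right_end:
  assumes "0 < h"
  shows "S_phi a b j h b = 0"
proof -
  have "((\<lambda>s. S j h (SE_phi a b s)) \<longlongrightarrow> 0) (at b within {a<..<b})"
    unfolding at_within_right_end
    by (rule filterlim_compose[OF S_tendsto_0(2)[OF assms] SE_phi_at_right_end])
  moreover have "\<not> trivial_limit (at b within {a<..<b})"
    unfolding at_within_right_end by simp
  ultimately show ?thesis unfolding S_phi_def by (simp add: tendsto_Lim)
qed

lemma dpsi_eq_deriv: "deriv (SE_psi a b) x = dpsi a b (x::real)"
  by (rule DERIV_imp_deriv[OF SE_psi_has_field_derivative]) simp

lemma SE_psi_strip_weight:
  assumes "0 < d"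
  shows "strip_weight d (b - a) (b - a) (\<lambda>x. SE_psi a b x - a) (dpsi a b)"
proof
  show "((\<lambda>x. SE_psi a b x - a) has_real_derivative dpsi a b x) (at x)" for x
    using DERIV_diff[OF SE_psi_has_field_derivative[of x a b] DERIV_const[of a]] by simp
  have e: "((\<lambda>x. (b - a) * exp x) \<longlongrightarrow> 0) at_bot"
    by (intro tendsto_mult_right_zero exp_at_bot)
  show "((\<lambda>x. SE_psi a b x - a) \<longlongrightarrow> 0) at_bot"
    by (rule Lim_null_comparison[OF _ e])
       (use SE_psi_sub_left_le_exp SE_psi_real_bounds(1) in \<open>auto intro!: always_eventually simp: abs_of_pos\<close>)
  show "(dpsi a b \<longlongrightarrow> (0::real)) at_bot"
  proof (rule Lim_null_comparison[OF _ e])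
    show "\<forall>\<^sub>F x in at_bot. norm (dpsi a b x :: real) \<le> (b - a) * exp x"
      using dpsi_real_le_exp dpsi_real_nonneg
      by (intro eventually_mono[OF eventually_le_at_bot[of 0]]) (metis abs_of_nonneg abs_of_nonpos minus_minus real_norm_def)
  qed
  show "dpsi a b x \<le> b - a" for x :: real
  proof -
    have "(b - a) * exp (- \<bar>x\<bar>) \<le> (b - a) * 1" using ab by (intro mult_left_mono) auto
    thus ?thesis using dpsi_real_le_exp[of x] by simp
  qed
qed (use assms dpsi_real_nonneg SE_psi_real_bounds in \<open>auto simp: less_imp_le\<close>)

end

section \<open>Stability of the collocation equations\<close>

text \<open>
  The products of the factors \<open>1 + c q\<close> solve the recursion with equality, and they are at most the
  exponential of the sum.
\<close>

lemma discrete_Gronwall: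
  fixes v c :: "nat \<Rightarrow> real"
  assumes c: "\<And>q. 0 \<le> c q" and Y: "0 \<le> Y"
    and v: "\<And>p. p \<le> n \<Longrightarrow> v p \<le> Y + (\<Sum>q<p. c q * v q)"
  shows "p \<le> n \<Longrightarrow> v p \<le> Y * exp (\<Sum>q<p. c q)"
proof -
  define Q where "Q = (\<lambda>p. \<Prod>q<p. 1 + c q)"
  have tel: "(\<Sum>q<p. c q * Q q) = Q p - 1" for p
    by (induction p) (simp_all add: Q_def algebra_simps)
  have main: "p \<le> n \<Longrightarrow> v p \<le> Y * Q p" for p
  proof (induction p rule: less_induct)
    case (less p)
    have "v p \<le> Y + (\<Sum>q<p. c q * v q)" by (rule v[OF less.prems])
    also have "\<dots> \<le> Y + (\<Sum>q<p. c q * (Y * Q q))"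
      using less c by (intro add_left_mono sum_mono mult_left_mono) auto
    also have "(\<Sum>q<p. c q * (Y * Q q)) = Y * (\<Sum>q<p. c q * Q q)"
      by (simp add: sum_distrib_left mult_ac)
    finally show ?case unfolding tel by (simp add: algebra_simps)
  qed
  have "Q p \<le> (\<Prod>q<p. exp (c q))"
    unfolding Q_def using c by (intro prod_mono) (auto intro: add_nonneg_nonneg exp_ge_add_one_self)
  also have "\<dots> = exp (\<Sum>q<p. c q)" by (simp add: exp_sum)
  finally have "Y * Q p \<le> Y * exp (\<Sum>q<p. c q)" using Y by (rule mult_left_mono)
  thus "p \<le> n \<Longrightarrow> v p \<le> Y * exp (\<Sum>q<p. c q)" using main order_trans by blast
qed

text \<open>
  This is the convergence of the sine integral at \<open>\<plusminus>\<infinity>\<close>, for both signs at once.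
\<close>

lemma delta_m1_near_step:
  assumes "0 < \<epsilon>"
  obtains m0 where "\<And>m. m0 \<le> \<bar>m\<bar> \<Longrightarrow> \<bar>delta_m1 m - (if 0 < m then 1 else 0)\<bar> \<le> \<epsilon>"
proof -
  have e: "0 < pi * \<epsilon>" using assms by simp
  have "\<forall>\<^sub>F t in at_top. dist (Si t) (pi / 2) < pi * \<epsilon>" by (rule tendstoD[OF Si_at_top e])
  then obtain T1 where T1: "\<And>t. T1 \<le> t \<Longrightarrow> \<bar>Si t - pi / 2\<bar> < pi * \<epsilon>"
    by (auto simp: eventually_at_top_linorder dist_real_def)
  have "\<forall>\<^sub>F t in at_bot. dist (Si t) (- (pi / 2)) < pi * \<epsilon>" by (rule tendstoD[OF Si_at_bot e])
  then obtain T2 where T2: "\<And>t. t \<le> T2 \<Longrightarrow> \<bar>Si t + pi / 2\<bar> < pi * \<epsilon>"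
    by (auto simp: eventually_at_bot_linorder dist_real_def)
  define m0 where "m0 = \<lceil>max 1 (max T1 (- T2))\<rceil>"
  have "\<bar>delta_m1 m - (if 0 < m then 1 else 0)\<bar> \<le> \<epsilon>" if m: "m0 \<le> \<bar>m\<bar>" for m
  proof -
    have b: "max 1 (max T1 (- T2)) \<le> of_int \<bar>m\<bar>" using m unfolding m0_def by (simp add: ceiling_le_iff)
    hence T: "T1 \<le> of_int \<bar>m\<bar>" "- T2 \<le> of_int \<bar>m\<bar>" by auto
    have pm: "real_of_int \<bar>m\<bar> \<le> pi * of_int \<bar>m\<bar>" using pi_gt3 by (simp add: mult_le_cancel_right1)
    show ?thesis
    proof (cases "0 < m")
      case True
      hence a: "real_of_int \<bar>m\<bar> = of_int m" by simp
      have "T1 \<le> pi * of_int m" using T(1) pm unfolding a by linarith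
      from T1[OF this] have "\<bar>1 / pi * (Si (pi * of_int m) - pi / 2)\<bar> \<le> 1 / pi * (pi * \<epsilon>)"
        unfolding abs_mult by (intro mult_mono) auto
      thus ?thesis using True by (simp add: delta_m1_def field_simps)
    next
      case False
      hence a: "real_of_int \<bar>m\<bar> = - of_int m" by simp
      have "pi * of_int m \<le> T2" using T(2) pm unfolding a by linarith
      from T2[OF this] have "\<bar>1 / pi * (Si (pi * of_int m) + pi / 2)\<bar> \<le> 1 / pi * (pi * \<epsilon>)"
        unfolding abs_mult by (intro mult_mono) auto
      thus ?thesis using False by (simp add: delta_m1_def field_simps)
    qed
  qed
  thus ?thesis by (rule that)
qed

lemma delta_m1_step_bounded:
  obtains B where "0 \<le> B" "\<And>m. \<bar>delta_m1 m - (if 0 < m then 1 else 0)\<bar> \<le> B"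
proof -
  obtain B where B: "0 \<le> B" "\<And>t. \<bar>Si t\<bar> \<le> B" using Si_bounded by blast
  have "\<bar>delta_m1 m - (if 0 < m then 1 else 0)\<bar> \<le> 2 + B / pi" for m
  proof -
    have "\<bar>1 / pi * Si (pi * of_int m)\<bar> \<le> B / pi" using B by (simp add: divide_right_mono)
    moreover have "(if 0 < m then 1 else 0) \<in> {0, 1::real}" by simp
    ultimately show ?thesis unfolding delta_m1_def by (elim insertE emptyE) linarith+
  qed
  thus ?thesis using that[of "2 + B / pi"] B by simp
qed

text \<open>
  A Riemann sum of \<open>exp (- \<bar>x\<bar>)\<close>, whose integral is \<open>2\<close>.
\<close>

lemma sum_exp_mesh_le:
  fixes h :: real
  assumes "0 < h"
  shows "(\<Sum>q\<le>2 * N. h * exp (- \<bar>(real q - real N) * h\<bar>)) \<le> h + 2"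
proof -
  have "(\<Sum>q\<le>2 * N. exp (- \<bar>(real q - real N) * h\<bar>)) = (\<Sum>j = - int N..int N. exp (- \<bar>of_int j * h\<bar>))"
    by (rule sum.reindex_bij_witness[of _ "\<lambda>j. nat (j + int N)" "\<lambda>q. int q - int N"]) auto
  also have "\<dots> = exp (- \<bar>of_int 0 * h\<bar>) + (\<Sum>j\<in>{- int N..int N} - {0}. exp (- \<bar>of_int j * h\<bar>))"
    by (subst sum.remove[of _ 0]) auto
  also have "{- int N..int N} - {0} = {- int N..int N} - {- int 0..int 0}" by auto
  also have "(\<Sum>j\<in>\<dots>. exp (- \<bar>of_int j * h\<bar>)) \<le> 2 / h"
    using sum_exp_tail_le[of 1 h N 0] assms by simp
  finally have "(\<Sum>q\<le>2 * N. exp (- \<bar>(real q - real N) * h\<bar>)) \<le> 1 + 2 / h" by simp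
  hence "h * (\<Sum>q\<le>2 * N. exp (- \<bar>(real q - real N) * h\<bar>)) \<le> h * (1 + 2 / h)"
    using assms by (intro mult_left_mono) auto
  thus ?thesis using assms by (simp add: sum_distrib_left distrib_left)
qed

text \<open>
  Write \<open>delta_m1 (p - q)\<close> as the indicator of \<open>q < p\<close> plus an error \<open>\<eta>\<close>. The indicator gives a
  strictly lower triangular matrix whose rows have bounded sums, so \<open>discrete_Gronwall\<close> bounds the
  solution with a constant independent of \<open>N\<close>. The rows of the remaining matrix are small: far from the
  diagonal \<open>\<eta>\<close> is at most \<open>\<epsilon>\<close>, while near the diagonal there is a fixed number of entries, each of
  size \<open>O(h N)\<close>. The contribution of this matrix is absorbed in the maximum \<open>X\<close> of the solution.
\<close>

lemma sinc_volterra_stability: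
  fixes \<rho> :: "real \<Rightarrow> real" and h :: "nat \<Rightarrow> real" and A M :: real
  assumes \<rho>: "\<And>x. 0 \<le> \<rho> x" "\<And>x. \<rho> x \<le> A * exp (- \<bar>x\<bar>)"
    and h: "\<And>N. 0 < N \<Longrightarrow> 0 < h N" "h \<longlonglongrightarrow> 0" and M: "0 \<le> M"
  obtains N0 Cs where "0 < N0" "0 \<le> Cs"
    "\<And>N (\<kappa> :: nat \<Rightarrow> nat \<Rightarrow> complex) (x :: nat \<Rightarrow> complex) Y p.
      \<lbrakk>N0 \<le> N; \<And>p q. p \<le> 2 * N \<Longrightarrow> q \<le> 2 * N \<Longrightarrow> cmod (\<kappa> p q) \<le> M;
        \<And>p. p \<le> 2 * N \<Longrightarrow> cmod (x p - (\<Sum>q\<le>2 * N. \<kappa> p q *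
          of_real (\<rho> ((real q - real N) * h N) * h N * delta_m1 (int p - int q)) * x q)) \<le> Y;
        p \<le> 2 * N\<rbrakk> \<Longrightarrow> cmod (x p) \<le> Cs * Y"
proof -
  have A: "0 \<le> A" using \<rho>(1)[of 0] \<rho>(2)[of 0] by simp
  \<comment> \<open>Bounds the sum of the quadrature weights \<open>\<rho> (j h) h\<close>, as soon as \<open>h N < 1\<close>.\<close>
  define W where "W = A * 3"
  have W0: "0 \<le> W" using A by (simp add: W_def)
  \<comment> \<open>Small enough for the perturbation, amplified by the Gronwall factor, to be at most half of \<open>X\<close>.\<close>
  define \<epsilon> where "\<epsilon> = 1 / (4 * (M + 1) * (W + 1) * exp (M * W))"
  have \<epsilon>: "0 < \<epsilon>" unfolding \<epsilon>_def using M W0 by (intro divide_pos_pos mult_pos_pos) auto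
  define \<eta> where "\<eta> = (\<lambda>m. \<bar>delta_m1 m - (if 0 < m then 1 else 0)\<bar>)"
  obtain m0 where m0: "\<And>m. m0 \<le> \<bar>m\<bar> \<Longrightarrow> \<eta> m \<le> \<epsilon>" using delta_m1_near_step[OF \<epsilon>] unfolding \<eta>_def by blast
  obtain B where B: "0 \<le> B" "\<And>m. \<eta> m \<le> B" using delta_m1_step_bounded unfolding \<eta>_def by blast
  have "(\<lambda>N. B * (2 * real (nat m0) + 1) * (A * h N)) \<longlonglongrightarrow> B * (2 * real (nat m0) + 1) * (A * 0)"
    by (intro tendsto_intros h)
  hence "\<forall>\<^sub>F N in sequentially. B * (2 * real (nat m0) + 1) * (A * h N) < \<epsilon>"
    using \<epsilon> by (intro order_tendstoD(2)) auto
  moreover have "\<forall>\<^sub>F N in sequentially. h N < 1"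
    by (rule order_tendstoD(2)[OF h(2)]) simp
  ultimately have "\<forall>\<^sub>F N in sequentially. B * (2 * real (nat m0) + 1) * (A * h N) < \<epsilon> \<and> h N < 1 \<and> 0 < N"
    by (intro eventually_conj eventually_gt_at_top)
  then obtain N0 where N0: "\<And>N. N0 \<le> N \<Longrightarrow> B * (2 * real (nat m0) + 1) * (A * h N) < \<epsilon> \<and> h N < 1 \<and> 0 < N"
    by (auto simp: eventually_sequentially)
  show ?thesis
  proof (rule that[of N0 "2 * exp (M * W)"])
    show "0 < N0" using N0[of N0] by simp
    show "0 \<le> 2 * exp (M * W)" by simp
    fix N :: nat and \<kappa> :: "nat \<Rightarrow> nat \<Rightarrow> complex" and x :: "nat \<Rightarrow> complex" and Y :: real and p :: nat
    assume N: "N0 \<le> N" and \<kappa>: "\<And>p q. p \<le> 2 * N \<Longrightarrow> q \<le> 2 * N \<Longrightarrow> cmod (\<kappa> p q) \<le> M"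
      and res: "\<And>p. p \<le> 2 * N \<Longrightarrow> cmod (x p - (\<Sum>q\<le>2 * N. \<kappa> p q *
          of_real (\<rho> ((real q - real N) * h N) * h N * delta_m1 (int p - int q)) * x q)) \<le> Y"
      and p: "p \<le> 2 * N"
    define w where "w = (\<lambda>q::nat. \<rho> ((real q - real N) * h N) * h N)"
    have hN: "0 < h N" "h N < 1" using N0[OF N] h by auto
    have w0: "0 \<le> w q" for q using \<rho> hN by (simp add: w_def)
    have wle: "w q \<le> A * (h N * exp (- \<bar>(real q - real N) * h N\<bar>))" for q
      using mult_right_mono[OF \<rho>(2)[of "(real q - real N) * h N"], of "h N"] hN by (simp add: w_def mult_ac)
    have wA: "w q \<le> A * h N" for q
    proof -
      have "A * (h N * exp (- \<bar>(real q - real N) * h N\<bar>)) \<le> A * (h N * 1)"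
        using A hN by (intro mult_left_mono) auto
      thus ?thesis using wle[of q] by simp
    qed
    have wW: "(\<Sum>q\<le>2 * N. w q) \<le> W"
    proof -
      have "(\<Sum>q\<le>2 * N. w q) \<le> A * (\<Sum>q\<le>2 * N. h N * exp (- \<bar>(real q - real N) * h N\<bar>))"
        unfolding sum_distrib_left by (intro sum_mono wle)
      also have "\<dots> \<le> A * (h N + 2)" using A sum_exp_mesh_le[OF hN(1)] by (intro mult_left_mono)
      also have "\<dots> \<le> W" unfolding W_def using A hN by (intro mult_left_mono) auto
      finally show ?thesis .
    qed
    have sum\<eta>: "(\<Sum>q\<le>2 * N. w q * \<eta> (int p - int q)) \<le> \<epsilon> * (W + 1)" for p
    proof -
      let ?near = "{q. q \<le> 2 * N \<and> \<bar>int p - int q\<bar> < m0}"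
      have "(\<Sum>q\<le>2 * N. w q * \<eta> (int p - int q)) \<le> (\<Sum>q\<le>2 * N. \<epsilon> * w q + (if q \<in> ?near then A * h N * B else 0))"
      proof (rule sum_mono)
        fix q assume q: "q \<in> {..2 * N}"
        show "w q * \<eta> (int p - int q) \<le> \<epsilon> * w q + (if q \<in> ?near then A * h N * B else 0)"
        proof (cases "q \<in> ?near")
          case True
          have "w q * \<eta> (int p - int q) \<le> A * h N * B"
            using wA w0 B(1) A hN by (intro mult_mono B(2)) (auto simp: \<eta>_def)
          moreover have "0 \<le> \<epsilon> * w q" using \<epsilon> w0 by simp
          ultimately show ?thesis using True by simp
        next
          case False
          hence "\<eta> (int p - int q) \<le> \<epsilon>" using q by (intro m0) auto
          hence "w q * \<eta> (int p - int q) \<le> w q * \<epsilon>" using w0 by (rule mult_left_mono)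
          thus ?thesis unfolding if_not_P[OF False] by (simp add: mult.commute)
        qed
      qed
      also have "\<dots> = \<epsilon> * (\<Sum>q\<le>2 * N. w q) + real (card ?near) * (A * h N * B)"
      proof -
        have "{..2 * N} \<inter> ?near = ?near" "{..2 * N} \<inter> {q. \<bar>int p - int q\<bar> < m0} = ?near" by auto
        thus ?thesis by (simp add: sum.distrib sum_distrib_left sum.If_cases)
      qed
      also have "\<dots> \<le> \<epsilon> * W + (2 * real (nat m0) + 1) * (A * h N * B)"
      proof (intro add_mono mult_left_mono mult_right_mono wW)
        have "?near \<subseteq> {p - nat m0..p + nat m0}" by auto
        hence "card ?near \<le> card {p - nat m0..p + nat m0}" by (intro card_mono) auto
        also have "\<dots> \<le> 2 * nat m0 + 1" by auto
        finally show "real (card ?near) \<le> 2 * real (nat m0) + 1" by linarith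
      qed (use \<epsilon> A hN B in auto)
      also have "\<dots> \<le> \<epsilon> * W + \<epsilon>" using N0[OF N] by (simp add: mult_ac)
      finally show ?thesis by (simp add: distrib_left)
    qed
    define X where "X = Max ((\<lambda>q. cmod (x q)) ` {..2 * N})"
    have X: "cmod (x q) \<le> X" if "q \<le> 2 * N" for q
      unfolding X_def using that by (intro Max_ge) auto
    have X0: "0 \<le> X" using X[of 0] norm_ge_zero[of "x 0"] by linarith
    have Y0: "0 \<le> Y" using order_trans[OF norm_ge_zero res[OF p]] .
    define Y' where "Y' = Y + M * (X * (\<epsilon> * (W + 1)))"
    have Y'0: "0 \<le> Y'" unfolding Y'_def using Y0 M X0 \<epsilon> W0 by simp
    have "cmod (x p) \<le> Y' + (\<Sum>q<p. (M * w q) * cmod (x q))" if p: "p \<le> 2 * N" for p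
    proof -
      let ?t = "\<lambda>q. \<kappa> p q * of_real (w q * delta_m1 (int p - int q)) * x q"
      have "cmod (x p) \<le> cmod (x p - (\<Sum>q\<le>2 * N. ?t q)) + cmod (\<Sum>q\<le>2 * N. ?t q)"
        using norm_triangle_ineq[of "x p - (\<Sum>q\<le>2 * N. ?t q)" "\<Sum>q\<le>2 * N. ?t q"] by simp
      also have "\<dots> \<le> Y + (\<Sum>q\<le>2 * N. M * (w q * \<eta> (int p - int q)) * X + (if q < p then M * w q * cmod (x q) else 0))"
      proof (intro add_mono)
        show "cmod (x p - (\<Sum>q\<le>2 * N. ?t q)) \<le> Y" using res[OF p] by (simp add: w_def)
        show "cmod (\<Sum>q\<le>2 * N. ?t q) \<le> (\<Sum>q\<le>2 * N. M * (w q * \<eta> (int p - int q)) * X + (if q < p then M * w q * cmod (x q) else 0))"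
        proof (rule order_trans[OF norm_sum sum_mono])
          fix q assume q: "q \<in> {..2 * N}"
          have \<delta>: "\<bar>delta_m1 (int p - int q)\<bar> \<le> \<eta> (int p - int q) + (if q < p then 1 else 0)"
            unfolding \<eta>_def by auto
          have "cmod (?t q) = cmod (\<kappa> p q) * (w q * \<bar>delta_m1 (int p - int q)\<bar>) * cmod (x q)"
            using w0[of q] by (simp add: norm_mult abs_mult)
          also have "\<dots> \<le> M * (w q * (\<eta> (int p - int q) + (if q < p then 1 else 0))) * cmod (x q)"
            using \<kappa>[OF p] q w0 M \<delta> by (intro mult_right_mono mult_mono mult_left_mono) auto
          also have "\<dots> = M * (w q * \<eta> (int p - int q)) * cmod (x q) + (if q < p then M * w q * cmod (x q) else 0)"
            by (simp add: algebra_simps)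
          also have "\<dots> \<le> M * (w q * \<eta> (int p - int q)) * X + (if q < p then M * w q * cmod (x q) else 0)"
            using X q M w0 by (intro add_right_mono mult_left_mono) (auto simp: \<eta>_def)
          finally show "cmod (?t q) \<le> M * (w q * \<eta> (int p - int q)) * X + (if q < p then M * w q * cmod (x q) else 0)" .
        qed
      qed
      also have "\<dots> = Y + M * (X * (\<Sum>q\<le>2 * N. w q * \<eta> (int p - int q))) + (\<Sum>q<p. (M * w q) * cmod (x q))"
      proof -
        have "{..2 * N} \<inter> {q. q < p} = {..<p}" using p by auto
        thus ?thesis by (simp add: sum.distrib sum.If_cases sum_distrib_left mult_ac)
      qed
      also have "\<dots> \<le> Y' + (\<Sum>q<p. (M * w q) * cmod (x q))"
        unfolding Y'_def using M X0 sum\<eta>[of p] by (intro add_mono mult_left_mono) auto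
      finally show ?thesis .
    qed
    note gr = discrete_Gronwall[of "\<lambda>q. M * w q" Y' "2 * N" "\<lambda>q. cmod (x q)", OF _ Y'0 this]
    have xle: "cmod (x p) \<le> Y' * exp (M * W)" if p: "p \<le> 2 * N" for p
    proof -
      have "cmod (x p) \<le> Y' * exp (\<Sum>q<p. M * w q)" using M w0 p by (intro gr) auto
      also have "(\<Sum>q<p. M * w q) \<le> M * (\<Sum>q\<le>2 * N. w q)"
        unfolding sum_distrib_left using M w0 p by (intro sum_mono2) auto
      also have "\<dots> \<le> M * W" using M wW by (intro mult_left_mono)
      finally show ?thesis using Y'0 by (simp add: mult_left_mono)
    qed
    have "X \<le> Y' * exp (M * W)" unfolding X_def using xle by (subst Max_le_iff) auto
    also have "\<dots> = Y * exp (M * W) + X * (M * (W + 1) * exp (M * W) * \<epsilon>)"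
      by (simp add: Y'_def algebra_simps)
    also have "\<dots> \<le> Y * exp (M * W) + X * (1 / 2)"
    proof (intro add_left_mono mult_left_mono X0)
      have "M * (W + 1) * exp (M * W) * \<epsilon> = M / (4 * (M + 1))"
        unfolding \<epsilon>_def using M W0 by simp
      also have "\<dots> \<le> 1 / 2" using M by (simp add: field_simps)
      finally show "M * (W + 1) * exp (M * W) * \<epsilon> \<le> 1 / 2" .
    qed
    finally have "X \<le> 2 * (Y * exp (M * W))" by linarith
    hence "X \<le> 2 * exp (M * W) * Y" by (simp add: mult_ac)
    thus "cmod (x p) \<le> 2 * exp (M * W) * Y" using X[OF p] by linarith
  qed
qed

section \<open>Errors on the SE mesh\<close>

text \<open>
  Brings the exponential decay into the form that the contour estimates require.
\<close>

lemma exp_decay_le_inverse_quartic: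
  fixes x \<beta> :: real
  assumes "0 < \<beta>"
  shows "exp (- \<beta> * \<bar>x\<bar>) \<le> (max 1 (4 / \<beta>)) ^ 4 / (1 + x\<^sup>2)\<^sup>2"
proof -
  define m where "m = max 1 (4 / \<beta>)"
  have m: "1 \<le> m" "4 / \<beta> \<le> m" by (auto simp: m_def)
  have "4 / \<beta> * (\<beta> * \<bar>x\<bar> / 4) \<le> m * (\<beta> * \<bar>x\<bar> / 4)"
    using m assms by (intro mult_right_mono) auto
  hence "1 + \<bar>x\<bar> \<le> m * (1 + \<beta> * \<bar>x\<bar> / 4)" using m assms by (simp add: distrib_left)
  also have "\<dots> \<le> m * exp (\<beta> * \<bar>x\<bar> / 4)"
    using m by (intro mult_left_mono exp_ge_add_one_self) auto
  finally have "(1 + \<bar>x\<bar>) ^ 4 \<le> (m * exp (\<beta> * \<bar>x\<bar> / 4)) ^ 4" by (intro power_mono) auto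
  also have "\<dots> = m ^ 4 * exp (\<beta> * \<bar>x\<bar>)"
    by (simp add: power_mult_distrib flip: exp_of_nat_mult)
  finally have 1: "(1 + \<bar>x\<bar>) ^ 4 \<le> m ^ 4 * exp (\<beta> * \<bar>x\<bar>)" .
  have "1 + x\<^sup>2 \<le> (1 + \<bar>x\<bar>)\<^sup>2" by (simp add: power2_sum)
  hence "(1 + x\<^sup>2)\<^sup>2 \<le> ((1 + \<bar>x\<bar>)\<^sup>2)\<^sup>2" by (intro power_mono) auto
  also have "\<dots> = (1 + \<bar>x\<bar>) ^ 4" by simp
  finally have 2: "(1 + x\<^sup>2)\<^sup>2 \<le> m ^ 4 * exp (\<beta> * \<bar>x\<bar>)" using 1 by linarith
  have p: "0 < (1 + x\<^sup>2)\<^sup>2" by (intro zero_less_power add_pos_nonneg) auto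
  have "exp (- \<beta> * \<bar>x\<bar>) * (1 + x\<^sup>2)\<^sup>2 \<le> exp (- \<beta> * \<bar>x\<bar>) * (m ^ 4 * exp (\<beta> * \<bar>x\<bar>))"
    using 2 by (intro mult_left_mono) auto
  also have "\<dots> = m ^ 4" by (simp add: exp_minus field_simps)
  finally show ?thesis using p by (simp add: m_def pos_le_divide_eq)
qed

lemma inverse_sinh_le:
  fixes y y0 :: real
  assumes "0 < y0" "y0 \<le> y"
  shows "1 / sinh y \<le> 2 / (1 - exp (- 2 * y0)) * exp (- y)"
proof -
  have c: "0 < 1 - exp (- 2 * y0)" using assms by simp
  have "exp (- 2 * y) \<le> exp (- 2 * y0)" using assms by simp
  hence "exp y * (1 - exp (- 2 * y0)) / 2 \<le> exp y * (1 - exp (- 2 * y)) / 2"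
    by (intro divide_right_mono mult_left_mono) auto
  also have "\<dots> = sinh y"
  proof -
    have "exp y * exp (- 2 * y) = exp (- y)" unfolding mult_exp_exp by simp
    thus ?thesis by (simp only: sinh_field_def right_diff_distrib mult_1_right)
  qed
  finally have le: "exp y * (1 - exp (- 2 * y0)) / 2 \<le> sinh y" .
  have "1 / sinh y \<le> 1 / (exp y * (1 - exp (- 2 * y0)) / 2)"
    by (rule frac_le[OF _ _ _ le]) (use c in auto)
  also have "\<dots> = 2 / (1 - exp (- 2 * y0)) * exp (- y)"
  proof -
    have "1 / (E * C / 2) = 2 / C * inverse E" for E C :: real by (simp only: divide_inverse inverse_mult_distrib inverse_inverse_eq mult_1_left mult_ac)
    thus ?thesis unfolding exp_minus[of y] by blast
  qed
  finally show ?thesis .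
qed

lemma sum_inverse_squares_le: "(\<Sum>m=1..n. 1 / (real m)\<^sup>2) \<le> 2"
proof -
  have main: "(\<Sum>m=1..Suc n. 1 / (real m)\<^sup>2) \<le> 2 - 1 / real (Suc n)" for n
  proof (induction n)
    case (Suc n)
    define r where "r = real (Suc n)"
    have r: "0 < r" by (simp add: r_def)
    have "1 / (r + 1)\<^sup>2 \<le> 1 / (r * (r + 1))"
      using r by (intro divide_left_mono) (auto simp: power2_eq_square)
    also have "\<dots> = 1 / r - 1 / (r + 1)" using r by (simp add: field_simps)
    finally have "1 / (real (Suc (Suc n)))\<^sup>2 \<le> 1 / real (Suc n) - 1 / real (Suc (Suc n))"
      by (simp add: r_def add.commute)
    thus ?case using Suc by simp
  qed simp
  show ?thesis
  proof (cases n)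
    case (Suc m)
    have "0 \<le> 1 / real (Suc m)" by simp
    thus ?thesis using main[of m] unfolding Suc by linarith
  qed simp
qed

lemma abs_S_le:
  assumes h: "0 < h" and i: "\<bar>x / h - of_int i\<bar> \<le> 1 / 2" and ij: "i \<noteq> j"
  shows "\<bar>S j h x\<bar> \<le> 1 / \<bar>of_int (i - j)\<bar>"
proof -
  have "1 \<le> \<bar>i - j\<bar>" using ij by linarith
  hence ge1: "1 \<le> \<bar>real_of_int (i - j)\<bar>" by linarith
  have far: "\<bar>real_of_int (i - j)\<bar> / 2 \<le> \<bar>x / h - of_int j\<bar>" 
  proof -
    have "\<bar>I - J\<bar> / 2 \<le> \<bar>A - J\<bar>" if "\<bar>A - I\<bar> \<le> 1 / 2" "1 \<le> \<bar>I - J\<bar>" for A I J :: real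
      using that by (auto simp: abs_if split: if_splits)
    thus ?thesis using i ge1 unfolding of_int_diff by blast
  qed
  hence ne: "x \<noteq> of_int j * h" using ge1 h by auto
  have e: "pi * (x - of_int j * h) / h = pi * (x / h - of_int j)" using h by (simp add: field_simps)
  have "\<bar>S j h x\<bar> = \<bar>sin (pi * (x / h - of_int j))\<bar> / (pi * \<bar>x / h - of_int j\<bar>)"
    using ne unfolding S_def e by (simp add: abs_mult)
  also have "\<dots> \<le> 1 / \<bar>of_int (i - j)\<bar>"
  proof (rule frac_le)
    have "\<bar>real_of_int (i - j)\<bar> / 2 * 2 \<le> \<bar>x / h - of_int j\<bar> * pi"
      using far pi_ge_two by (intro mult_mono) auto
    thus "\<bar>real_of_int (i - j)\<bar> \<le> pi * \<bar>x / h - of_int j\<bar>" by (simp add: mult.commute)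
  qed (use ge1 in auto)
  finally show ?thesis .
qed

text \<open>
  By the Cauchy-Schwarz inequality it suffices that the squares have a bounded sum, which follows
  from comparison with the inverse squares of the distances to the node closest to \<open>x\<close>. The true
  order of growth is \<open>ln N\<close>, but the interpolation error already contains a factor \<open>sqrt N\<close>.
\<close>

lemma sinc_Lebesgue_constant:
  assumes h: "0 < h" and N: "0 < N"
  shows "(\<Sum>j = - int N..int N. \<bar>S j h x\<bar>) \<le> 4 * sqrt (real N)"
proof -
  define i where "i = round (x / h)"
  have i: "\<bar>x / h - of_int i\<bar> \<le> 1 / 2" unfolding i_def using of_int_round_abs_le[of "x / h"] by linarith
  let ?J = "{- int N..int N}"
  define K where "K = nat (\<bar>i\<bar> + int N)"
  have "(\<Sum>j\<in>?J. (S j h x)\<^sup>2) \<le> (\<Sum>j\<in>insert i ?J. (S j h x)\<^sup>2)" by (intro sum_mono2) auto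
  also have "\<dots> = (S i h x)\<^sup>2 + (\<Sum>j\<in>?J - {i}. (S j h x)\<^sup>2)" by (subst sum.insert_remove) auto
  also have "\<dots> \<le> 1 + (\<Sum>j\<in>?J - {i}. 1 / (of_int (i - j))\<^sup>2)"
  proof (intro add_mono sum_mono)
    show "(S i h x)\<^sup>2 \<le> 1" using abs_S_le_1[of i h x] by (simp add: abs_square_le_1)
    fix j assume "j \<in> ?J - {i}"
    hence "\<bar>S j h x\<bar>\<^sup>2 \<le> (1 / \<bar>of_int (i - j)\<bar>)\<^sup>2" by (intro power_mono abs_S_le[OF h i]) auto
    thus "(S j h x)\<^sup>2 \<le> 1 / (of_int (i - j))\<^sup>2" by (simp add: power_divide del: of_int_diff)
  qed
  also have "(\<Sum>j\<in>?J - {i}. 1 / (real_of_int (i - j))\<^sup>2) = (\<Sum>m\<in>(\<lambda>j. i - j) ` (?J - {i}). 1 / (real_of_int m)\<^sup>2)"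
    by (subst sum.reindex) (auto simp: inj_on_def)
  also have "\<dots> \<le> (\<Sum>m\<in>int ` {1..K} \<union> (\<lambda>n. - int n) ` {1..K}. 1 / (real_of_int m)\<^sup>2)"
  proof (intro sum_mono2)
    show "(\<lambda>j. i - j) ` (?J - {i}) \<subseteq> int ` {1..K} \<union> (\<lambda>n. - int n) ` {1..K}"
    proof
      fix m assume "m \<in> (\<lambda>j. i - j) ` (?J - {i})"
      then obtain j where j: "m = i - j" "j \<in> ?J" "j \<noteq> i" by blast
      hence "nat \<bar>m\<bar> \<in> {1..K}" unfolding K_def by auto
      moreover have "m = int (nat \<bar>m\<bar>) \<or> m = - int (nat \<bar>m\<bar>)" by auto
      ultimately show "m \<in> int ` {1..K} \<union> (\<lambda>n. - int n) ` {1..K}" by blast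
    qed
  qed auto
  also have "\<dots> \<le> (\<Sum>m\<in>int ` {1..K}. 1 / (real_of_int m)\<^sup>2) + (\<Sum>m\<in>(\<lambda>n. - int n) ` {1..K}. 1 / (real_of_int m)\<^sup>2)"
    by (subst sum.union_inter[symmetric]) (auto intro: sum_nonneg)
  also have "\<dots> = (\<Sum>m=1..K. 1 / (real m)\<^sup>2) + (\<Sum>m=1..K. 1 / (real m)\<^sup>2)"
    by (simp add: sum.reindex inj_on_def)
  also have "1 + \<dots> \<le> 5" using sum_inverse_squares_le[of K] by simp
  finally have sq: "(\<Sum>j\<in>?J. (S j h x)\<^sup>2) \<le> 5" by simp
  have "(\<Sum>j\<in>?J. \<bar>S j h x\<bar>)\<^sup>2 \<le> (\<Sum>j\<in>?J. \<bar>S j h x\<bar>\<^sup>2) * real (card ?J)"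
    by (rule sum_squared_le_sum_of_squares) 
  also have "\<dots> \<le> 5 * real (2 * N + 1)"
    using sq by (intro mult_mono) auto
  also have "\<dots> \<le> 16 * real N" using N by simp
  also have "\<dots> = (4 * sqrt (real N))\<^sup>2" by (simp add: power_mult_distrib)
  finally show ?thesis by (rule power2_le_imp_le) simp
qed

context
  fixes \<alpha> d :: real
  assumes \<alpha>: "0 < \<alpha>" and d: "0 < d"
begin

lemma mesh_size_pos: "0 < N \<Longrightarrow> 0 < mesh_size \<alpha> d N"
  unfolding mesh_size_def using \<alpha> d by simp

text \<open>
  The mesh size balances the discretisation error \<open>exp (- pi * d / h)\<close> against the truncation error
  \<open>exp (- \<alpha> * N * h)\<close>.
\<close>

lemma mesh_size_exponents:
  assumes N: "0 < N"
  shows "pi * d / mesh_size \<alpha> d N = sqrt (pi * d * \<alpha> * real N)"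
    and "\<alpha> * (real N * mesh_size \<alpha> d N) = sqrt (pi * d * \<alpha> * real N)"
    and "1 / mesh_size \<alpha> d N = sqrt (\<alpha> / (pi * d)) * sqrt (real N)"
proof -
  define s where "s = sqrt (pi * d)"
  define r where "r = sqrt (\<alpha> * real N)"
  have s: "0 < s" "pi * d = s * s" using d by (simp_all add: s_def)
  have r: "0 < r" "\<alpha> * real N = r * r" using \<alpha> N by (simp_all add: r_def)
  have h: "mesh_size \<alpha> d N = s / r" by (simp add: mesh_size_def s_def r_def real_sqrt_divide)
  have t: "sqrt (pi * d * \<alpha> * real N) = s * r" by (simp only: s_def r_def real_sqrt_mult[symmetric] mult.assoc)
  show "pi * d / mesh_size \<alpha> d N = sqrt (pi * d * \<alpha> * real N)"
    unfolding h t unfolding s(2) using s r by simp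
  have "\<alpha> * (real N * mesh_size \<alpha> d N) = (r * r) * (s / r)" unfolding h r(2)[symmetric] by simp
  thus "\<alpha> * (real N * mesh_size \<alpha> d N) = sqrt (pi * d * \<alpha> * real N)"
    unfolding t using r by simp
  show "1 / mesh_size \<alpha> d N = sqrt (\<alpha> / (pi * d)) * sqrt (real N)"
    unfolding h by (simp add: s_def r_def real_sqrt_mult real_sqrt_divide)
qed

lemma mesh_size_le: "0 < N \<Longrightarrow> mesh_size \<alpha> d N \<le> sqrt (pi * d / \<alpha>)"
proof -
  assume N: "0 < N"
  have "pi * d / (\<alpha> * real N) \<le> pi * d / (\<alpha> * 1)"
    using \<alpha> d N by (intro divide_left_mono mult_left_mono mult_pos_pos) auto
  thus ?thesis by (simp add: mesh_size_def)
qed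

lemma mesh_size_tendsto_0: "mesh_size \<alpha> d \<longlonglongrightarrow> 0"
proof -
  have "(\<lambda>N. sqrt (pi * d / \<alpha> * (1 / real N))) \<longlonglongrightarrow> sqrt (pi * d / \<alpha> * 0)"
    by (intro tendsto_intros lim_1_over_n)
  thus ?thesis by (simp add: mesh_size_def[abs_def])
qed

definition sinh_const :: real where
  "sinh_const = 2 / (1 - exp (- 2 * sqrt (pi * d * \<alpha>)))"

lemma inverse_sinh_mesh_le:
  assumes N: "0 < N"
  shows "1 / sinh (pi * d / mesh_size \<alpha> d N) \<le> sinh_const * exp (- sqrt (pi * d * \<alpha> * real N))"
  unfolding mesh_size_exponents(1)[OF N] sinh_const_def
  using \<alpha> d N by (intro inverse_sinh_le) auto

lemma sinh_const_pos: "0 < sinh_const"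
  unfolding sinh_const_def using \<alpha> d by simp

lemma SE_interpolation_error:
  assumes F: "F holomorphic_on strip d" and K: "0 \<le> K"
    and b: "\<And>\<zeta>. \<zeta> \<in> strip d \<Longrightarrow> cmod (F \<zeta>) \<le> K * exp (- \<alpha> * \<bar>Re \<zeta>\<bar>)"
  obtains Ci where "0 \<le> Ci" "\<And>N x. 0 < N \<Longrightarrow>
    cmod (F (of_real x) - (\<Sum>j = - int N..int N. F (of_real (of_int j * mesh_size \<alpha> d N)) *
        of_real (S j (mesh_size \<alpha> d N) x)))
      \<le> Ci * sqrt (real N) * exp (- sqrt (pi * d * \<alpha> * real N))"
proof -
  define c where "c = (max 1 (4 / \<alpha>)) ^ 4"
  have c0: "0 \<le> c" unfolding c_def by (intro zero_le_power) auto
  define C1 where "C1 = K * c / d * sinh_const"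
  define C2 where "C2 = 2 * K / \<alpha> * sqrt (\<alpha> / (pi * d))"
  have C1: "0 \<le> C1" unfolding C1_def using K c0 d sinh_const_pos by simp
  have C2: "0 \<le> C2" unfolding C2_def using K \<alpha> d by simp
  have Kb: "cmod (F \<zeta>) \<le> K * c / (1 + (Re \<zeta>)\<^sup>2)\<^sup>2" if "\<zeta> \<in> strip d" for \<zeta>
    using b[OF that] mult_left_mono[OF exp_decay_le_inverse_quartic[OF \<alpha>, of "Re \<zeta>"] K]
    by (simp add: c_def)
  have "cmod (F (of_real x) - (\<Sum>j = - int N..int N. F (of_real (of_int j * mesh_size \<alpha> d N)) *
        of_real (S j (mesh_size \<alpha> d N) x)))
      \<le> (C1 + C2) * sqrt (real N) * exp (- sqrt (pi * d * \<alpha> * real N))" if N: "0 < N" for N x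
  proof -
    let ?h = "mesh_size \<alpha> d N" and ?E = "exp (- sqrt (pi * d * \<alpha> * real N))"
    have sN: "1 \<le> sqrt (real N)" using N by simp
    have "cmod (F (of_real x) - (\<Sum>j = - int N..int N. F (of_real (of_int j * ?h)) * of_real (S j ?h x)))
        \<le> K * c / (d * sinh (pi * d / ?h)) + 2 * K * exp (- \<alpha> * (N * ?h)) / (\<alpha> * ?h)"
    proof (rule sinc_interpolation_error[OF F mesh_size_pos[OF N] d _ Kb \<alpha> K])
      show "cmod (F (of_real \<xi>)) \<le> K * exp (- \<alpha> * \<bar>\<xi>\<bar>)" for \<xi>
        using b[OF of_real_in_strip[OF d]] by simp
    qed (use K c0 in auto)
    also have "\<dots> = K * c / d * (1 / sinh (pi * d / ?h)) + 2 * K / \<alpha> * exp (- (\<alpha> * (N * ?h))) * (1 / ?h)"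
      by simp
    also have "\<dots> \<le> K * c / d * (sinh_const * ?E) + 2 * K / \<alpha> * ?E * (sqrt (\<alpha> / (pi * d)) * sqrt (real N))"
      unfolding mesh_size_exponents(2,3)[OF N]
      using inverse_sinh_mesh_le[OF N] K c0 d by (intro add_right_mono mult_left_mono) auto
    also have "\<dots> = C1 * 1 * ?E + C2 * sqrt (real N) * ?E" by (simp add: C1_def C2_def mult_ac)
    also have "\<dots> \<le> C1 * sqrt (real N) * ?E + C2 * sqrt (real N) * ?E"
      using sN C1 by (intro add_right_mono mult_right_mono mult_left_mono) auto
    finally show ?thesis by (simp add: distrib_right)
  qed
  thus ?thesis using that[of "C1 + C2"] C1 C2 by auto
qed

text \<open>
  Integrands containing the Jacobian decay like \<open>exp (- \<bar>Re \<zeta>\<bar>)\<close>; as \<open>\<alpha> \<le> 1\<close>, the truncation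
  error \<open>exp (- N * h)\<close> is not larger than the rate. The constant does not depend on the integrand,
  because it has to serve for all rows of the linear system at once.
\<close>

lemma SE_indefinite_integral_error:
  assumes K: "0 \<le> K" and \<alpha>1: "\<alpha> \<le> 1"
  obtains Cq where "0 \<le> Cq" "\<And>N x F p. \<lbrakk>0 < N; F holomorphic_on strip d;
      \<And>\<zeta>. \<zeta> \<in> strip d \<Longrightarrow> cmod (F \<zeta>) \<le> K * exp (- \<bar>Re \<zeta>\<bar>); vanishing_primitive d F p\<rbrakk> \<Longrightarrow>
    cmod (p (of_real x) - (\<Sum>j = - int N..int N. F (of_real (of_int j * mesh_size \<alpha> d N)) *
        of_real (mesh_size \<alpha> d N * (1 / 2 + 1 / pi * Si (pi * (x - of_int j * mesh_size \<alpha> d N) / mesh_size \<alpha> d N)))))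
      \<le> Cq * exp (- sqrt (pi * d * \<alpha> * real N))"
proof -
  obtain B where B: "0 \<le> B" "\<And>t. \<bar>Si t\<bar> \<le> B" using Si_bounded by blast
  define c where "c = (4::real) ^ 4"
  have c0: "0 \<le> c" by (simp add: c_def)
  define C1 where "C1 = sqrt (pi * d / \<alpha>) * ((2 * (1 + 1 / d\<^sup>2) * (K * c) + 2 / pi * (K * c / d)) * sinh_const)"
  define C2 where "C2 = 4 * B * K / pi"
  have q: "0 \<le> 2 * (1 + 1 / d\<^sup>2) * (K * c) + 2 / pi * (K * c / d)"
    by (intro add_nonneg_nonneg mult_nonneg_nonneg divide_nonneg_nonneg c0) (use K d in auto)
  have C1: "0 \<le> C1" unfolding C1_def
    by (intro mult_nonneg_nonneg q) (use sinh_const_pos \<alpha> d in auto)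
  have C2: "0 \<le> C2" unfolding C2_def using B K by simp
  have main: "cmod (p (of_real x) - (\<Sum>j = - int N..int N. F (of_real (of_int j * mesh_size \<alpha> d N)) *
        of_real (mesh_size \<alpha> d N * (1 / 2 + 1 / pi * Si (pi * (x - of_int j * mesh_size \<alpha> d N) / mesh_size \<alpha> d N)))))
      \<le> (C1 + C2) * exp (- sqrt (pi * d * \<alpha> * real N))"
    if N: "0 < N" and F: "F holomorphic_on strip d"
      and b: "\<And>\<zeta>. \<zeta> \<in> strip d \<Longrightarrow> cmod (F \<zeta>) \<le> K * exp (- \<bar>Re \<zeta>\<bar>)"
      and p: "vanishing_primitive d F p" for N x F p
  proof -
    let ?h = "mesh_size \<alpha> d N" and ?E = "exp (- sqrt (pi * d * \<alpha> * real N))"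
    have h: "0 < ?h" by (rule mesh_size_pos[OF N])
    have Kb: "cmod (F \<zeta>) \<le> K * c / (1 + (Re \<zeta>)\<^sup>2)\<^sup>2" if "\<zeta> \<in> strip d" for \<zeta>
      using b[OF that] mult_left_mono[OF exp_decay_le_inverse_quartic[of 1 "Re \<zeta>"] K]
      by (simp add: c_def)
    have "cmod (p (of_real x) - (\<Sum>j = - int N..int N. F (of_real (of_int j * ?h)) *
        of_real (?h * (1 / 2 + 1 / pi * Si (pi * (x - of_int j * ?h) / ?h)))))
      \<le> ?h * (2 * (1 + 1 / d\<^sup>2) * (K * c) / sinh (pi * d / ?h) + 2 / pi * (K * c / (d * sinh (pi * d / ?h))))
        + 4 * B * K * exp (- 1 * (N * ?h)) / (pi * 1)"
    proof (rule sinc_indefinite_integral_error[OF F h d _ Kb _ K _ _ _ B(2), of _ "\<lambda>x. p (of_real x)"])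
      show "cmod (F (of_real \<xi>)) \<le> K * exp (- 1 * \<bar>\<xi>\<bar>)" for \<xi>
        using b[OF of_real_in_strip[OF d]] by simp
      show "((\<lambda>x. p (of_real x)) has_vector_derivative F (of_real x)) (at x)" for x
        using p of_real_in_strip[OF d]
        by (intro has_vector_derivative_real_field) (auto simp: vanishing_primitive_def)
      show "((\<lambda>x. p (of_real x)) \<longlongrightarrow> 0) at_bot" using p by (simp add: vanishing_primitive_def)
    qed (use K in \<open>auto simp: c_def\<close>)
    also have "\<dots> = ?h * ((2 * (1 + 1 / d\<^sup>2) * (K * c) + 2 / pi * (K * c / d)) * (1 / sinh (pi * d / ?h)))
        + C2 * exp (- (N * ?h))"
      by (simp add: C2_def add_divide_distrib)
    also have "\<dots> \<le> sqrt (pi * d / \<alpha>) * ((2 * (1 + 1 / d\<^sup>2) * (K * c) + 2 / pi * (K * c / d)) * (sinh_const * ?E)) + C2 * ?E"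
    proof (intro add_mono mult_mono[OF mesh_size_le[OF N]] mult_left_mono q C2 inverse_sinh_mesh_le N)
      have "\<alpha> * (N * ?h) \<le> 1 * (N * ?h)" using \<alpha>1 h by (intro mult_right_mono) auto
      thus "exp (- (N * ?h)) \<le> ?E" unfolding mesh_size_exponents(2)[OF N] by simp
      show "0 \<le> sqrt (pi * d / \<alpha>)" using \<alpha> d by simp
      show "0 \<le> (2 * (1 + 1 / d\<^sup>2) * (K * c) + 2 / pi * (K * c / d)) * (1 / sinh (pi * d / ?h))"
        using q h d by (intro mult_nonneg_nonneg) auto
    qed
    also have "\<dots> = (C1 + C2) * ?E" by (simp add: C1_def distrib_right)
    finally show ?thesis .
  qed
  show ?thesis by (rule that[of "C1 + C2"]) (use C1 C2 main in auto)
qed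

end

lemma one_minus_mat_mult_vec_index:
  fixes V :: "'a::comm_ring_1 mat"
  assumes V: "V \<in> carrier_mat n n" and c: "c \<in> carrier_vec n" and p: "p < n"
  shows "vec_index (mult_mat_vec (1\<^sub>m n - V) c) p = vec_index c p - (\<Sum>q<n. index_mat V (p, q) * vec_index c q)"
proof -
  have "vec_index (mult_mat_vec (1\<^sub>m n - V) c) p = (\<Sum>q<n. ((if p = q then 1 else 0) - index_mat V (p, q)) * vec_index c q)"
    using V c p by (simp add: scalar_prod_def lessThan_atLeast0)
  also have "\<dots> = (\<Sum>q<n. (if p = q then vec_index c q else 0)) - (\<Sum>q<n. index_mat V (p, q) * vec_index c q)"
    unfolding sum_subtractf[symmetric] by (intro sum.cong) (auto simp: left_diff_distrib)
  also have "(\<Sum>q<n. (if p = q then vec_index c q else 0)) = vec_index c p" using p by simp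
  finally show ?thesis .
qed

lemma injective_mat_invertible:
  fixes A :: "'a::field mat"
  assumes A: "A \<in> carrier_mat n n"
    and inj: "\<And>v. v \<in> carrier_vec n \<Longrightarrow> mult_mat_vec A v = 0\<^sub>v n \<Longrightarrow> v = 0\<^sub>v n"
  shows "invertible_mat A"
proof -
  have "Determinant.det A \<noteq> 0" using det_0_iff_vec_prod_zero_field[OF A] inj by blast
  from det_non_zero_imp_unit[OF A this, of "()"]
  obtain B where "B \<in> carrier_mat n n" "B * A = 1\<^sub>m n" "A * B = 1\<^sub>m n"
    unfolding Units_def ring_mat_def by auto
  thus ?thesis using A unfolding invertible_mat_def inverts_mat_def by (intro conjI exI[of _ B]) auto
qed

section \<open>Analytic continuation of the solution\<close>

locale volterra_SE =
  fixes a b \<alpha> d :: real and g :: "complex \<Rightarrow> complex" and k :: "complex \<Rightarrow> complex \<Rightarrow> complex"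
    and u :: "real \<Rightarrow> complex"
  assumes ab: "a < b" and \<alpha>: "0 < \<alpha>" "\<alpha> \<le> 1" and dd: "0 < d" "d < pi"
    and k_cont: "\<And>t. t \<in> {a..b} \<Longrightarrow> continuous_on {a..b} (\<lambda>s. k (of_real t) (of_real s))"
    and g_M: "g \<in> Malpha a b \<alpha> (SE_domain a b d)"
    and k_H: "\<And>z. z \<in> SE_domain a b d \<Longrightarrow> k z \<in> Hinf (SE_domain a b d)"
    and k_M: "Malpha_uniformly a b \<alpha> (SE_domain a b d) k"
    and sol: "volterra_solution a b k g u"
begin

abbreviation \<psi> :: "complex \<Rightarrow> complex" where "\<psi> \<equiv> SE_psi a b"
abbreviation \<psi>r :: "real \<Rightarrow> real" where "\<psi>r \<equiv> SE_psi a b"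
abbreviation \<psi>' :: "complex \<Rightarrow> complex" where "\<psi>' \<equiv> dpsi a b"
abbreviation \<psi>r' :: "real \<Rightarrow> real" where "\<psi>r' \<equiv> dpsi a b"
abbreviation \<phi> :: "real \<Rightarrow> real" where "\<phi> \<equiv> SE_phi a b"

text \<open>
  The factor \<open>\<psi>' \<omega>\<close> is the Jacobian, so that this is the kernel of the equation in the strip coordinate.
\<close>

definition pulled_kernel :: "complex \<Rightarrow> complex \<Rightarrow> complex" where
  "pulled_kernel \<zeta> \<omega> = k (\<psi> \<zeta>) (\<psi> \<omega>) * \<psi>' \<omega>"

lemma psi_in_domain: "\<zeta> \<in> strip d \<Longrightarrow> \<psi> \<zeta> \<in> SE_domain a b d"
  by (simp add: SE_domain_def)

lemma of_real_strip: "of_real x \<in> strip d"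
  by (rule of_real_in_strip[OF dd(1)])

lemma cos_half_d_pos: "0 < cos (d / 2)"
  by (rule cos_half_pos[OF dd])

lemma Hinf_comp_holomorphic:
  assumes "f \<in> Hinf (SE_domain a b d)"
  shows "(\<lambda>\<zeta>. f (\<psi> \<zeta>)) holomorphic_on strip d"
proof -
  have "f holomorphic_on SE_domain a b d" using assms by (simp add: Hinf_def analytic_imp_holomorphic)
  hence "(f \<circ> \<psi>) holomorphic_on strip d"
    by (intro holomorphic_on_compose_gen[OF SE_psi_holomorphic[OF dd]]) (auto simp: SE_domain_def)
  thus ?thesis by (simp add: o_def)
qed

text \<open>
  Bounds the distance to either end point, raised to the power \<open>\<alpha>\<close>, throughout the domain, and is
  the constant in the exponential decay of this power towards that end.
\<close>

definition end_distance_bound :: real where "end_distance_bound = ((b - a) / cos (d / 2)) powr \<alpha>"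

lemma end_distance_bound_nonneg: "0 \<le> end_distance_bound" by (simp add: end_distance_bound_def)

lemma left_distance:
  assumes "\<zeta> \<in> strip d"
  shows "cmod (\<psi> \<zeta> - of_real a) \<le> (b - a) / cos (d / 2) * exp (Re \<zeta>)"
    and "cmod (\<psi> \<zeta> - of_real a) powr \<alpha> \<le> end_distance_bound * exp (\<alpha> * Re \<zeta>)"
proof -
  have "(\<psi>r (Re \<zeta>) - a) / cos (d / 2) \<le> (b - a) * exp (Re \<zeta>) / cos (d / 2)"
    using cos_half_d_pos SE_psi_sub_left_le_exp[OF ab] by (intro divide_right_mono) auto
  thus 1: "cmod (\<psi> \<zeta> - of_real a) \<le> (b - a) / cos (d / 2) * exp (Re \<zeta>)"
    using cmod_SE_psi_sub_left[OF ab dd assms] by simp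
  have "cmod (\<psi> \<zeta> - of_real a) powr \<alpha> \<le> ((b - a) / cos (d / 2) * exp (Re \<zeta>)) powr \<alpha>"
    using 1 \<alpha> by (intro powr_mono2) auto
  also have "\<dots> = end_distance_bound * (exp (Re \<zeta>) powr \<alpha>)"
    unfolding end_distance_bound_def by (rule powr_mult)
  also have "exp (Re \<zeta>) powr \<alpha> = exp (\<alpha> * Re \<zeta>)" by (simp add: exp_powr_real mult.commute)
  finally show "cmod (\<psi> \<zeta> - of_real a) powr \<alpha> \<le> end_distance_bound * exp (\<alpha> * Re \<zeta>)" .
qed

lemma right_distance:
  assumes "\<zeta> \<in> strip d"
  shows "cmod (of_real b - \<psi> \<zeta>) \<le> (b - a) / cos (d / 2) * exp (- Re \<zeta>)"
    and "cmod (of_real b - \<psi> \<zeta>) powr \<alpha> \<le> end_distance_bound * exp (- \<alpha> * Re \<zeta>)"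
proof -
  have "(b - \<psi>r (Re \<zeta>)) / cos (d / 2) \<le> (b - a) * exp (- Re \<zeta>) / cos (d / 2)"
    using cos_half_d_pos SE_psi_sub_right_le_exp[OF ab] by (intro divide_right_mono) auto
  thus 1: "cmod (of_real b - \<psi> \<zeta>) \<le> (b - a) / cos (d / 2) * exp (- Re \<zeta>)"
    using cmod_SE_psi_sub_right[OF ab dd assms] by simp
  have "cmod (of_real b - \<psi> \<zeta>) powr \<alpha> \<le> ((b - a) / cos (d / 2) * exp (- Re \<zeta>)) powr \<alpha>"
    using 1 \<alpha> by (intro powr_mono2) auto
  also have "\<dots> = end_distance_bound * (exp (- Re \<zeta>) powr \<alpha>)"
    unfolding end_distance_bound_def by (rule powr_mult)
  also have "exp (- Re \<zeta>) powr \<alpha> = exp (- \<alpha> * Re \<zeta>)" by (simp add: exp_powr_real mult.commute)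
  finally show "cmod (of_real b - \<psi> \<zeta>) powr \<alpha> \<le> end_distance_bound * exp (- \<alpha> * Re \<zeta>)" .
qed

lemma domain_bounded:
  assumes "\<zeta> \<in> strip d"
  shows "cmod (\<psi> \<zeta> - of_real a) powr \<alpha> \<le> end_distance_bound"
proof -
  have "(\<psi>r (Re \<zeta>) - a) / cos (d / 2) \<le> (b - a) / cos (d / 2)"
    using cos_half_d_pos SE_psi_real_bounds(2)[OF ab, of "Re \<zeta>"] by (intro divide_right_mono) auto
  hence "cmod (\<psi> \<zeta> - of_real a) \<le> (b - a) / cos (d / 2)"
    using cmod_SE_psi_sub_left[OF ab dd assms] by linarith
  thus ?thesis unfolding end_distance_bound_def using \<alpha> by (intro powr_mono2) auto
qed

lemma Hoelder_constants:
  obtains Lg Lk where "0 \<le> Lg" "0 \<le> Lk"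
    "\<And>\<zeta>. \<zeta> \<in> strip d \<Longrightarrow> cmod (g (\<psi> \<zeta>) - g (of_real a)) \<le> Lg * cmod (\<psi> \<zeta> - of_real a) powr \<alpha>"
    "\<And>\<zeta>. \<zeta> \<in> strip d \<Longrightarrow> cmod (g (of_real b) - g (\<psi> \<zeta>)) \<le> Lg * cmod (of_real b - \<psi> \<zeta>) powr \<alpha>"
    "\<And>\<zeta> \<omega>. \<zeta> \<in> strip d \<Longrightarrow> \<omega> \<in> strip d \<Longrightarrow>
        cmod (k (\<psi> \<zeta>) (\<psi> \<omega>) - k (of_real a) (\<psi> \<omega>)) \<le> Lk * cmod (\<psi> \<zeta> - of_real a) powr \<alpha>"
    "\<And>\<zeta> \<omega>. \<zeta> \<in> strip d \<Longrightarrow> \<omega> \<in> strip d \<Longrightarrow>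
        cmod (k (of_real b) (\<psi> \<omega>) - k (\<psi> \<zeta>) (\<psi> \<omega>)) \<le> Lk * cmod (of_real b - \<psi> \<zeta>) powr \<alpha>"
proof -
  obtain L1 where L1: "end_Hoelder a b \<alpha> (SE_domain a b d) L1 g" using g_M by (auto simp: Malpha_def)
  obtain L2 where L2: "\<And>w. w \<in> SE_domain a b d \<Longrightarrow> end_Hoelder a b \<alpha> (SE_domain a b d) L2 (\<lambda>z. k z w)"
    using k_M by (auto simp: Malpha_uniformly_def)
  have up: "x \<le> L * y powr \<alpha> \<Longrightarrow> x \<le> \<bar>L\<bar> * y powr \<alpha>" for x L y :: real
    using mult_right_mono[OF abs_ge_self[of L] powr_ge_zero[of y \<alpha>]] by linarith
  show ?thesis
    by (rule that[of "\<bar>L1\<bar>" "\<bar>L2\<bar>"])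
       (use L1 L2 psi_in_domain in \<open>auto simp: end_Hoelder_def intro!: up\<close>)
qed

text \<open>
  The section of the kernel at \<open>\<psi> 0\<close> is bounded. By the uniform Hoelder condition at \<open>a\<close>, every
  other section differs from it by a bounded amount.
\<close>

lemma kernel_bounded:
  obtains M where "0 < M"
    "\<And>\<zeta> \<omega>. \<zeta> \<in> strip d \<Longrightarrow> \<omega> \<in> strip d \<Longrightarrow> cmod (k (\<psi> \<zeta>) (\<psi> \<omega>)) \<le> M"
proof -
  obtain Lg Lk where "0 \<le> Lk" and Lk: "\<And>\<zeta> \<omega>. \<zeta> \<in> strip d \<Longrightarrow> \<omega> \<in> strip d \<Longrightarrow>
        cmod (k (\<psi> \<zeta>) (\<psi> \<omega>) - k (of_real a) (\<psi> \<omega>)) \<le> Lk * cmod (\<psi> \<zeta> - of_real a) powr \<alpha>"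
    using Hoelder_constants by metis
  have Lk': "cmod (k (\<psi> \<zeta>) (\<psi> \<omega>) - k (of_real a) (\<psi> \<omega>)) \<le> Lk * end_distance_bound"
    if "\<zeta> \<in> strip d" "\<omega> \<in> strip d" for \<zeta> \<omega>
    using Lk[OF that] mult_left_mono[OF domain_bounded[OF that(1)] \<open>0 \<le> Lk\<close>] by linarith
  have o: "(0::complex) \<in> strip d" using of_real_strip[of 0] by simp
  have "k (\<psi> 0) \<in> Hinf (SE_domain a b d)" by (rule k_H[OF psi_in_domain[OF o]])
  then obtain B where B: "\<And>w. w \<in> SE_domain a b d \<Longrightarrow> cmod (k (\<psi> 0) w) \<le> B"
    by (auto simp: Hinf_def bounded_iff)
  have "cmod (k (\<psi> \<zeta>) (\<psi> \<omega>)) \<le> \<bar>B\<bar> + 2 * (Lk * end_distance_bound) + 1" if "\<zeta> \<in> strip d" "\<omega> \<in> strip d" for \<zeta> \<omega>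
  proof -
    have tri: "cmod (X - Y + Z) \<le> cmod X + cmod Y + cmod Z" for X Y Z :: complex
      using norm_triangle_ineq[of "X - Y" Z] norm_triangle_ineq4[of X Y] by linarith
    have "cmod (k (\<psi> \<zeta>) (\<psi> \<omega>)) \<le> cmod (k (\<psi> \<zeta>) (\<psi> \<omega>) - k (of_real a) (\<psi> \<omega>))
        + cmod (k (\<psi> 0) (\<psi> \<omega>) - k (of_real a) (\<psi> \<omega>)) + cmod (k (\<psi> 0) (\<psi> \<omega>))"
      using tri[of "k (\<psi> \<zeta>) (\<psi> \<omega>) - k (of_real a) (\<psi> \<omega>)" "k (\<psi> 0) (\<psi> \<omega>) - k (of_real a) (\<psi> \<omega>)" "k (\<psi> 0) (\<psi> \<omega>)"]
      by simp
    also have "\<dots> \<le> Lk * end_distance_bound + Lk * end_distance_bound + \<bar>B\<bar>"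
      by (intro add_mono Lk' that o order_trans[OF B[OF psi_in_domain[OF that(2)]]]) simp
    finally have "cmod (k (\<psi> \<zeta>) (\<psi> \<omega>)) \<le> Lk * end_distance_bound + Lk * end_distance_bound + \<bar>B\<bar>" .
    thus ?thesis by simp
  qed
  moreover have "0 < \<bar>B\<bar> + 2 * (Lk * end_distance_bound) + 1"
    using mult_nonneg_nonneg[OF \<open>0 \<le> Lk\<close> end_distance_bound_nonneg] by linarith
  ultimately show ?thesis using that by blast
qed

lemma pulled_kernel_strip_kernel:
  assumes M: "0 < M" "\<And>\<zeta> \<omega>. \<zeta> \<in> strip d \<Longrightarrow> \<omega> \<in> strip d \<Longrightarrow> cmod (k (\<psi> \<zeta>) (\<psi> \<omega>)) \<le> M"
  shows "strip_kernel d (b - a) (b - a) (\<lambda>x. \<psi>r x - a) \<psi>r' pulled_kernel (M / (cos (d / 2))\<^sup>2)"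
proof -
  interpret strip_weight d "b - a" "b - a" "\<lambda>x. \<psi>r x - a" \<psi>r'
    by (rule SE_psi_strip_weight[OF ab dd(1)])
  show ?thesis
  proof
    show "0 < M / (cos (d / 2))\<^sup>2" using M(1) cos_half_d_pos by simp
    show "(\<lambda>\<zeta>. pulled_kernel \<zeta> \<omega>) holomorphic_on strip d" if "\<omega> \<in> strip d" for \<omega>
    proof -
      have "(\<lambda>z. k z (\<psi> \<omega>)) \<in> Hinf (SE_domain a b d)"
        using k_M psi_in_domain[OF that] by (simp add: Malpha_uniformly_def)
      from Hinf_comp_holomorphic[OF this] show ?thesis
        unfolding pulled_kernel_def by (intro holomorphic_intros)
    qed
    show "pulled_kernel \<zeta> holomorphic_on strip d" if "\<zeta> \<in> strip d" for \<zeta>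
      unfolding pulled_kernel_def[abs_def]
      by (intro holomorphic_on_mult dpsi_holomorphic dd Hinf_comp_holomorphic k_H psi_in_domain that)
    show "cmod (pulled_kernel \<zeta> \<omega>) \<le> M / (cos (d / 2))\<^sup>2 * \<psi>r' (Re \<omega>)"
      if "\<zeta> \<in> strip d" "\<omega> \<in> strip d" for \<zeta> \<omega>
    proof -
      have "cmod (pulled_kernel \<zeta> \<omega>) \<le> M * (\<psi>r' (Re \<omega>) / (cos (d / 2))\<^sup>2)"
        unfolding pulled_kernel_def norm_mult
        by (intro mult_mono M(2) that cmod_dpsi_le[OF ab dd]) (use M(1) in auto)
      thus ?thesis by simp
    qed
  qed
qed

lemma u_cont: "continuous_on {a..b} u"
  and u_eq: "t \<in> {a..b} \<Longrightarrow> u t - integral {a..t} (\<lambda>s. k (of_real t) (of_real s) * u s) = g (of_real t)"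
  using sol by (auto simp: volterra_solution_def)

lemma u_left_end: "u a = g (of_real a)"
  using u_eq[of a] ab by simp

lemma psi_phi: "a < t \<Longrightarrow> t < b \<Longrightarrow> \<psi> (of_real (\<phi> t)) = of_real t"
  by (simp add: SE_psi_of_real SE_psi_phi[OF ab])

text \<open>
  The substitution \<open>s = \<psi> x\<close> in the fundamental theorem of calculus: the Jacobian in
  \<open>pulled_kernel\<close> cancels the derivative of \<open>\<phi>\<close>. At \<open>s = a\<close>, where \<open>\<phi>\<close> tends to \<open>- \<infinity>\<close>, the function
  \<open>q\<close> is continuous because the primitive vanishes there.
\<close>

lemma primitive_real_integral:
  assumes P: "vanishing_primitive d (\<lambda>\<omega>. pulled_kernel (of_real (\<phi> t)) \<omega> * U \<omega>) P" and t: "a < t" "t < b"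
  shows "((\<lambda>s. k (of_real t) (of_real s) * U (of_real (\<phi> s))) has_integral P (of_real (\<phi> t))) {a..t}"
proof -
  define q where "q = (\<lambda>s. if s \<le> a then 0 else P (of_real (\<phi> s)))"
  have der: "(q has_vector_derivative k (of_real t) (of_real s) * U (of_real (\<phi> s))) (at s)" if s: "a < s" "s < b" for s
  proof -
    have nz: "\<psi>r' (\<phi> s) \<noteq> 0" using ab by (simp add: dpsi_def)
    have "((\<lambda>s. complex_of_real (\<phi> s)) has_vector_derivative of_real (inverse (\<psi>r' (\<phi> s)))) (at s)"
      by (rule has_vector_derivative_of_real[OF SE_phi_has_derivative[OF ab s]])
    moreover have "(P has_field_derivative pulled_kernel (of_real (\<phi> t)) (of_real (\<phi> s)) * U (of_real (\<phi> s))) (at (of_real (\<phi> s)))"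
      using P of_real_strip by (simp add: vanishing_primitive_def)
    ultimately have "(P \<circ> (\<lambda>s. complex_of_real (\<phi> s)) has_vector_derivative
        of_real (inverse (\<psi>r' (\<phi> s))) * (pulled_kernel (of_real (\<phi> t)) (of_real (\<phi> s)) * U (of_real (\<phi> s)))) (at s)"
      by (rule field_vector_diff_chain_at)
    also have "of_real (inverse (\<psi>r' (\<phi> s))) * (pulled_kernel (of_real (\<phi> t)) (of_real (\<phi> s)) * U (of_real (\<phi> s)))
        = k (of_real t) (of_real s) * U (of_real (\<phi> s))"
      unfolding pulled_kernel_def psi_phi[OF t] psi_phi[OF s] dpsi_of_real using nz by (simp add: field_simps)
    finally show ?thesis
      by (rule has_vector_derivative_transform_within_open[of _ _ _ "{a<..<b}"])
         (use s in \<open>auto simp: q_def\<close>)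
  qed
  have "((\<lambda>s. k (of_real t) (of_real s) * U (of_real (\<phi> s))) has_integral (q t - q a)) {a..t}"
  proof (rule fundamental_theorem_of_calculus_interior)
    show "continuous_on {a..t} q"
      unfolding continuous_on_eq_continuous_within
    proof
      fix s assume s: "s \<in> {a..t}"
      show "continuous (at s within {a..t}) q"
      proof (cases "s = a")
        case True
        have "((\<lambda>s. P (of_real (\<phi> s))) \<longlongrightarrow> 0) (at_right a)"
          using P SE_phi_at_left_end[OF ab] unfolding vanishing_primitive_def
          by (auto intro: filterlim_compose[of "\<lambda>x. P (of_real x)"])
        hence "(q \<longlongrightarrow> 0) (at_right a)"
          by (rule Lim_transform_eventually) (auto simp: q_def eventually_at_filter)
        thus ?thesis using True t by (simp add: continuous_within q_def at_within_Icc_at_right)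
      next
        case False
        hence "isCont q s" using der[of s] s t by (intro has_vector_derivative_continuous) auto
        thus ?thesis by (rule continuous_at_imp_continuous_at_within)
      qed
    qed
  qed (use der t in auto)
  thus ?thesis using t by (simp add: q_def)
qed

text \<open>
  On the open interval the difference of \<open>u\<close> and \<open>U\<close> solves the homogeneous real Volterra equation.
\<close>

lemma solution_agrees:
  assumes U: "U holomorphic_on strip d" "\<And>\<zeta>. \<zeta> \<in> strip d \<Longrightarrow> cmod (U \<zeta>) \<le> m"
    and \<Phi>: "\<And>\<zeta>. \<zeta> \<in> strip d \<Longrightarrow> vanishing_primitive d (\<lambda>\<omega>. pulled_kernel \<zeta> \<omega> * U \<omega>) (\<Phi> \<zeta>)"
    and eq: "\<And>\<zeta>. \<zeta> \<in> strip d \<Longrightarrow> U \<zeta> = g (\<psi> \<zeta>) + \<Phi> \<zeta> \<zeta>"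
  shows "U (of_real x) = u (\<psi>r x)"
proof -
  obtain M where M: "0 < M" "\<And>\<zeta> \<omega>. \<zeta> \<in> strip d \<Longrightarrow> \<omega> \<in> strip d \<Longrightarrow> cmod (k (\<psi> \<zeta>) (\<psi> \<omega>)) \<le> M"
    using kernel_bounded by blast
  have "compact (u ` {a..b})" by (intro compact_continuous_image u_cont) simp
  then obtain Bu where Bu: "\<And>t. t \<in> {a..b} \<Longrightarrow> cmod (u t) \<le> Bu"
    by (meson compact_imp_bounded bounded_iff imageI)
  \<comment> \<open>\<open>\<phi> a\<close> is meaningless; changing \<open>e\<close> at one point does not affect the integrals.\<close>
  define e where "e = (\<lambda>t. if t = a then 0 else u t - U (of_real (\<phi> t)))"
  have "e t = 0" if t: "a < t" "t < b" for t
  proof (rule volterra_homogeneous_zero[OF M(1), where kk = "\<lambda>t s. k (of_real t) (of_real s)", OF _ _ _ _ t])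
    show "cmod (e t) \<le> Bu + m" if "a < t" "t < b" for t
      using Bu[of t] U(2)[OF of_real_strip, of "\<phi> t"] that norm_triangle_ineq4[of "u t" "U (of_real (\<phi> t))"]
      by (simp add: e_def)
    show "cmod (k (of_real t) (of_real s)) \<le> M" if "a < s" "s < b" "a < t" "t < b" for t s
      using M(2)[OF of_real_strip of_real_strip, of "\<phi> t" "\<phi> s"] that by (simp add: psi_phi)
    show "e a = 0" by (simp add: e_def)
    show "((\<lambda>s. k (of_real t) (of_real s) * e s) has_integral e t) {a..t}" if t: "a < t" "t < b" for t
    proof -
      have "continuous_on {a..t} (\<lambda>s. k (of_real t) (of_real s) * u s)"
        using k_cont[of t] u_cont t by (intro continuous_on_mult) (auto elim: continuous_on_subset)
      hence "((\<lambda>s. k (of_real t) (of_real s) * u s) has_integral (u t - g (of_real t))) {a..t}"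
        using u_eq[of t] t integrable_integral[OF integrable_continuous_real] by (force simp: algebra_simps)
      from has_integral_diff[OF this primitive_real_integral[OF \<Phi>[OF of_real_strip] t]]
      have "((\<lambda>s. k (of_real t) (of_real s) * (u s - U (of_real (\<phi> s)))) has_integral e t) {a..t}"
        using eq[OF of_real_strip, of "\<phi> t"] t by (simp add: e_def psi_phi algebra_simps)
      thus ?thesis
        by (rule has_integral_spike_finite[of "{a}", rotated 2]) (auto simp: e_def)
    qed
  qed
  from this[of "\<psi>r x"] show ?thesis
    using SE_psi_real_bounds[OF ab, of x] by (simp add: e_def SE_phi_psi[OF ab])
qed

lemma g_bounded:
  obtains B where "\<And>\<zeta>. \<zeta> \<in> strip d \<Longrightarrow> cmod (g (\<psi> \<zeta>)) \<le> B"
  using g_M psi_in_domain by (auto simp: Malpha_def Hinf_def bounded_iff)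

lemma g_holomorphic: "(\<lambda>\<zeta>. g (\<psi> \<zeta>)) holomorphic_on strip d"
  using g_M by (intro Hinf_comp_holomorphic) (simp add: Malpha_def)

lemma u_tendsto_right_end: "((\<lambda>R. u (\<psi>r R)) \<longlongrightarrow> u b) at_top"
proof (rule continuous_on_tendsto_compose[OF u_cont])
  have e: "((\<lambda>x. (b - a) * exp (- x)) \<longlongrightarrow> 0) at_top"
    by (intro tendsto_mult_right_zero filterlim_compose[OF exp_at_bot filterlim_uminus_at_bot_at_top])
  have "((\<lambda>x. \<psi>r x - b) \<longlongrightarrow> 0) at_top"
    by (rule Lim_null_comparison[OF _ e])
       (use SE_psi_sub_right_le_exp[OF ab] SE_psi_real_bounds(2)[OF ab] in
         \<open>auto intro!: always_eventually simp: abs_of_neg\<close>)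
  thus "(\<psi>r \<longlongrightarrow> b) at_top" by (simp add: LIM_zero_iff)
  show "b \<in> {a..b}" using ab by simp
  show "\<forall>\<^sub>F x in at_top. \<psi>r x \<in> {a..b}"
    using SE_psi_real_bounds[OF ab] by (auto intro!: always_eventually simp: less_imp_le)
qed

text \<open>
  At the right end the value \<open>u b\<close> is reached as the limit of \<open>U R = u (\<psi> R)\<close> for real \<open>R \<rightarrow> \<infinity>\<close>.
\<close>

lemma solution_end_decay:
  assumes M: "0 < M" "\<And>\<zeta> \<omega>. \<zeta> \<in> strip d \<Longrightarrow> \<omega> \<in> strip d \<Longrightarrow> cmod (k (\<psi> \<zeta>) (\<psi> \<omega>)) \<le> M"
    and U: "U holomorphic_on strip d" "\<And>\<zeta>. \<zeta> \<in> strip d \<Longrightarrow> cmod (U \<zeta>) \<le> m"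
    and \<Phi>: "\<And>\<zeta>. \<zeta> \<in> strip d \<Longrightarrow> vanishing_primitive d (\<lambda>\<omega>. pulled_kernel \<zeta> \<omega> * U \<omega>) (\<Phi> \<zeta>)"
    and eq: "\<And>\<zeta>. \<zeta> \<in> strip d \<Longrightarrow> U \<zeta> = g (\<psi> \<zeta>) + \<Phi> \<zeta> \<zeta>"
  obtains K where "0 \<le> K"
    "\<And>\<zeta>. \<zeta> \<in> strip d \<Longrightarrow> Re \<zeta> \<le> 0 \<Longrightarrow> cmod (U \<zeta> - u a) \<le> K * exp (- \<alpha> * \<bar>Re \<zeta>\<bar>)"
    "\<And>\<zeta>. \<zeta> \<in> strip d \<Longrightarrow> 0 \<le> Re \<zeta> \<Longrightarrow> cmod (U \<zeta> - u b) \<le> K * exp (- \<alpha> * \<bar>Re \<zeta>\<bar>)"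
proof -
  interpret strip_kernel d "b - a" "b - a" "\<lambda>x. \<psi>r x - a" \<psi>r' pulled_kernel "M / (cos (d / 2))\<^sup>2"
    by (rule pulled_kernel_strip_kernel[OF M])
  let ?C = "M / (cos (d / 2))\<^sup>2"
  obtain Lg Lk where L: "0 \<le> Lg" "0 \<le> Lk"
    and Lga: "\<And>\<zeta>. \<zeta> \<in> strip d \<Longrightarrow> cmod (g (\<psi> \<zeta>) - g (of_real a)) \<le> Lg * cmod (\<psi> \<zeta> - of_real a) powr \<alpha>"
    and Lgb: "\<And>\<zeta>. \<zeta> \<in> strip d \<Longrightarrow> cmod (g (of_real b) - g (\<psi> \<zeta>)) \<le> Lg * cmod (of_real b - \<psi> \<zeta>) powr \<alpha>"
    and Lkb: "\<And>\<zeta> \<omega>. \<zeta> \<in> strip d \<Longrightarrow> \<omega> \<in> strip d \<Longrightarrow>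
        cmod (k (of_real b) (\<psi> \<omega>) - k (\<psi> \<zeta>) (\<psi> \<omega>)) \<le> Lk * cmod (of_real b - \<psi> \<zeta>) powr \<alpha>"
    using Hoelder_constants by metis
  have m0: "0 \<le> m" using U(2)[OF of_real_strip] norm_ge_zero order_trans by blast
  define K1 where "K1 = Lg * end_distance_bound + ?C * m * (b - a)"
  define H2 where "H2 = 2 * (Lk * end_distance_bound) / (cos (d / 2))\<^sup>2"
  define K2 where "K2 = 2 * (Lg * end_distance_bound) + H2 * m * (b - a) + ?C * m * (b - a) * d + ?C * m * (b - a)"
  have H2: "0 \<le> H2" unfolding H2_def using L end_distance_bound_nonneg by simp
  have K1: "0 \<le> K1" unfolding K1_def using L end_distance_bound_nonneg M m0 ab by simp
  have K2: "0 \<le> K2" unfolding K2_def using L end_distance_bound_nonneg M m0 ab H2 d by simp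
  have left: "cmod (U \<zeta> - u a) \<le> K1 * exp (\<alpha> * Re \<zeta>)" if \<zeta>: "\<zeta> \<in> strip d" "Re \<zeta> \<le> 0" for \<zeta>
    unfolding K1_def u_left_end
  proof (rule solution_near_left_end[OF U(2) \<Phi> eq \<zeta> \<alpha>(2)])
    show "cmod (g (\<psi> \<zeta>) - g (of_real a)) \<le> Lg * end_distance_bound * exp (\<alpha> * Re \<zeta>)"
      using Lga[OF \<zeta>(1)] mult_left_mono[OF left_distance(2)[OF \<zeta>(1)] L(1)] by (simp add: mult_ac)
    show "\<psi>r (Re \<zeta>) - a \<le> (b - a) * exp (Re \<zeta>)" by (rule SE_psi_sub_left_le_exp[OF ab])
  qed
  have right: "cmod (U \<zeta> - u b) \<le> K2 * exp (- \<alpha> * Re \<zeta>)" if \<zeta>: "\<zeta> \<in> strip d" "0 \<le> Re \<zeta>" for \<zeta>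
  proof -
    have R: "cmod (U \<zeta> - U (of_real R)) \<le> K2 * exp (- \<alpha> * Re \<zeta>)" if R: "Re \<zeta> \<le> R" for R
      unfolding K2_def
    proof (rule solution_near_right_end[OF U(2) \<Phi> eq \<zeta> R \<alpha>(2) _ _ H2])
      have eR: "exp (- \<alpha> * R) \<le> exp (- \<alpha> * Re \<zeta>)" using R \<alpha> by simp
      have b1: "c * cmod (of_real b - \<psi> \<zeta>) powr \<alpha> \<le> c * end_distance_bound * exp (- \<alpha> * Re \<zeta>)" if "0 \<le> c" for c
        using mult_left_mono[OF right_distance(2)[OF \<zeta>(1)] that] by (simp add: mult_ac)
      have b2: "c * cmod (of_real b - \<psi> (of_real R)) powr \<alpha> \<le> c * end_distance_bound * exp (- \<alpha> * Re \<zeta>)" if "0 \<le> c" for c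
      proof -
        have "cmod (of_real b - \<psi> (of_real R)) powr \<alpha> \<le> end_distance_bound * exp (- \<alpha> * R)"
          using right_distance(2)[OF of_real_strip, of R] by simp
        also have "\<dots> \<le> end_distance_bound * exp (- \<alpha> * Re \<zeta>)" using eR end_distance_bound_nonneg by (rule mult_left_mono)
        finally show ?thesis using that by (simp add: mult_left_mono mult.assoc)
      qed
      have "cmod (g (\<psi> \<zeta>) - g (\<psi> (of_real R))) \<le> cmod (g (of_real b) - g (\<psi> (of_real R))) + cmod (g (of_real b) - g (\<psi> \<zeta>))"
        using norm_triangle_ineq4[of "g (of_real b) - g (\<psi> (of_real R))" "g (of_real b) - g (\<psi> \<zeta>)"] by simp
      thus "cmod (g (\<psi> \<zeta>) - g (\<psi> (of_real R))) \<le> 2 * (Lg * end_distance_bound) * exp (- \<alpha> * Re \<zeta>)"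
        using Lgb[OF \<zeta>(1)] Lgb[OF of_real_strip, of R] b1[OF L(1)] b2[OF L(1)] by linarith
      show "cmod (pulled_kernel \<zeta> \<omega> - pulled_kernel (of_real R) \<omega>) \<le> H2 * exp (- \<alpha> * Re \<zeta>) * \<psi>r' (Re \<omega>)"
        if \<omega>: "\<omega> \<in> strip d" for \<omega>
      proof -
        have "cmod (k (\<psi> \<zeta>) (\<psi> \<omega>) - k (\<psi> (of_real R)) (\<psi> \<omega>))
            \<le> cmod (k (of_real b) (\<psi> \<omega>) - k (\<psi> (of_real R)) (\<psi> \<omega>)) + cmod (k (of_real b) (\<psi> \<omega>) - k (\<psi> \<zeta>) (\<psi> \<omega>))"
          using norm_triangle_ineq4[of "k (of_real b) (\<psi> \<omega>) - k (\<psi> (of_real R)) (\<psi> \<omega>)" "k (of_real b) (\<psi> \<omega>) - k (\<psi> \<zeta>) (\<psi> \<omega>)"] by simp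
        hence kd: "cmod (k (\<psi> \<zeta>) (\<psi> \<omega>) - k (\<psi> (of_real R)) (\<psi> \<omega>)) \<le> 2 * (Lk * end_distance_bound) * exp (- \<alpha> * Re \<zeta>)"
          using Lkb[OF \<zeta>(1) \<omega>] Lkb[OF of_real_strip \<omega>, of R] b1[OF L(2)] b2[OF L(2)] by linarith
        have "pulled_kernel \<zeta> \<omega> - pulled_kernel (of_real R) \<omega> = (k (\<psi> \<zeta>) (\<psi> \<omega>) - k (\<psi> (of_real R)) (\<psi> \<omega>)) * \<psi>' \<omega>"
          by (simp add: pulled_kernel_def left_diff_distrib)
        also have "cmod \<dots> \<le> 2 * (Lk * end_distance_bound) * exp (- \<alpha> * Re \<zeta>) * (\<psi>r' (Re \<omega>) / (cos (d / 2))\<^sup>2)"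
          unfolding norm_mult
          by (intro mult_mono kd cmod_dpsi_le[OF ab dd \<omega>]) (use L end_distance_bound_nonneg in auto)
        finally show ?thesis by (simp add: H2_def)
      qed
      have "\<psi>r' (Re \<zeta>) \<le> (b - a) * exp (- \<bar>Re \<zeta>\<bar>)" by (rule dpsi_real_le_exp[OF ab])
      thus "\<psi>r' (Re \<zeta>) \<le> (b - a) * exp (- Re \<zeta>)" using \<zeta>(2) by simp
      show "\<psi>r R - a - (\<psi>r (Re \<zeta>) - a) \<le> (b - a) * exp (- Re \<zeta>)"
        using SE_psi_sub_right_le_exp[OF ab, of "Re \<zeta>"] SE_psi_real_bounds(2)[OF ab, of R] by linarith
    qed
    have "((\<lambda>R. cmod (U \<zeta> - u (\<psi>r R))) \<longlongrightarrow> cmod (U \<zeta> - u b)) at_top"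
      by (intro tendsto_intros u_tendsto_right_end)
    thus ?thesis
      by (rule tendsto_upperbound)
         (use R in \<open>auto intro!: eventually_mono[OF eventually_ge_at_top[of "Re \<zeta>"]] simp: solution_agrees[OF U \<Phi> eq]\<close>)
  qed
  show ?thesis
  proof (rule that[of "K1 + K2"])
    fix \<zeta> assume "\<zeta> \<in> strip d"
    show "cmod (U \<zeta> - u a) \<le> (K1 + K2) * exp (- \<alpha> * \<bar>Re \<zeta>\<bar>)" if "Re \<zeta> \<le> 0"
    proof -
      have "cmod (U \<zeta> - u a) \<le> K1 * exp (- \<alpha> * \<bar>Re \<zeta>\<bar>)" using left \<open>\<zeta> \<in> strip d\<close> that by simp
      moreover have "0 \<le> K2 * exp (- \<alpha> * \<bar>Re \<zeta>\<bar>)" using K2 by simp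
      ultimately show ?thesis unfolding distrib_right by linarith
    qed
    show "cmod (U \<zeta> - u b) \<le> (K1 + K2) * exp (- \<alpha> * \<bar>Re \<zeta>\<bar>)" if "0 \<le> Re \<zeta>"
    proof -
      have "cmod (U \<zeta> - u b) \<le> K2 * exp (- \<alpha> * \<bar>Re \<zeta>\<bar>)" using right \<open>\<zeta> \<in> strip d\<close> that by simp
      moreover have "0 \<le> K1 * exp (- \<alpha> * \<bar>Re \<zeta>\<bar>)" using K1 by simp
      ultimately show ?thesis unfolding distrib_right by linarith
    qed
  qed (use K1 K2 in simp)
qed

text \<open>
  Subtracting the linear interpolant of the end point values leaves a function that decays at both
  ends of the strip, as \<open>SE_interpolation_error\<close> requires.
\<close>

lemma reduced_solution_decay:
  assumes K: "0 \<le> K"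
    and left: "\<And>\<zeta>. \<zeta> \<in> strip d \<Longrightarrow> Re \<zeta> \<le> 0 \<Longrightarrow> cmod (U \<zeta> - u a) \<le> K * exp (- \<alpha> * \<bar>Re \<zeta>\<bar>)"
    and right: "\<And>\<zeta>. \<zeta> \<in> strip d \<Longrightarrow> 0 \<le> Re \<zeta> \<Longrightarrow> cmod (U \<zeta> - u b) \<le> K * exp (- \<alpha> * \<bar>Re \<zeta>\<bar>)"
    and \<zeta>: "\<zeta> \<in> strip d"
  shows "cmod (U \<zeta> - u a * ((of_real b - \<psi> \<zeta>) / of_real (b - a)) - u b * ((\<psi> \<zeta> - of_real a) / of_real (b - a)))
      \<le> (K + cmod (u a - u b) / cos (d / 2)) * exp (- \<alpha> * \<bar>Re \<zeta>\<bar>)" (is "cmod ?f \<le> _")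
proof -
  have ba: "complex_of_real (b - a) \<noteq> 0" using ab by simp
  let ?A = "(\<psi> \<zeta> - of_real a) / of_real (b - a)" and ?B = "(of_real b - \<psi> \<zeta>) / of_real (b - a)"
  have AB: "?A + ?B = 1" using ba by (simp add: add_divide_distrib[symmetric])
  have ex: "exp (- \<bar>Re \<zeta>\<bar>) \<le> exp (- \<alpha> * \<bar>Re \<zeta>\<bar>)"
    using \<alpha> mult_right_mono[of \<alpha> 1 "\<bar>Re \<zeta>\<bar>"] by simp
  have small: "cmod (u a - u b) * x \<le> cmod (u a - u b) / cos (d / 2) * exp (- \<alpha> * \<bar>Re \<zeta>\<bar>)"
    if x: "x \<le> exp (- \<bar>Re \<zeta>\<bar>) / cos (d / 2)" for x
  proof -
    have "x \<le> exp (- \<alpha> * \<bar>Re \<zeta>\<bar>) / cos (d / 2)" using x ex cos_half_d_pos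
      by (meson divide_right_mono less_imp_le order_trans)
    from mult_left_mono[OF this norm_ge_zero[of "u a - u b"]] show ?thesis by simp
  qed
  show ?thesis
  proof (cases "Re \<zeta> \<le> 0")
    case True
    have "V - p * B - q * A = (V - p * (A + B)) + (p - q) * A" for V p q A B :: complex
      by (simp add: algebra_simps)
    hence "?f = (U \<zeta> - u a * (?A + ?B)) + (u a - u b) * ?A" by blast
    hence f: "?f = (U \<zeta> - u a) + (u a - u b) * ?A" by (simp only: AB mult_1_right)
    have "cmod ?A \<le> exp (- \<bar>Re \<zeta>\<bar>) / cos (d / 2)"
      using left_distance(1)[OF \<zeta>] ab True unfolding norm_divide norm_of_real
      by (simp add: pos_divide_le_eq mult_ac)
    from small[OF this] left[OF \<zeta> True] show ?thesis
      unfolding f distrib_right using norm_triangle_ineq[of "U \<zeta> - u a" "(u a - u b) * ?A"]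
      unfolding norm_mult by linarith
  next
    case False
    have "V - p * B - q * A = (V - q * (A + B)) - (p - q) * B" for V p q A B :: complex
      by (simp add: algebra_simps)
    hence "?f = (U \<zeta> - u b * (?A + ?B)) - (u a - u b) * ?B" by blast
    hence f: "?f = (U \<zeta> - u b) - (u a - u b) * ?B" by (simp only: AB mult_1_right)
    have "cmod ?B \<le> exp (- \<bar>Re \<zeta>\<bar>) / cos (d / 2)"
      using right_distance(1)[OF \<zeta>] ab False unfolding norm_divide norm_of_real
      by (simp add: pos_divide_le_eq mult_ac)
    from small[OF this] right[OF \<zeta>] False show ?thesis
      unfolding f distrib_right using norm_triangle_ineq4[of "U \<zeta> - u b" "(u a - u b) * ?B"]
      unfolding norm_mult by simp
  qed
qed

end

section \<open>Convergence of the SE-Sinc-collocation method\<close>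

context volterra_SE
begin

abbreviation mesh :: "nat \<Rightarrow> real" where "mesh \<equiv> mesh_size \<alpha> d"

definition grid :: "nat \<Rightarrow> nat \<Rightarrow> real" where
  "grid N p = (real p - real N) * mesh N"

abbreviation rate :: "nat \<Rightarrow> real" where
  "rate N \<equiv> exp (- sqrt (pi * d * \<alpha> * real N))"

lemma grid_eq: "of_int (int p - int N) * mesh N = grid N p"
  by (simp add: grid_def)

lemma V_SE_carrier: "V_SE a b k h N \<in> carrier_mat (2 * N + 1) (2 * N + 1)"
  by (simp add: V_SE_def)

lemma V_SE_index:
  assumes "p < 2 * N + 1" "q < 2 * N + 1"
  shows "index_mat (V_SE a b k (mesh N) N) (p, q) =
    k (\<psi> (of_real (grid N p))) (\<psi> (of_real (grid N q))) *
    of_real (\<psi>r' ((real q - real N) * mesh N) * mesh N * delta_m1 (int p - int q))"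
proof -
  have "(int p - int N) - (int q - int N) = int p - int q" by simp
  thus ?thesis using assms
    by (simp only: V_SE_def index_mat Let_def prod.case node_def grid_eq SE_psi_of_real dpsi_eq_deriv[OF ab])
       (simp add: grid_def)
qed

text \<open>
  The inverse of the collocation matrix, if it exists, is bounded by \<open>Cs\<close> in the maximum norm.
\<close>

definition collocation_stable :: "nat \<Rightarrow> real \<Rightarrow> bool" where
  "collocation_stable N Cs \<longleftrightarrow> (\<forall>e Y p. e \<in> carrier_vec (2 * N + 1) \<longrightarrow>
     (\<forall>p<2 * N + 1. cmod (vec_index (mult_mat_vec (1\<^sub>m (2 * N + 1) - V_SE a b k (mesh N) N) e) p) \<le> Y) \<longrightarrow>
     p < 2 * N + 1 \<longrightarrow> cmod (vec_index e p) \<le> Cs * Y)"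

lemma collocation_stableD:
  assumes "collocation_stable N Cs" "e \<in> carrier_vec (2 * N + 1)"
    and "\<And>p. p < 2 * N + 1 \<Longrightarrow>
        cmod (vec_index (mult_mat_vec (1\<^sub>m (2 * N + 1) - V_SE a b k (mesh N) N) e) p) \<le> Y"
    and "p < 2 * N + 1"
  shows "cmod (vec_index e p) \<le> Cs * Y"
  using assms unfolding collocation_stable_def by blast

lemma discrete_stability:
  obtains N0 Cs where "0 < N0" "0 \<le> Cs" "\<forall>N\<ge>N0. collocation_stable N Cs"
proof -
  obtain M where M: "0 < M" "\<And>\<zeta> \<omega>. \<zeta> \<in> strip d \<Longrightarrow> \<omega> \<in> strip d \<Longrightarrow> cmod (k (\<psi> \<zeta>) (\<psi> \<omega>)) \<le> M"
    by (rule kernel_bounded) blast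
  obtain N0 Cs where N0: "0 < N0" and Cs: "0 \<le> Cs"
    and st: "\<And>N (\<kappa> :: nat \<Rightarrow> nat \<Rightarrow> complex) (x :: nat \<Rightarrow> complex) Y p.
      \<lbrakk>N0 \<le> N; \<And>p q. p \<le> 2 * N \<Longrightarrow> q \<le> 2 * N \<Longrightarrow> cmod (\<kappa> p q) \<le> M;
        \<And>p. p \<le> 2 * N \<Longrightarrow> cmod (x p - (\<Sum>q\<le>2 * N. \<kappa> p q *
          of_real (\<psi>r' ((real q - real N) * mesh N) * mesh N * delta_m1 (int p - int q)) * x q)) \<le> Y;
        p \<le> 2 * N\<rbrakk> \<Longrightarrow> cmod (x p) \<le> Cs * Y"
    by (rule sinc_volterra_stability[OF dpsi_real_nonneg[OF ab] dpsi_real_le_exp[OF ab]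
        mesh_size_pos[OF \<alpha>(1) dd(1)] mesh_size_tendsto_0[OF \<alpha>(1) dd(1)] less_imp_le[OF M(1)]]) blast+
  show ?thesis
  proof (rule that[OF N0 Cs], unfold collocation_stable_def, intro allI impI)
    fix N e Y p
    assume N: "N0 \<le> N" and e: "e \<in> carrier_vec (2 * N + 1)" and p: "p < 2 * N + 1"
      and "\<forall>p<2 * N + 1. cmod (vec_index (mult_mat_vec (1\<^sub>m (2 * N + 1) - V_SE a b k (mesh N) N) e) p) \<le> Y"
    hence res: "\<And>p. p < 2 * N + 1 \<Longrightarrow>
        cmod (vec_index (mult_mat_vec (1\<^sub>m (2 * N + 1) - V_SE a b k (mesh N) N) e) p) \<le> Y" by blast
    show "cmod (vec_index e p) \<le> Cs * Y"
    proof (rule st[OF N, where \<kappa> = "\<lambda>p q. k (\<psi> (of_real (grid N p))) (\<psi> (of_real (grid N q)))"])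
      show "cmod (k (\<psi> (of_real (grid N p))) (\<psi> (of_real (grid N q)))) \<le> M" for p q
        by (rule M(2)) (rule of_real_strip)+
      fix p assume "p \<le> 2 * N"
      hence p: "p < 2 * N + 1" by simp
      have "(\<Sum>q\<le>2 * N. k (\<psi> (of_real (grid N p))) (\<psi> (of_real (grid N q))) *
          of_real (\<psi>r' ((real q - real N) * mesh N) * mesh N * delta_m1 (int p - int q)) * vec_index e q)
        = (\<Sum>q<2 * N + 1. index_mat (V_SE a b k (mesh N) N) (p, q) * vec_index e q)"
        by (intro sum.cong) (auto simp: V_SE_index[OF p])
      thus "cmod (vec_index e p - (\<Sum>q\<le>2 * N. k (\<psi> (of_real (grid N p))) (\<psi> (of_real (grid N q))) *
          of_real (\<psi>r' ((real q - real N) * mesh N) * mesh N * delta_m1 (int p - int q)) * vec_index e q)) \<le> Y"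
        using res[OF p] unfolding one_minus_mat_mult_vec_index[OF V_SE_carrier e p] by simp
    qed (use p in simp)
  qed
qed

lemma collocation_matrix_invertible:
  obtains N0 where "0 < N0" "\<And>N. N0 \<le> N \<Longrightarrow> invertible_mat (1\<^sub>m (2 * N + 1) - V_SE a b k (mesh N) N)"
proof -
  obtain N0 Cs where N0: "0 < N0" and st: "\<forall>N\<ge>N0. collocation_stable N Cs"
    by (rule discrete_stability) blast
  have "invertible_mat (1\<^sub>m (2 * N + 1) - V_SE a b k (mesh N) N)" if N: "N0 \<le> N" for N
  proof (rule injective_mat_invertible)
    show "1\<^sub>m (2 * N + 1) - V_SE a b k (mesh N) N \<in> carrier_mat (2 * N + 1) (2 * N + 1)"
      by (rule minus_carrier_mat[OF V_SE_carrier])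
    fix v assume v: "v \<in> carrier_vec (2 * N + 1)"
      and z: "mult_mat_vec (1\<^sub>m (2 * N + 1) - V_SE a b k (mesh N) N) v = 0\<^sub>v (2 * N + 1)"
    have "cmod (vec_index v p) \<le> Cs * 0" if "p < 2 * N + 1" for p
      by (rule collocation_stableD[OF st[rule_format, OF N] v _ that]) (simp only: z index_zero_vec norm_zero order_refl)
    thus "v = 0\<^sub>v (2 * N + 1)" using v by (intro eq_vecI) auto
  qed
  thus ?thesis using that N0 by blast
qed

text \<open>
  The residual of the exact values in row \<open>p\<close> is the error of Sinc indefinite integration, at the
  node \<open>p\<close>, for the integrand \<open>pulled_kernel (grid N p) \<omega> * U \<omega>\<close>.
\<close>

lemma collocation_residual:
  assumes M: "0 < M" "\<And>\<zeta> \<omega>. \<zeta> \<in> strip d \<Longrightarrow> \<omega> \<in> strip d \<Longrightarrow> cmod (k (\<psi> \<zeta>) (\<psi> \<omega>)) \<le> M"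
    and U: "U holomorphic_on strip d" "\<And>\<zeta>. \<zeta> \<in> strip d \<Longrightarrow> cmod (U \<zeta>) \<le> m"
    and \<Phi>: "\<And>\<zeta>. \<zeta> \<in> strip d \<Longrightarrow> vanishing_primitive d (\<lambda>\<omega>. pulled_kernel \<zeta> \<omega> * U \<omega>) (\<Phi> \<zeta>)"
    and eq: "\<And>\<zeta>. \<zeta> \<in> strip d \<Longrightarrow> U \<zeta> = g (\<psi> \<zeta>) + \<Phi> \<zeta> \<zeta>"
  obtains Cq where "0 \<le> Cq" "\<And>N p. 0 < N \<Longrightarrow> p < 2 * N + 1 \<Longrightarrow>
    cmod (vec_index (mult_mat_vec (1\<^sub>m (2 * N + 1) - V_SE a b k (mesh N) N)
        (vec (2 * N + 1) (\<lambda>p. u (\<psi>r (grid N p))))) p - vec_index (g_vec a b g (mesh N) N) p) \<le> Cq * rate N"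
proof -
  interpret strip_kernel d "b - a" "b - a" "\<lambda>x. \<psi>r x - a" \<psi>r' pulled_kernel "M / (cos (d / 2))\<^sup>2"
    by (rule pulled_kernel_strip_kernel[OF M])
  let ?C = "M / (cos (d / 2))\<^sup>2"
  have m0: "0 \<le> m" using U(2)[OF of_real_strip] norm_ge_zero order_trans by blast
  have "0 \<le> ?C * m * (b - a)" using M m0 ab by simp
  note err = SE_indefinite_integral_error[OF \<alpha>(1) dd(1) this \<alpha>(2)]
  obtain Cq where Cq: "0 \<le> Cq" and er: "\<And>N x F p. \<lbrakk>0 < N; F holomorphic_on strip d;
      \<And>\<zeta>. \<zeta> \<in> strip d \<Longrightarrow> cmod (F \<zeta>) \<le> ?C * m * (b - a) * exp (- \<bar>Re \<zeta>\<bar>); vanishing_primitive d F p\<rbrakk> \<Longrightarrow>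
    cmod (p (of_real x) - (\<Sum>j = - int N..int N. F (of_real (of_int j * mesh N)) *
        of_real (mesh N * (1 / 2 + 1 / pi * Si (pi * (x - of_int j * mesh N) / mesh N)))))
      \<le> Cq * rate N"
    by (rule err) blast
  show ?thesis
  proof (rule that[OF Cq])
    fix N p :: nat assume N: "0 < N" and p: "p < 2 * N + 1"
    let ?x = "grid N p" and ?h = "mesh N"
    have h: "0 < ?h" by (rule mesh_size_pos[OF \<alpha>(1) dd(1) N])
    define F where "F = (\<lambda>\<omega>. pulled_kernel (of_real ?x) \<omega> * U \<omega>)"
    have "F holomorphic_on strip d"
      unfolding F_def by (intro holomorphic_on_mult \<kappa>_holo2 of_real_strip U)
    moreover have "cmod (F \<zeta>) \<le> ?C * m * (b - a) * exp (- \<bar>Re \<zeta>\<bar>)" if \<zeta>: "\<zeta> \<in> strip d" for \<zeta>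
    proof -
      have "cmod (F \<zeta>) \<le> ?C * \<psi>r' (Re \<zeta>) * m"
        unfolding F_def norm_mult
        by (intro mult_mono \<kappa>_bound of_real_strip \<zeta> U mult_nonneg_nonneg[OF less_imp_le[OF C] \<rho>(1)]) auto
      also have "\<dots> = ?C * m * \<psi>r' (Re \<zeta>)" by (simp only: mult_ac)
      also have "\<dots> \<le> ?C * m * ((b - a) * exp (- \<bar>Re \<zeta>\<bar>))"
        by (intro mult_left_mono dpsi_real_le_exp[OF ab] mult_nonneg_nonneg m0 less_imp_le[OF C])
      finally show ?thesis by (simp only: mult.assoc)
    qed
    moreover have "vanishing_primitive d F (\<Phi> (of_real ?x))"
      unfolding F_def by (rule \<Phi>[OF of_real_strip])
    ultimately have e: "cmod (\<Phi> (of_real ?x) (of_real ?x) - (\<Sum>j = - int N..int N. F (of_real (of_int j * ?h)) *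
        of_real (?h * (1 / 2 + 1 / pi * Si (pi * (?x - of_int j * ?h) / ?h))))) \<le> Cq * rate N"
      by (rule er[OF N])
    have "(\<Sum>j = - int N..int N. F (of_real (of_int j * ?h)) *
        of_real (?h * (1 / 2 + 1 / pi * Si (pi * (?x - of_int j * ?h) / ?h))))
      = (\<Sum>q<2 * N + 1. F (of_real (of_int (int q - int N) * ?h)) *
        of_real (?h * (1 / 2 + 1 / pi * Si (pi * (?x - of_int (int q - int N) * ?h) / ?h))))"
      by (rule sum.reindex_bij_witness[of _ "\<lambda>q. int q - int N" "\<lambda>j. nat (j + int N)"]) auto
    also have "\<dots> = (\<Sum>q<2 * N + 1. index_mat (V_SE a b k ?h N) (p, q) * u (\<psi>r (grid N q)))"
    proof (rule sum.cong[OF refl])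
      fix q assume "q \<in> {..<2 * N + 1}"
      hence q: "q < 2 * N + 1" by simp
      have "(?x - of_int (int q - int N) * ?h) = of_int (int p - int q) * ?h"
        by (simp add: grid_def algebra_simps)
      hence "pi * (?x - of_int (int q - int N) * ?h) / ?h = pi * of_int (int p - int q)"
        using h by simp
      hence \<delta>: "?h * (1 / 2 + 1 / pi * Si (pi * (?x - of_int (int q - int N) * ?h) / ?h)) = ?h * delta_m1 (int p - int q)"
        by (simp only: delta_m1_def)
      have Uq: "U (of_real (grid N q)) = u (\<psi>r (grid N q))" by (rule solution_agrees[OF U \<Phi> eq])
      show "F (of_real (of_int (int q - int N) * ?h)) *
          of_real (?h * (1 / 2 + 1 / pi * Si (pi * (?x - of_int (int q - int N) * ?h) / ?h)))
        = index_mat (V_SE a b k ?h N) (p, q) * u (\<psi>r (grid N q))"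
        unfolding \<delta> unfolding grid_eq F_def Uq V_SE_index[OF p q] pulled_kernel_def dpsi_of_real grid_def[of N q, symmetric]
        by (simp add: mult_ac)
    qed
    finally have s: "(\<Sum>j = - int N..int N. F (of_real (of_int j * ?h)) *
        of_real (?h * (1 / 2 + 1 / pi * Si (pi * (?x - of_int j * ?h) / ?h))))
      = (\<Sum>q<2 * N + 1. index_mat (V_SE a b k ?h N) (p, q) * u (\<psi>r (grid N q)))" .
    have 1: "\<Phi> (of_real ?x) (of_real ?x) = u (\<psi>r ?x) - g (\<psi> (of_real ?x))"
      using eq[OF of_real_strip, of ?x] solution_agrees[OF U \<Phi> eq, of ?x] by simp
    have 2: "vec_index (g_vec a b g ?h N) p = g (\<psi> (of_real ?x))"
      using p by (simp only: g_vec_def index_vec node_def grid_eq SE_psi_of_real)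
    have 3: "vec_index (mult_mat_vec (1\<^sub>m (2 * N + 1) - V_SE a b k ?h N) (vec (2 * N + 1) (\<lambda>p. u (\<psi>r (grid N p))))) p
        = u (\<psi>r ?x) - (\<Sum>q<2 * N + 1. index_mat (V_SE a b k ?h N) (p, q) * u (\<psi>r (grid N q)))"
      using p by (subst one_minus_mat_mult_vec_index[OF V_SE_carrier _ p]) auto
    have "u (\<psi>r ?x) - y - g (\<psi> (of_real ?x)) = u (\<psi>r ?x) - g (\<psi> (of_real ?x)) - y" for y by simp
    thus "cmod (vec_index (mult_mat_vec (1\<^sub>m (2 * N + 1) - V_SE a b k ?h N)
        (vec (2 * N + 1) (\<lambda>p. u (\<psi>r (grid N p))))) p - vec_index (g_vec a b g ?h N) p) \<le> Cq * rate N"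
      using e unfolding s 1 2 3 by (simp only:)
  qed
qed

text \<open>
  Four contributions to the error: interpolation of the reduced solution, replacement of each of the
  two end point values \<open>ua\<close>, \<open>ub\<close> by the outermost coefficients \<open>x\<close>, \<open>y\<close>, and the errors \<open>v j - c j\<close> at
  the nodes.
\<close>

lemma interpolant_error_identity:
  fixes t x y z :: complex and A B :: complex and s p q :: "int \<Rightarrow> complex"
  shows "t - (x * A + y * B + (\<Sum>j\<in>J. (c j - x * p j - y * q j) * s j))
    = (t - ua * A - ub * B - (\<Sum>j\<in>J. (v j - ua * p j - ub * q j) * s j))
      + (ua - x) * (A - (\<Sum>j\<in>J. p j * s j)) + (ub - y) * (B - (\<Sum>j\<in>J. q j * s j))
      + (\<Sum>j\<in>J. (v j - c j) * s j)"
  by (simp add: algebra_simps sum.distrib sum_subtractf sum_distrib_left)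

text \<open>
  The four terms of \<open>interpolant_error_identity\<close> are estimated by \<open>SE_interpolation_error\<close>, by the
  decay of \<open>U\<close> towards its end point values (the outermost nodes are at distance \<open>N * h\<close> from \<open>0\<close>) and by
  stability and consistency. All but the first are multiplied by the Lebesgue constant. At the end points
  of the interval all sinc functions vanish, and the approximation equals an outermost coefficient.
\<close>

lemma SE_approximation_error:
  obtains N0 C where "0 < N0"
    "\<And>N c t. \<lbrakk>N0 \<le> N; SE_solution a b k g (mesh N) N c; t \<in> {a..b}\<rbrakk> \<Longrightarrow>
      cmod (u t - v_SE a b (mesh N) N c t) \<le> C * sqrt (real N) * rate N"
proof -
  obtain M where M: "0 < M" "\<And>\<zeta> \<omega>. \<zeta> \<in> strip d \<Longrightarrow> \<omega> \<in> strip d \<Longrightarrow> cmod (k (\<psi> \<zeta>) (\<psi> \<omega>)) \<le> M"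
    by (rule kernel_bounded) blast
  interpret strip_kernel d "b - a" "b - a" "\<lambda>x. \<psi>r x - a" \<psi>r' pulled_kernel "M / (cos (d / 2))\<^sup>2"
    by (rule pulled_kernel_strip_kernel[OF M])
  obtain Bg where Bg: "\<And>\<zeta>. \<zeta> \<in> strip d \<Longrightarrow> cmod (g (\<psi> \<zeta>)) \<le> Bg" by (rule g_bounded) blast
  obtain U \<Phi> m where U: "U holomorphic_on strip d" "\<And>\<zeta>. \<zeta> \<in> strip d \<Longrightarrow> cmod (U \<zeta>) \<le> m"
    and \<Phi>: "\<And>\<zeta>. \<zeta> \<in> strip d \<Longrightarrow> vanishing_primitive d (\<lambda>\<omega>. pulled_kernel \<zeta> \<omega> * U \<omega>) (\<Phi> \<zeta>)"
    and eq: "\<And>\<zeta>. \<zeta> \<in> strip d \<Longrightarrow> U \<zeta> = g (\<psi> \<zeta>) + \<Phi> \<zeta> \<zeta>"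
  proof (rule volterra_equation_holomorphic_solution[OF g_holomorphic Bg], goal_cases)
    case (2 U \<Phi> m)
    show ?case by (rule 2(1)[OF 2(2-)])
  qed
  have Uu: "U (of_real x) = u (\<psi>r x)" for x
    by (rule solution_agrees[OF U \<Phi> eq])
  obtain K where K: "0 \<le> K"
    and left: "\<And>\<zeta>. \<zeta> \<in> strip d \<Longrightarrow> Re \<zeta> \<le> 0 \<Longrightarrow> cmod (U \<zeta> - u a) \<le> K * exp (- \<alpha> * \<bar>Re \<zeta>\<bar>)"
    and right: "\<And>\<zeta>. \<zeta> \<in> strip d \<Longrightarrow> 0 \<le> Re \<zeta> \<Longrightarrow> cmod (U \<zeta> - u b) \<le> K * exp (- \<alpha> * \<bar>Re \<zeta>\<bar>)"
  proof (rule solution_end_decay[OF M U \<Phi> eq], goal_cases)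
    case 6
    show ?case by (rule 6(1)[OF 6(2-)])
  qed
  define F where "F = (\<lambda>\<zeta>. U \<zeta> - u a * ((of_real b - \<psi> \<zeta>) / of_real (b - a)) - u b * ((\<psi> \<zeta> - of_real a) / of_real (b - a)))"
  have ba: "complex_of_real (b - a) \<noteq> 0" using ab by simp
  have Fh: "F holomorphic_on strip d"
    unfolding F_def using ba by (intro holomorphic_intros U SE_psi_holomorphic[OF dd])
  define KF where "KF = K + cmod (u a - u b) / cos (d / 2)"
  have KF: "0 \<le> KF" unfolding KF_def using K cos_half_d_pos by simp
  have Fb: "cmod (F \<zeta>) \<le> KF * exp (- \<alpha> * \<bar>Re \<zeta>\<bar>)" if "\<zeta> \<in> strip d" for \<zeta>
    unfolding F_def KF_def by (rule reduced_solution_decay[OF K left right that])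
  obtain Ci where Ci: "0 \<le> Ci" and ie: "\<And>N x. 0 < N \<Longrightarrow>
      cmod (F (of_real x) - (\<Sum>j = - int N..int N. F (of_real (of_int j * mesh N)) * of_real (S j (mesh N) x)))
        \<le> Ci * sqrt (real N) * rate N"
  proof (rule SE_interpolation_error[OF \<alpha>(1) dd(1) Fh KF Fb], goal_cases)
    case 2
    show ?case by (rule 2(1)[OF 2(2-)])
  qed
  obtain Cq where Cq: "0 \<le> Cq" and res: "\<And>N p. 0 < N \<Longrightarrow> p < 2 * N + 1 \<Longrightarrow>
    cmod (vec_index (mult_mat_vec (1\<^sub>m (2 * N + 1) - V_SE a b k (mesh N) N)
        (vec (2 * N + 1) (\<lambda>p. u (\<psi>r (grid N p))))) p - vec_index (g_vec a b g (mesh N) N) p) \<le> Cq * rate N"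
  proof (rule collocation_residual[OF M U \<Phi> eq], goal_cases)
    case 6
    show ?case by (rule 6(1)[OF 6(2-)])
  qed
  obtain N0 Cs where N0: "0 < N0" and Cs: "0 \<le> Cs"
    and st: "\<forall>N\<ge>N0. collocation_stable N Cs"
    by (rule discrete_stability) blast
  define Cn where "Cn = Cs * Cq"
  have Cn: "0 \<le> Cn" unfolding Cn_def using Cs Cq by simp
  define C where "C = Ci + 2 * ((K + Cn) * 5) + Cn * 4"
  have main: "cmod (u t - v_SE a b (mesh N) N c t) \<le> C * sqrt (real N) * rate N"
    if N: "N0 \<le> N" and c: "SE_solution a b k g (mesh N) N c" and t: "t \<in> {a..b}" for N c t
  proof -
    have N1: "0 < N" using N N0 by simp
    have sN: "1 \<le> sqrt (real N)" using N1 by simp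
    let ?h = "mesh N" and ?E = "rate N"
    have h: "0 < ?h" by (rule mesh_size_pos[OF \<alpha>(1) dd(1) N1])
    have cc: "c \<in> carrier_vec (2 * N + 1)"
      and ceq: "mult_mat_vec (1\<^sub>m (2 * N + 1) - V_SE a b k ?h N) c = g_vec a b g ?h N"
      using c by (auto simp: SE_solution_def)
    define J where "J = {- int N..int N}"
    define cj where "cj = (\<lambda>j::int. vec_index c (nat (j + int N)))"
    define uj where "uj = (\<lambda>j::int. u (\<psi>r (of_int j * ?h)))"
    have node_err: "cmod (uj j - cj j) \<le> Cn * ?E" if j: "j \<in> J" for j
    proof -
      let ?A = "1\<^sub>m (2 * N + 1) - V_SE a b k ?h N"
      let ?w = "vec (2 * N + 1) (\<lambda>p. u (\<psi>r (grid N p)))"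
      define p where "p = nat (j + int N)"
      have p: "p < 2 * N + 1" and jp: "j = int p - int N" using j by (auto simp: p_def J_def)
      have A: "?A \<in> carrier_mat (2 * N + 1) (2 * N + 1)" by (rule minus_carrier_mat[OF V_SE_carrier])
      have w: "?w \<in> carrier_vec (2 * N + 1)" by simp
      have "cmod (vec_index (?w - c) p) \<le> Cs * (Cq * ?E)"
      proof (rule collocation_stableD[OF st[rule_format, OF N] _ _ p])
        show "?w - c \<in> carrier_vec (2 * N + 1)" using cc by simp
        fix p assume p: "p < 2 * N + 1"
        have "mult_mat_vec ?A (?w - c) = mult_mat_vec ?A ?w - g_vec a b g ?h N"
          using mult_minus_distrib_mat_vec[OF A w cc] ceq by simp
        moreover have "dim_vec (g_vec a b g ?h N) = 2 * N + 1" by (simp add: g_vec_def)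
        ultimately show "cmod (vec_index (mult_mat_vec ?A (?w - c)) p) \<le> Cq * ?E"
          using res[OF N1 p] p by simp
      qed
      moreover have "vec_index (?w - c) p = uj j - cj j"
      proof -
        have "uj j = u (\<psi>r (grid N p))" by (simp only: uj_def jp grid_eq)
        moreover have "cj j = vec_index c p" by (simp add: cj_def jp)
        ultimately show ?thesis using p cc by simp
      qed
      ultimately show ?thesis by (simp add: Cn_def mult.assoc)
    qed
    have J_ends: "- int N \<in> J" "int N \<in> J" by (auto simp: J_def)
    have rate_eq: "exp (- \<alpha> * (real N * ?h)) = ?E"
      using mesh_size_exponents(2)[OF \<alpha>(1) dd(1) N1] by simp
    have end_a: "cmod (u a - cj (- int N)) \<le> (K + Cn) * ?E"
    proof -
      have x: "real_of_int (- int N) * ?h \<le> 0" using h by simp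
      have "cmod (U (of_real (of_int (- int N) * ?h)) - u a) \<le> K * exp (- \<alpha> * \<bar>of_int (- int N) * ?h\<bar>)"
        by (rule left[OF of_real_strip, of "of_int (- int N) * ?h", unfolded Re_complex_of_real, OF x])
      moreover have "\<bar>of_int (- int N) * ?h\<bar> = real N * ?h" using h by (simp add: abs_mult)
      ultimately have "cmod (uj (- int N) - u a) \<le> K * ?E"
        by (simp only: uj_def Uu rate_eq)
      moreover have "cmod (uj (- int N) - cj (- int N)) \<le> Cn * ?E" by (rule node_err[OF J_ends(1)])
      ultimately show ?thesis
        using norm_triangle_ineq4[of "uj (- int N) - cj (- int N)" "uj (- int N) - u a"]
        unfolding distrib_right by simp
    qed
    have end_b: "cmod (u b - cj (int N)) \<le> (K + Cn) * ?E"
    proof -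
      have x: "0 \<le> real_of_int (int N) * ?h" using h by simp
      have "cmod (U (of_real (of_int (int N) * ?h)) - u b) \<le> K * exp (- \<alpha> * \<bar>of_int (int N) * ?h\<bar>)"
        by (rule right[OF of_real_strip, of "of_int (int N) * ?h", unfolded Re_complex_of_real, OF x])
      moreover have "\<bar>of_int (int N) * ?h\<bar> = real N * ?h" using h by (simp add: abs_mult)
      ultimately have "cmod (uj (int N) - u b) \<le> K * ?E"
        by (simp only: uj_def Uu rate_eq)
      moreover have "cmod (uj (int N) - cj (int N)) \<le> Cn * ?E" by (rule node_err[OF J_ends(2)])
      ultimately show ?thesis
        using norm_triangle_ineq4[of "uj (int N) - cj (int N)" "uj (int N) - u b"]
        unfolding distrib_right by simp
    qed
    have v: "v_SE a b ?h N c t = cj (- int N) * of_real (omega_a a b t) + cj (int N) * of_real (omega_b a b t)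
        + (\<Sum>j\<in>J. (cj j - cj (- int N) * of_real (omega_a a b (\<psi>r (of_int j * ?h)))
              - cj (int N) * of_real (omega_b a b (\<psi>r (of_int j * ?h)))) * of_real (S_phi a b j ?h t))"
      by (simp only: v_SE_def Let_def cj_def J_def node_def)
    have le_C: "(K + Cn) * ?E \<le> C * sqrt (real N) * ?E"
    proof -
      have "(K + Cn) * 1 \<le> C * sqrt (real N)"
        using K Cn Ci sN unfolding C_def by (intro mult_mono) auto
      thus ?thesis by (simp add: mult_right_mono)
    qed
    consider "t = a" | "t = b" | "a < t" "t < b" using t by fastforce
    thus ?thesis
    proof cases
      case 1
      hence "v_SE a b ?h N c t = cj (- int N)"
        unfolding v using ab by (simp add: omega_a_def omega_b_def S_phi_left_end[OF ab h])
      thus ?thesis using order_trans[OF end_a le_C] by (simp only: 1)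
    next
      case 2
      hence "v_SE a b ?h N c t = cj (int N)"
        unfolding v using ab by (simp add: omega_a_def omega_b_def S_phi_right_end[OF ab h])
      thus ?thesis using order_trans[OF end_b le_C] by (simp only: 2)
    next
      case 3
      define x where "x = \<phi> t"
      have tx: "t = \<psi>r x" using SE_psi_phi[OF ab 3] by (simp add: x_def)
      let ?wa = "\<lambda>x. omega_a a b (\<psi>r x)" and ?wb = "\<lambda>x. omega_b a b (\<psi>r x)"
      have wab: "\<bar>?wa y\<bar> \<le> 1" "\<bar>?wb y\<bar> \<le> 1" for y
        using SE_psi_real_bounds[OF ab, of y] ab by (auto simp: omega_a_def omega_b_def abs_le_iff field_simps)
      have Fr: "F (of_real y) = u (\<psi>r y) - u a * of_real (?wa y) - u b * of_real (?wb y)" for y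
        unfolding F_def Uu by (simp add: omega_a_def omega_b_def SE_psi_of_real)
      have Sp: "S_phi a b j ?h t = S j ?h x" for j using 3 by (simp add: S_phi_def x_def)
      have Leb: "(\<Sum>j\<in>J. \<bar>S j ?h x\<bar>) \<le> 4 * sqrt (real N)"
        unfolding J_def by (rule sinc_Lebesgue_constant[OF h N1])
      have wsum: "cmod (of_real (w x) - (\<Sum>j\<in>J. of_real (w (of_int j * ?h)) * of_real (S j ?h x))) \<le> 5 * sqrt (real N)"
        if w: "\<And>y. \<bar>w y\<bar> \<le> 1" for w :: "real \<Rightarrow> real"
      proof -
        have "cmod (\<Sum>j\<in>J. of_real (w (of_int j * ?h)) * of_real (S j ?h x)) \<le> (\<Sum>j\<in>J. \<bar>S j ?h x\<bar>)"
        proof (rule order_trans[OF norm_sum sum_mono])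
          fix j
          show "cmod (of_real (w (of_int j * ?h)) * of_real (S j ?h x)) \<le> \<bar>S j ?h x\<bar>"
            unfolding norm_mult norm_of_real using w[of "of_int j * ?h"] by (simp add: mult_left_le_one_le)
        qed
        moreover have "cmod (of_real (w x)) \<le> 1" using w by simp
        ultimately show ?thesis
          using norm_triangle_ineq4[of "of_real (w x)" "\<Sum>j\<in>J. of_real (w (of_int j * ?h)) * complex_of_real (S j ?h x)"] Leb sN
          by linarith
      qed
      have e1: "cmod (u t - u a * of_real (?wa x) - u b * of_real (?wb x)
          - (\<Sum>j\<in>J. (uj j - u a * of_real (?wa (of_int j * ?h)) - u b * of_real (?wb (of_int j * ?h))) * of_real (S j ?h x)))
          \<le> Ci * sqrt (real N) * ?E"
        using ie[OF N1, of x] unfolding Fr J_def uj_def tx .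
      have e2: "cmod ((u a - cj (- int N)) * (of_real (?wa x) - (\<Sum>j\<in>J. of_real (?wa (of_int j * ?h)) * of_real (S j ?h x))))
          \<le> (K + Cn) * ?E * (5 * sqrt (real N))"
        unfolding norm_mult by (intro mult_mono end_a wsum wab) (use K Cn in auto)
      have e3: "cmod ((u b - cj (int N)) * (of_real (?wb x) - (\<Sum>j\<in>J. of_real (?wb (of_int j * ?h)) * of_real (S j ?h x))))
          \<le> (K + Cn) * ?E * (5 * sqrt (real N))"
        unfolding norm_mult by (intro mult_mono end_b wsum wab) (use K Cn in auto)
      have e4: "cmod (\<Sum>j\<in>J. (uj j - cj j) * of_real (S j ?h x)) \<le> Cn * ?E * (4 * sqrt (real N))"
      proof -
        have "cmod (\<Sum>j\<in>J. (uj j - cj j) * of_real (S j ?h x)) \<le> (\<Sum>j\<in>J. Cn * ?E * \<bar>S j ?h x\<bar>)"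
        proof (rule order_trans[OF norm_sum sum_mono])
          fix j assume "j \<in> J"
          thus "cmod ((uj j - cj j) * of_real (S j ?h x)) \<le> Cn * ?E * \<bar>S j ?h x\<bar>"
            unfolding norm_mult norm_of_real by (intro mult_right_mono node_err) auto
        qed
        also have "\<dots> = Cn * ?E * (\<Sum>j\<in>J. \<bar>S j ?h x\<bar>)" by (simp add: sum_distrib_left)
        also have "\<dots> \<le> Cn * ?E * (4 * sqrt (real N))" using Leb Cn by (intro mult_left_mono) auto
        finally show ?thesis .
      qed
      have "u t - v_SE a b ?h N c t =
          (u t - u a * of_real (?wa x) - u b * of_real (?wb x)
          - (\<Sum>j\<in>J. (uj j - u a * of_real (?wa (of_int j * ?h)) - u b * of_real (?wb (of_int j * ?h))) * of_real (S j ?h x)))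
        + (u a - cj (- int N)) * (of_real (?wa x) - (\<Sum>j\<in>J. of_real (?wa (of_int j * ?h)) * of_real (S j ?h x)))
        + (u b - cj (int N)) * (of_real (?wb x) - (\<Sum>j\<in>J. of_real (?wb (of_int j * ?h)) * of_real (S j ?h x)))
        + (\<Sum>j\<in>J. (uj j - cj j) * of_real (S j ?h x))"
        unfolding v Sp tx[symmetric] by (rule interpolant_error_identity)
      also have "cmod \<dots> \<le> Ci * sqrt (real N) * ?E + (K + Cn) * ?E * (5 * sqrt (real N))
          + (K + Cn) * ?E * (5 * sqrt (real N)) + Cn * ?E * (4 * sqrt (real N))"
        by (intro order_trans[OF norm_triangle_ineq] add_mono e1 e2 e3 e4)
      also have "\<dots> = C * sqrt (real N) * ?E" by (simp add: C_def algebra_simps)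
      finally show ?thesis .
    qed
  qed
  show ?thesis by (rule that[OF N0 main])
qed

end

theorem theorem4p3:
  fixes a b \<alpha> d :: real
    and g :: "complex \<Rightarrow> complex"
    and k :: "complex \<Rightarrow> complex \<Rightarrow> complex"
    and u :: "real \<Rightarrow> complex"
    and D :: "complex set"
  assumes "a < b"
    and "0 < \<alpha>" and "\<alpha> \<le> 1" and "0 < d" and "d < pi"
    and D: "D = SE_domain a b d"
    and "continuous_on {a..b} (\<lambda>t. g (of_real t))"
    and "continuous_on ({a..b} \<times> {a..b}) (\<lambda>(t, s). k (of_real t) (of_real s))"
    and "g \<in> Hinf D"
    and "\<And>z. z \<in> D \<Longrightarrow> (\<lambda>w. k z w) \<in> Hinf D"
    and "\<And>w. w \<in> D \<Longrightarrow> (\<lambda>z. k z w) \<in> Hinf D"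
    and "\<And>t. t \<in> {a..b} \<Longrightarrow> continuous_on {a..b} (\<lambda>s. k (of_real t) (of_real s))"
    and "\<And>s. s \<in> {a..b} \<Longrightarrow> continuous_on {a..b} (\<lambda>t. k (of_real t) (of_real s))"
    and "g \<in> Malpha a b \<alpha> D"
    and "Malpha_uniformly a b \<alpha> D k"
    and "volterra_solution a b k g u"
  shows "\<exists>N0>0.
    (\<forall>N\<ge>N0. invertible_mat (1\<^sub>m (2 * N + 1) - V_SE a b k (mesh_size \<alpha> d N) N)) \<and>
    (\<exists>C::real. \<forall>N\<ge>N0. \<forall>c. SE_solution a b k g (mesh_size \<alpha> d N) N c \<longrightarrow>
      uniform_norm a b (\<lambda>t. u t - v_SE a b (mesh_size \<alpha> d N) N c t)
        \<le> C * sqrt (real N) * exp (- sqrt (pi * d * \<alpha> * real N)))"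
proof -
  interpret volterra_SE a b \<alpha> d g k u
    by unfold_locales (use assms in auto)
  obtain N1 where N1: "0 < N1"
    and inv: "\<And>N. N1 \<le> N \<Longrightarrow> invertible_mat (1\<^sub>m (2 * N + 1) - V_SE a b k (mesh_size \<alpha> d N) N)"
    by (rule collocation_matrix_invertible) blast
  obtain N2 C where "0 < N2"
    and err: "\<And>N c t. \<lbrakk>N2 \<le> N; SE_solution a b k g (mesh_size \<alpha> d N) N c; t \<in> {a..b}\<rbrakk> \<Longrightarrow>
      cmod (u t - v_SE a b (mesh_size \<alpha> d N) N c t) \<le> C * sqrt (real N) * exp (- sqrt (pi * d * \<alpha> * real N))"
    by (rule SE_approximation_error) blast
  show ?thesis
  proof (intro exI[of _ "max N1 N2"] conjI allI impI exI[of _ C])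
    show "0 < max N1 N2" using N1 by simp
    show "invertible_mat (1\<^sub>m (2 * N + 1) - V_SE a b k (mesh_size \<alpha> d N) N)" if "max N1 N2 \<le> N" for N
      using inv that by simp
    fix N c assume "max N1 N2 \<le> N" and c: "SE_solution a b k g (mesh_size \<alpha> d N) N c"
    hence N: "N2 \<le> N" by simp
    show "uniform_norm a b (\<lambda>t. u t - v_SE a b (mesh_size \<alpha> d N) N c t)
        \<le> C * sqrt (real N) * exp (- sqrt (pi * d * \<alpha> * real N))"
      unfolding uniform_norm_def using \<open>a < b\<close> by (intro cSUP_least err[OF N c]) auto
  qed
qed

end
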